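(* Let $k\geqslant 2$ be a fixed integer. The symmetry group and the extended symmetry group of $(\mathbb{X}^{(k)}_{\mathrm{G}},\mathbb{Z}^2)$, the shift generated by the set $V=V^{(k)}_{\mathrm{G}}$ of $k$-free Gaussian integers, are given by $\mathcal{S}=\mathbb{Z}^2$ and $\mathcal{R}=\mathcal{S}\rtimes D_4$, respectively, where $D_4=\mathrm{stab}(V)=C_4\rtimes C_2$ is the symmetry group of the square, and as such a maximal finite subgroup of $\mathrm{GL}(2,\mathbb{Z})$. In particular, $C_4\simeq\mathbb{Z}[\mathrm{i}]^{\times}$, while $C_2$ is the group of field automorphisms of $\mathbb{Q}(\mathrm{i})$, generated by complex conjugation.
   Context: $\mathbb{Z}[\mathrm{i}]$ is identified with $\mathbb{Z}^2$ via $m+n\mathrm{i}\leftrightarrow(m,n)$. $V^{(k)}_{\mathrm{G}}$ is the set of Gaussian integers that are not divisible by the $k$-th power of any Gaussian prime. Subsets of $\mathbb{Z}^2$ are identified with elements of $\{0,1\}^{\mathbb{Z}^2}$ (product topology), and $\mathbb{X}^{(k)}_{\mathrm{G}}=\overline{\mathbb{Z}^2+V^{(k)}_{\mathrm{G}}}$ is the closure of $\{t+V^{(k)}_{\mathrm{G}} : t\in\mathbb{Z}^2\}$, with the shift action $T_t(U)=U-t$ of $\mathbb{Z}^2$. $\mathrm{stab}(V)$ is the stabiliser of $V$ in $\mathrm{GL}(2,\mathbb{Z})$. For a subshift $\mathbb{X}$, $\mathrm{Aut}(\mathbb{X})$ is the group of all homeomorphisms of $\mathbb{X}$, $\mathcal{G}=\{T_t|_{\mathbb{X}}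 : t\in\mathbb{Z}^2\}$, the symmetry group $\mathcal{S}$ is the centraliser and the extended symmetry group $\mathcal{R}$ the normaliser of $\mathcal{G}$ in $\mathrm{Aut}(\mathbb{X})$. $\mathcal{S}=\mathbb{Z}^2$ means $\mathcal{S}=\mathcal{G}\simeq\mathbb{Z}^2$. A matrix $M\in\mathrm{GL}(2,\mathbb{Z})$ acts on subsets by $U\mapsto MU$, and $\mathcal{R}=\mathcal{S}\rtimes D_4$ is understood with $D_4=\mathrm{stab}(V)$ acting in this way (so the elements of $\mathcal{R}$ are the maps $U\mapsto MU+t$ with $t\in\mathbb{Z}^2$, $M\in D_4$). $C_n$ is the cyclic group of order $n$ and $D_4$ the dihedral group of order $8$. *)

theory Defs
  imports "HOL-Analysis.Analysis" "HOL-Algebra.Algebra" "HOL-Algebra.Algebraic_Closure_Type"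
begin

definition centralizer :: "('a, 'b) monoid_scheme \<Rightarrow> 'a set \<Rightarrow> 'a set" where
  "centralizer G H = {g \<in> carrier G. \<forall>h\<in>H. g \<otimes>\<^bsub>G\<^esub> h = h \<otimes>\<^bsub>G\<^esub> g}"

text \<open>\<open>internal_semidirect G N H\<close>: the group \<open>G\<close> is the internal semidirect product of its normal
  subgroup \<open>N\<close> (the left factor) and its subgroup \<open>H\<close>.\<close>

definition internal_semidirect :: "('a, 'b) monoid_scheme \<Rightarrow> 'a set \<Rightarrow> 'a set \<Rightarrow> bool" where
  "internal_semidirect G N H \<longleftrightarrow>
     normal N G \<and> subgroup H G \<and> N \<inter> H = {\<one>\<^bsub>G\<^esub>} \<and> N <#>\<^bsub>G\<^esub> H = carrier G"

text \<open>The abstract dihedral group of order \<open>2 * n\<close> (for \<open>n > 0\<close>); the pair \<open>(a, s)\<close> stands for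
  \<open>r ^ a\<close> followed on the right by the reflection if \<open>s\<close> is true.\<close>

definition dihedral_group :: "nat \<Rightarrow> (int \<times> bool) monoid" where
  "dihedral_group n = \<lparr>carrier = {0..<int n} \<times> UNIV,
     monoid.mult = (\<lambda>(a, s) (b, t). ((a + (if s then - b else b)) mod int n, s \<noteq> t)),
     one = (0, False)\<rparr>"

definition maximal_finite_subgroup :: "'a set \<Rightarrow> ('a, 'b) monoid_scheme \<Rightarrow> bool" where
  "maximal_finite_subgroup H G \<longleftrightarrow> subgroup H G \<and> finite H \<and>
     (\<forall>K. subgroup K G \<and> finite K \<and> H \<subseteq> K \<longrightarrow> K = H)"

text \<open>As in \<^const>\<open>BijGroup\<close>, maps are undefined outside the underlying set, so that equality of maps is
  equality on that set.\<close>

definition ring_automorphism_group :: "('a, 'b) ring_scheme \<Rightarrow> ('a \<Rightarrow> 'a) monoid" where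
  "ring_automorphism_group R =
     (BijGroup (carrier R)) \<lparr>carrier := ring_iso R R \<inter> extensional (carrier R)\<rparr>"

definition homeomorphism_group :: "'a topology \<Rightarrow> ('a \<Rightarrow> 'a) monoid" where
  "homeomorphism_group T =
     (BijGroup (topspace T)) \<lparr>carrier := {f. homeomorphic_map T T f} \<inter> extensional (topspace T)\<rparr>"

definition lattice_group :: "(int ^ 2) monoid" where
  "lattice_group = \<lparr>carrier = UNIV, monoid.mult = (+), one = 0\<rparr>"

definition GL2Z :: "(int ^ 2 ^ 2) monoid" where
  "GL2Z = \<lparr>carrier = {M. invertible M}, monoid.mult = (**), one = mat 1\<rparr>"

definition stab :: "(int ^ 2) set \<Rightarrow> (int ^ 2 ^ 2) set" where
  "stab V = stabilizer GL2Z (\<lambda>M U. (\<lambda>x. M *v x) ` U) V"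

abbreviation stab_group :: "(int ^ 2) set \<Rightarrow> (int ^ 2 ^ 2) monoid" where
  "stab_group V \<equiv> GL2Z \<lparr>carrier := stab V\<rparr>"

text \<open>The product topology on \<open>{0,1}\<close>-valued configurations, transported to subsets of the lattice
  along indicator functions.\<close>

definition config_topology :: "(int ^ 2) set topology" where
  "config_topology = pullback_topology UNIV (\<lambda>U x. x \<in> U)
     (product_topology (\<lambda>_. discrete_topology (UNIV :: bool set)) UNIV)"

definition shift_hull :: "(int ^ 2) set \<Rightarrow> (int ^ 2) set set" where
  "shift_hull V = config_topology closure_of {(\<lambda>x. t + x) ` V | t. True}"

definition Aut :: "(int ^ 2) set set \<Rightarrow> ((int ^ 2) set \<Rightarrow> (int ^ 2) set) monoid" where
  "Aut \<Omega> = homeomorphism_group (subtopology config_topology \<Omega>)"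

definition shift :: "(int ^ 2) set set \<Rightarrow> int ^ 2 \<Rightarrow> (int ^ 2) set \<Rightarrow> (int ^ 2) set" where
  "shift \<Omega> t = (\<lambda>U\<in>\<Omega>. (\<lambda>x. x - t) ` U)"

definition shift_group :: "(int ^ 2) set set \<Rightarrow> ((int ^ 2) set \<Rightarrow> (int ^ 2) set) set" where
  "shift_group \<Omega> = range (shift \<Omega>)"

definition symmetry_group :: "(int ^ 2) set set \<Rightarrow> ((int ^ 2) set \<Rightarrow> (int ^ 2) set) set" where
  "symmetry_group \<Omega> = centralizer (Aut \<Omega>) (shift_group \<Omega>)"

definition extended_symmetry_group :: "(int ^ 2) set set \<Rightarrow> ((int ^ 2) set \<Rightarrow> (int ^ 2) set) set" where
  "extended_symmetry_group \<Omega> = normalizer (Aut \<Omega>) (shift_group \<Omega>)"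

definition affine_action ::
    "(int ^ 2) set set \<Rightarrow> int ^ 2 \<Rightarrow> int ^ 2 ^ 2 \<Rightarrow> (int ^ 2) set \<Rightarrow> (int ^ 2) set" where
  "affine_action \<Omega> t M = (\<lambda>U\<in>\<Omega>. (\<lambda>x. M *v x + t) ` U)"

definition linear_action :: "(int ^ 2) set set \<Rightarrow> int ^ 2 ^ 2 \<Rightarrow> (int ^ 2) set \<Rightarrow> (int ^ 2) set" where
  "linear_action \<Omega> M = (\<lambda>U\<in>\<Omega>. (\<lambda>x. M *v x) ` U)"

definition square_symmetries :: "(real ^ 2 ^ 2) set" where
  "square_symmetries = {A. orthogonal_matrix A \<and>
     (\<lambda>x. A *v x) ` {x. \<forall>i. \<bar>x $ i\<bar> \<le> 1} = {x. \<forall>i. \<bar>x $ i\<bar> \<le> 1}}"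

definition real_matrix :: "int ^ 2 ^ 2 \<Rightarrow> real ^ 2 ^ 2" where
  "real_matrix M = (\<chi> i j. real_of_int (M $ i $ j))"

definition to_gauss :: "int ^ 2 \<Rightarrow> complex" where
  "to_gauss x = of_int (x $ 1) + \<i> * of_int (x $ 2)"

text \<open>The inverse of \<^const>\<open>to_gauss\<close> on the Gaussian integers.\<close>

definition of_gauss :: "complex \<Rightarrow> int ^ 2" where
  "of_gauss z = vector [\<lfloor>Re z\<rfloor>, \<lfloor>Im z\<rfloor>]"

definition gauss_ring :: "complex ring" where
  "gauss_ring = ring_of_type_algebra \<lparr>carrier := range to_gauss\<rparr>"

definition gauss_field :: "complex ring" where
  "gauss_field = ring_of_type_algebra \<lparr>carrier := generate_field ring_of_type_algebra {\<i>}\<rparr>"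

definition gauss_kfree :: "nat \<Rightarrow> (int ^ 2) set" where
  "gauss_kfree k = {x. \<not> (\<exists>p\<in>carrier gauss_ring. ring_prime\<^bsub>gauss_ring\<^esub> p \<and>
     (p [^]\<^bsub>gauss_ring\<^esub> k) divides\<^bsub>gauss_ring\<^esub> to_gauss x)}"

text \<open>The integer matrix of an additive map of the Gaussian integers in the basis \<open>(1, \<i>)\<close>.\<close>

definition gauss_matrix :: "(complex \<Rightarrow> complex) \<Rightarrow> int ^ 2 ^ 2" where
  "gauss_matrix f = matrix (\<lambda>x. of_gauss (f (to_gauss x)))"

definition unit_matrix :: "complex \<Rightarrow> int ^ 2 ^ 2" where
  "unit_matrix u = gauss_matrix (\<lambda>z. u * z)"

definition C4 :: "(int ^ 2 ^ 2) set" where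
  "C4 = unit_matrix ` Units gauss_ring"

definition C2 :: "(int ^ 2 ^ 2) set" where
  "C2 = gauss_matrix ` carrier (ring_automorphism_group gauss_field)"

end

theory Submission
  imports Defs "HOL-Computational_Algebra.Factorial_Ring"
begin

text \<open>
  Call a set of lattice points admissible if, for every Gaussian prime \<open>p\<close>, it misses a residue class
  modulo \<open>p ^ k\<close>. The translates of \<open>V\<close> are admissible, since \<open>V\<close> itself misses the class of \<open>0\<close>, and
  admissibility passes to limits. Conversely, a sieve (\<open>sieve_exists\<close>, \<open>pattern_occurs\<close>) produces, for an
  admissible set, a translate of \<open>V\<close> that agrees with it on a given finite window. So the hull \<open>\<Omega>\<close>
  consists of all admissible sets (\<open>shift_hull_kfree\<close>); it is closed under taking subsets, and its finite
  members are dense in it.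

  Let \<open>\<phi>\<close> be a homeomorphism of \<open>\<Omega>\<close> that normalises the shift, so that it turns the translation by \<open>t\<close>
  into the translation by \<open>m t\<close> for an automorphism \<open>m\<close> of the lattice. By compactness \<open>\<phi>\<close> is given by
  a local rule, and it fixes the empty set, the only shift-invariant point of \<open>\<Omega>\<close>; hence it acts
  separately on pieces of a finite set that are far apart. The image of a sparse set \<open>T\<close> is therefore the
  union of the sets \<open>m t + A\<close> for \<open>t\<close> in \<open>T\<close>, where \<open>A = \<phi> {0}\<close>. Everything is extracted from the fact that
  such images are admissible again.

  Take a prime \<open>p\<close> of large norm that is not associated with its conjugate. There are sparse admissible
  sets that meet every class modulo the norm of \<open>p ^ k\<close> except those that agree with a prescribed class
  modulo \<open>p ^ k\<close> or modulo the conjugate of \<open>p ^ k\<close> (\<open>exists_sparse_cover\<close>). Applied to the class of \<open>0\<close>,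
  admissibility of the image says that a coset of the preimage under \<open>m\<close> of the ideal \<open>(p ^ k)\<close> lies
  in the union of this ideal and its conjugate, so the preimage lies in one of the two. An additive bijection
  that maps such an ideal into itself or into its conjugate is multiplication by a unit, possibly after
  complex conjugation, because its \<open>z\<close>-part or its \<open>gcnj z\<close>-part has a coefficient divisible by a number
  of large norm (\<open>additive_preserving_ideal\<close>). The same coset shows that \<open>A\<close> has a single element \<open>s\<close>.

  Suppose next that \<open>\<phi> U\<close> contains a point \<open>m y + s\<close> with \<open>y\<close> outside the finite set \<open>U\<close>. A sparse set
  that avoids exactly the classes of \<open>y\<close> can be added to \<open>U\<close>, but the image of the union meets every
  class modulo \<open>p ^ k\<close>. Hence \<open>\<phi> U\<close> is contained in \<open>m U + s\<close>; injectivity of \<open>\<phi>\<close> and induction on the size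
  of \<open>U\<close> give equality, and the local rule extends it to all of \<open>\<Omega>\<close> (\<open>\<phi>_affine\<close>). With \<open>m\<close> the identity
  this is the statement about the symmetry group, with arbitrary \<open>m\<close> that about the extended one. It also
  computes \<open>stab V\<close>: a matrix that preserves \<open>V\<close> acts on \<open>\<Omega>\<close> by such a homeomorphism.

  What remains is finite: the eight matrices \<open>dihedral_mats\<close> form the symmetry group of the square, and
  they form a maximal finite group because averaging a scalar product over a larger finite group
  would show all its elements to be orthogonal (\<open>maximal_finite_dihedral_mats\<close>).
\<close>

(* The symbol $ denotes vector components throughout; it would otherwise be ambiguous. *)
no_notation fps_nth (infixl \<open>$\<close> 75)

section \<open>The ring of Gaussian integers\<close>

datatype gint = GInt (gre: int) (gim: int)

lemma gint_eq_iff: "z = w \<longleftrightarrow> gre z = gre w \<and> gim z = gim w"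
  by (cases z; cases w) simp

instantiation gint :: comm_ring_1
begin
definition "0 = GInt 0 0"
definition "1 = GInt 1 0"
definition "z + w = GInt (gre z + gre w) (gim z + gim w)"
definition "- z = GInt (- gre z) (- gim z)"
definition "z - w = GInt (gre z - gre w) (gim z - gim w)"
definition "z * w = GInt (gre z * gre w - gim z * gim w) (gre z * gim w + gim z * gre w)"
instance
  by standard
    (simp_all add: zero_gint_def one_gint_def plus_gint_def uminus_gint_def minus_gint_def
      times_gint_def algebra_simps)
end

lemma gre_gim_simps [simp]:
  "gre 0 = 0" "gim 0 = 0" "gre 1 = 1" "gim 1 = 0"
  "gre (z + w) = gre z + gre w" "gim (z + w) = gim z + gim w"
  "gre (- z) = - gre z" "gim (- z) = - gim z"
  "gre (z - w) = gre z - gre w" "gim (z - w) = gim z - gim w"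
  "gre (z * w) = gre z * gre w - gim z * gim w"
  "gim (z * w) = gre z * gim w + gim z * gre w"
  by (simp_all add: zero_gint_def one_gint_def plus_gint_def uminus_gint_def minus_gint_def
      times_gint_def)

lemma gre_gim_of_int [simp]: "gre (of_int n) = n" "gim (of_int n) = 0"
proof -
  have "gre (of_nat m) = int m \<and> gim (of_nat m) = 0" for m
    by (induction m) auto
  then show "gre (of_int n) = n" "gim (of_int n) = 0"
    by (cases n rule: int_cases2; simp)+
qed

lemma gre_gim_of_nat [simp]: "gre (of_nat n) = int n" "gim (of_nat n) = 0"
  using gre_gim_of_int[of "int n"] by simp_all

lemma gre_gim_numeral [simp]: "gre (numeral n) = numeral n" "gim (numeral n) = 0"
  using gre_gim_of_int[of "numeral n"] by simp_all

definition gnorm :: "gint \<Rightarrow> int" where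
  "gnorm z = gre z * gre z + gim z * gim z"

definition gcnj :: "gint \<Rightarrow> gint" where
  "gcnj z = GInt (gre z) (- gim z)"

definition gI :: gint where "gI = GInt 0 1"

lemma gI_simps [simp]: "gre gI = 0" "gim gI = 1" by (simp_all add: gI_def)

lemma gcnj_simps [simp]: "gre (gcnj z) = gre z" "gim (gcnj z) = - gim z"
  by (simp_all add: gcnj_def)

lemma gnorm_mult: "gnorm (z * w) = gnorm z * gnorm w"
  by (simp add: gnorm_def algebra_simps)

lemma gnorm_nonneg [simp]: "gnorm z \<ge> 0"
  by (simp add: gnorm_def)

lemma gnorm_eq_0_iff [simp]: "gnorm z = 0 \<longleftrightarrow> z = 0"
  by (simp add: gnorm_def gint_eq_iff sum_squares_eq_zero_iff)

lemma gnorm_pos_iff [simp]: "gnorm z > 0 \<longleftrightarrow> z \<noteq> 0"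
  by (metis gnorm_eq_0_iff gnorm_nonneg less_le)

lemma gnorm_0 [simp]: "gnorm 0 = 0" and gnorm_1 [simp]: "gnorm 1 = 1"
  by (simp_all add: gnorm_def)

lemma gnorm_of_int: "gnorm (of_int n) = n * n"
  by (simp add: gnorm_def)

lemma gnorm_power: "gnorm (z ^ n) = gnorm z ^ n"
  by (induction n) (auto simp: gnorm_mult)

lemma gcnj_hom [simp]: "gcnj (z + w) = gcnj z + gcnj w" "gcnj (z * w) = gcnj z * gcnj w"
  "gcnj (z - w) = gcnj z - gcnj w" "gcnj (- z) = - gcnj z"
  "gcnj 0 = 0" "gcnj 1 = 1" "gcnj (gcnj z) = z" "gcnj (of_int n) = of_int n"
  "gcnj (of_nat m) = of_nat m"
  by (simp_all add: gint_eq_iff)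

lemma gcnj_power [simp]: "gcnj (z ^ n) = gcnj z ^ n"
  by (induction n) auto

lemma gnorm_gcnj [simp]: "gnorm (gcnj z) = gnorm z"
  by (simp add: gnorm_def)

lemma mult_gcnj: "z * gcnj z = of_int (gnorm z)"
  by (simp add: gint_eq_iff gnorm_def)

lemma gcnj_dvd_iff: "gcnj z dvd gcnj w \<longleftrightarrow> z dvd w"
  by (metis dvd_def gcnj_hom(2) gcnj_hom(7))

lemma gcnj_dvd_swap: "gcnj z dvd w \<longleftrightarrow> z dvd gcnj w"
  by (metis gcnj_dvd_iff gcnj_hom(7))

instance gint :: idom
proof
  fix a b :: gint
  assume "a \<noteq> 0" "b \<noteq> 0"
  then have "gnorm a * gnorm b \<noteq> 0" by simp
  then show "a * b \<noteq> 0" by (metis gnorm_mult gnorm_eq_0_iff)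
qed

instance gint :: ring_char_0
proof
  show "inj (of_nat :: nat \<Rightarrow> gint)"
    by (rule injI) (metis gre_gim_of_nat(1) of_nat_eq_iff)
qed

lemma dvd_imp_gnorm_dvd: "z dvd w \<Longrightarrow> gnorm z dvd gnorm w"
  by (auto simp: dvd_def gnorm_mult)

lemma dvd_imp_gnorm_le: "z dvd w \<Longrightarrow> w \<noteq> 0 \<Longrightarrow> gnorm z \<le> gnorm w"
  by (meson dvd_imp_gnorm_dvd gnorm_pos_iff zdvd_imp_le)

lemma dvd_gnorm: "z dvd of_int (gnorm z)"
  by (metis dvd_triv_left mult_gcnj)

lemma gint_unit_iff: "z dvd 1 \<longleftrightarrow> gnorm z = 1"
  by (metis dvd_gnorm dvd_imp_gnorm_dvd gnorm_1 gnorm_nonneg of_int_1 zdvd1_eq abs_of_nonneg)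

lemma gnorm_1_inverse: "gnorm u = 1 \<Longrightarrow> u * gcnj u = 1" "gnorm u = 1 \<Longrightarrow> gcnj u * u = 1"
  by (simp_all add: mult_gcnj mult.commute)

lemma unit_dvd_iff: "gnorm u = 1 \<Longrightarrow> a dvd u * b \<longleftrightarrow> a dvd b"
  using gnorm_1_inverse[of u] by (metis dvd_mult mult.assoc mult_1)

lemma of_int_dvd_iff: "(of_int n :: gint) dvd z \<longleftrightarrow> n dvd gre z \<and> n dvd gim z"
proof
  assume "n dvd gre z \<and> n dvd gim z"
  then obtain a b where "gre z = n * a" "gim z = n * b" by (auto simp: dvd_def)
  then have "z = of_int n * GInt a b" by (simp add: gint_eq_iff)
  then show "of_int n dvd z" by simp
qed (auto simp: dvd_def)

lemma finite_gnorm_le: "finite {z. gnorm z \<le> n}"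
proof (rule finite_subset)
  have sq: "\<bar>a\<bar> \<le> n" if "a * a \<le> n" for a :: int
  proof -
    have "\<bar>a\<bar> * 1 \<le> \<bar>a\<bar> * \<bar>a\<bar>"
      by (cases "a = 0") (auto intro!: mult_left_mono simp del: abs_mult_self_eq)
    with that show ?thesis by simp
  qed
  show "{z. gnorm z \<le> n} \<subseteq> case_prod GInt ` ({-n..n} \<times> {-n..n})"
  proof
    fix z assume z: "z \<in> {z. gnorm z \<le> n}"
    then have "gre z * gre z + gim z * gim z \<le> n" by (simp add: gnorm_def)
    then have "gre z * gre z \<le> n" "gim z * gim z \<le> n"
      using zero_le_square[of "gre z"] zero_le_square[of "gim z"] by linarith+
    then have "\<bar>gre z\<bar> \<le> n" "\<bar>gim z\<bar> \<le> n" using sq by auto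
    then show "z \<in> case_prod GInt ` ({-n..n} \<times> {-n..n})"
      by (intro image_eqI[of _ _ "(gre z, gim z)"]) auto
  qed
qed auto

text \<open>Rounding the quotient \<open>a / b\<close> to a nearest lattice point leaves a remainder whose norm is at
  most half of that of \<open>b\<close>.\<close>

lemma gint_euclid:
  assumes "b \<noteq> 0"
  shows "\<exists>q. gnorm (a - q * b) < gnorm b"
proof -
  define n where "n = gnorm b"
  have n: "n > 0" using assms by (simp add: n_def)
  have round: "\<exists>q. 4 * ((x - n * q) * (x - n * q)) \<le> n * n" for x
  proof -
    define q where "q = (2 * x + n) div (2 * n)"
    have "2 * x + n = 2 * n * q + (2 * x + n) mod (2 * n)"
      by (simp add: q_def)
    moreover have "0 \<le> (2 * x + n) mod (2 * n)" "(2 * x + n) mod (2 * n) < 2 * n"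
      using n by simp_all
    ultimately have "\<bar>2 * (x - n * q)\<bar> \<le> \<bar>n\<bar>" by (simp add: algebra_simps)
    then have "(2 * (x - n * q)) * (2 * (x - n * q)) \<le> n * n"
      by (metis abs_le_square_iff power2_eq_square)
    then show ?thesis by (intro exI[of _ q]) (simp add: algebra_simps)
  qed
  define w where "w = a * gcnj b"
  obtain q1 q2 where q: "4 * ((gre w - n * q1) * (gre w - n * q1)) \<le> n * n"
    "4 * ((gim w - n * q2) * (gim w - n * q2)) \<le> n * n"
    using round by meson
  have "(a - GInt q1 q2 * b) * gcnj b = w - GInt q1 q2 * of_int n"
    by (simp add: w_def n_def left_diff_distrib mult.assoc mult_gcnj)
  then have "gnorm (a - GInt q1 q2 * b) * n = gnorm (w - GInt q1 q2 * of_int n)"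
    by (metis gnorm_mult gnorm_gcnj n_def)
  also have "4 * \<dots> \<le> 2 * (n * n)"
    using q by (simp add: gnorm_def mult.commute)
  finally have "4 * (gnorm (a - GInt q1 q2 * b) * n) \<le> 2 * (n * n)" by simp
  then have "(2 * gnorm (a - GInt q1 q2 * b)) * n \<le> n * n" by linarith
  then have "2 * gnorm (a - GInt q1 q2 * b) \<le> n"
    using n by (simp only: mult_le_cancel_right)
  then have "gnorm (a - GInt q1 q2 * b) < n" using n by linarith
  then show ?thesis unfolding n_def by blast
qed

text \<open>A nonzero combination of \<open>a\<close> and \<open>b\<close> of least norm divides every other combination, by division with
  remainder.\<close>

lemma gint_bezout: "\<exists>d u v. d = u * a + v * b \<and> d dvd a \<and> d dvd (b :: gint)"
proof (cases "a = 0 \<and> b = 0")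
  case False
  define I where "I = {z. z \<noteq> 0 \<and> (\<exists>u v. z = u * a + v * b)}"
  have "a \<in> I" if "a \<noteq> 0"
    unfolding I_def
    by (rule CollectI, rule conjI[OF that], rule exI[of _ 1], rule exI[of _ 0]) simp
  moreover have "b \<in> I" if "b \<noteq> 0"
    unfolding I_def
    by (rule CollectI, rule conjI[OF that], rule exI[of _ 0], rule exI[of _ 1]) simp
  ultimately have "\<exists>z. z \<in> I" using False by blast
  then obtain d where d: "d \<in> I" and least: "\<And>z. z \<in> I \<Longrightarrow> nat (gnorm d) \<le> nat (gnorm z)"
    using ex_has_least_nat[of "\<lambda>z. z \<in> I" _ "\<lambda>z. nat (gnorm z)"] by blast
  from d obtain u v where uv: "d = u * a + v * b" and d0: "d \<noteq> 0" unfolding I_def by blast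
  have "d dvd x * a + y * b" for x y
  proof -
    obtain q where q: "gnorm (x * a + y * b - q * d) < gnorm d" using gint_euclid[OF d0] by blast
    let ?r = "x * a + y * b - q * d"
    have "?r = (x - q * u) * a + (y - q * v) * b" by (simp add: uv algebra_simps)
    then have "?r \<in> I" if "?r \<noteq> 0" using that unfolding I_def by blast
    then have "?r = 0" using least[of ?r] q gnorm_nonneg[of ?r] by linarith
    then show ?thesis by (simp add: dvd_def mult.commute)
  qed
  from this[of 1 0] this[of 0 1] show ?thesis using uv by auto
qed auto

text \<open>A non-unit divisor of least norm is prime: if it does not divide \<open>a\<close>, then its greatest common divisor
  with \<open>a\<close> is a unit.\<close>

lemma gint_prime_divisor:
  assumes "z \<noteq> 0" "\<not> z dvd (1 :: gint)"
  shows "\<exists>p. prime_elem p \<and> p dvd z"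
proof -
  define D where "D = {d. d dvd z \<and> \<not> d dvd 1}"
  have "z \<in> D" using assms by (simp add: D_def)
  then obtain p where p: "p \<in> D" and least: "\<And>d. d \<in> D \<Longrightarrow> nat (gnorm p) \<le> nat (gnorm d)"
    using ex_has_least_nat[of "\<lambda>z. z \<in> D" _ "\<lambda>z. nat (gnorm z)"] by blast
  have pz: "p dvd z" "\<not> p dvd 1" using p by (auto simp: D_def)
  have p0: "p \<noteq> 0" using pz assms by auto
  have "prime_elem p"
  proof (rule prime_elemI)
    fix a b assume ab: "p dvd a * b"
    show "p dvd a \<or> p dvd b"
    proof -
      obtain d u v where d: "d = u * p + v * a" "d dvd p" "d dvd a" using gint_bezout by blast
      show ?thesis
      proof (cases "d dvd 1")
        case True
        then obtain e where "1 = d * e" by (auto simp: dvd_def)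
        then have "b = e * (u * p + v * a) * b" by (simp add: d mult.commute)
        also have "\<dots> = p * (e * u * b) + e * v * (a * b)" by (simp add: algebra_simps)
        finally have "p dvd b" using ab by (metis dvd_add dvd_mult dvd_triv_left)
        then show ?thesis ..
      next
        case False
        then have "d \<in> D" using d pz by (auto simp: D_def intro: dvd_trans)
        with least have le: "gnorm p \<le> gnorm d" by (simp add: nat_le_eq_zle)
        obtain e where e: "p = d * e" using d by (auto simp: dvd_def)
        have dnz: "d \<noteq> 0" "e \<noteq> 0" using e p0 by auto
        have "gnorm d * gnorm e \<le> gnorm d * 1" using le e by (simp add: gnorm_mult)
        then have "gnorm e \<le> 1" using dnz by (simp add: mult_le_cancel_left_pos)
        then have "gnorm e = 1" using dnz by (smt (verit) gnorm_pos_iff)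
        then have "e dvd 1" by (simp add: gint_unit_iff)
        then obtain f where "1 = e * f" by (auto simp: dvd_def)
        then have "d = p * f" by (simp add: e mult.assoc)
        then show ?thesis using d by (metis dvd_def dvd_trans)
      qed
    qed
  qed (use p0 pz in auto)
  then show ?thesis using pz by blast
qed

text \<open>Coprimality in the form in which it is used: \<open>a\<close> and \<open>b\<close> generate the unit ideal.\<close>

definition comaximal :: "'a::comm_ring_1 \<Rightarrow> 'a \<Rightarrow> bool" where
  "comaximal a b \<longleftrightarrow> (\<exists>u v. u * a + v * b = 1)"

lemma comaximal_sym: "comaximal a b \<Longrightarrow> comaximal b a"
  unfolding comaximal_def by (metis add.commute)

lemma comaximal_1_left: "comaximal 1 b"
  unfolding comaximal_def by (intro exI[of _ 1] exI[of _ 0]) simp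

lemma comaximal_mult_left:
  assumes "comaximal a c" "comaximal b c"
  shows "comaximal (a * b) c"
proof -
  obtain u v s t where "u * a + v * c = 1" "s * b + t * c = 1"
    using assms unfolding comaximal_def by blast
  then have "(u * a + v * c) * (s * b + t * c) = 1" by simp
  then have "(u * s) * (a * b) + (u * a * t + v * s * b + v * c * t) * c = 1"
    by (simp add: algebra_simps)
  then show ?thesis unfolding comaximal_def by blast
qed

lemma comaximal_power_left: "comaximal a c \<Longrightarrow> comaximal (a ^ n) c"
  by (induction n) (auto simp: comaximal_1_left comaximal_mult_left)

lemma comaximal_power: "comaximal a b \<Longrightarrow> comaximal (a ^ m) (b ^ n)"
  by (simp add: comaximal_power_left comaximal_sym)

lemma comaximal_prod_left:
  "(\<And>x. x \<in> A \<Longrightarrow> comaximal (f x) c) \<Longrightarrow> comaximal (prod f A) c"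
  by (induction A rule: infinite_finite_induct) (auto simp: comaximal_1_left comaximal_mult_left)

lemma comaximal_dvd_mult:
  assumes "comaximal a b" "a dvd b * c"
  shows "a dvd c"
proof -
  obtain u v where "u * a + v * b = 1" using assms unfolding comaximal_def by blast
  then have "c = (u * a + v * b) * c" by simp
  also have "\<dots> = a * (u * c) + v * (b * c)" by (simp add: algebra_simps)
  finally show ?thesis using assms(2) by (metis dvd_add dvd_mult dvd_triv_left)
qed

lemma comaximal_solve:
  assumes "comaximal a b"
  shows "\<exists>x. a dvd x - y \<and> b dvd x - z"
proof -
  obtain u v where uv: "u * a + v * b = 1" using assms unfolding comaximal_def by blast
  define x where "x = z * (u * a) + y * (v * b)"
  have vb: "v * b = 1 - u * a" and ua: "u * a = 1 - v * b"
    using uv by (auto simp: algebra_simps)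
  have "x - y = a * (u * (z - y))" unfolding x_def vb by (simp add: algebra_simps)
  moreover have "x - z = b * (v * (y - z))" unfolding x_def ua by (simp add: algebra_simps)
  ultimately show ?thesis by (metis dvd_triv_left)
qed

lemma chinese_remainder_comaximal:
  assumes "finite A" "\<And>a b. a \<in> A \<Longrightarrow> b \<in> A \<Longrightarrow> a \<noteq> b \<Longrightarrow> comaximal (m a) (m b)"
  shows "\<exists>x. \<forall>a\<in>A. m a dvd x - r a"
  using assms
proof (induction A rule: finite_induct)
  case (insert p A)
  then obtain x where x: "\<And>a. a \<in> A \<Longrightarrow> m a dvd x - r a" by (metis insertCI)
  have "comaximal (prod m A) (m p)"
    using insert.prems insert.hyps by (intro comaximal_prod_left) auto
  then obtain y where y: "prod m A dvd y - x" "m p dvd y - r p" using comaximal_solve by blast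
  have "m a dvd y - r a" if "a \<in> A" for a
  proof -
    have "m a dvd prod m A" using that insert by (simp add: dvd_prodI)
    then have "m a dvd (y - x) + (x - r a)" using x[OF that] y by (meson dvd_add dvd_trans)
    then show ?thesis by simp
  qed
  then show ?case using y by blast
qed auto

lemma prime_comaximal:
  assumes "prime_elem (p :: gint)" "\<not> p dvd a"
  shows "comaximal p a"
proof -
  obtain d u v where d: "d = u * p + v * a" "d dvd p" "d dvd a" using gint_bezout by blast
  obtain e where e: "p = d * e" using d by (auto simp: dvd_def)
  have "\<not> p dvd d" using assms d by (meson dvd_trans)
  then have "p dvd e" using assms(1) e by (metis prime_elem_dvd_multD dvd_refl)
  then obtain f where "e = p * f" by (auto simp: dvd_def)
  then have "p * 1 = p * (d * f)" using e by (simp add: algebra_simps)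
  then have "1 = d * f"
    by (rule mult_left_cancel[THEN iffD1, OF prime_elem_not_zeroI[OF assms(1)]])
  also have "\<dots> = (f * u) * p + (f * v) * a" by (simp add: d(1) algebra_simps)
  finally have "(f * u) * p + (f * v) * a = 1" ..
  then show ?thesis unfolding comaximal_def by blast
qed

text \<open>If \<open>q = p e\<close>, then the prime \<open>q\<close> divides \<open>p\<close> or \<open>e\<close>, and the latter would make \<open>p\<close> a unit.\<close>

lemma prime_dvd_prime_imp_dvd:
  assumes "prime_elem (p :: gint)" "prime_elem q" "p dvd q"
  shows "q dvd p"
proof -
  obtain e where e: "q = p * e" using assms by (auto simp: dvd_def)
  have "q dvd p \<or> q dvd e" using assms e by (metis prime_elem_dvd_multD dvd_refl)
  moreover have False if qe: "q dvd e"
  proof -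
    obtain f where f: "e = q * f" using qe by (auto simp: dvd_def)
    have "q = p * (q * f)" using e unfolding f .
    then have "q * 1 = q * (p * f)" by (simp only: mult.left_commute mult_1_right)
    then have "1 = p * f"
      by (rule mult_left_cancel[THEN iffD1, OF prime_elem_not_zeroI[OF assms(2)]])
    then show False using assms(1) by (metis dvd_triv_left prime_elem_def)
  qed
  ultimately show ?thesis by blast
qed

lemma gnorm_prime_ge_2: "prime_elem p \<Longrightarrow> gnorm p \<ge> 2"
  by (smt (verit) gint_unit_iff gnorm_eq_0_iff gnorm_nonneg prime_elem_def)

lemma prime_elem_gcnj: "prime_elem (gcnj p) \<longleftrightarrow> prime_elem p"
proof -
  have "prime_elem (gcnj p)" if "prime_elem p" for p
  proof (rule prime_elemI)
    show "gcnj p \<noteq> 0" using that by (metis gnorm_eq_0_iff gnorm_gcnj prime_elem_not_zeroI)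
    show "\<not> gcnj p dvd 1" using that by (simp add: gint_unit_iff prime_elem_def)
    fix a b assume "gcnj p dvd a * b"
    then show "gcnj p dvd a \<or> gcnj p dvd b"
      using that by (simp add: gcnj_dvd_swap prime_elem_dvd_mult_iff)
  qed
  from this[of p] this[of "gcnj p"] show ?thesis by auto
qed

text \<open>A prime factor \<open>p\<close> of \<open>n! + \<i>\<close> divides no positive rational integer up to \<open>n\<close>, so its norm exceeds \<open>n\<close>.
  It is not associated with its conjugate, which divides \<open>n! - \<i>\<close>, because it does not divide the
  sum \<open>2 n!\<close> of these two numbers.\<close>

lemma large_split_prime:
  "\<exists>p. prime_elem p \<and> gnorm p > b \<and> comaximal p (gcnj p)"
proof -
  define n where "n = nat (max b 2)"
  define a :: gint where "a = of_nat (fact n)"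
  have fn: "fact n \<ge> (2 :: int)" using fact_mono[of 2 n, where 'a = int] by (simp add: n_def)
  have gre_a: "gre a = fact n" "gim a = 0"
    unfolding a_def gre_gim_of_nat by simp_all
  have "gnorm (a + gI) = fact n * fact n + 1" by (simp add: gnorm_def gre_a)
  also have "\<dots> > 1" using fn by auto
  finally have "\<not> a + gI dvd 1" "a + gI \<noteq> 0" by (auto simp: gint_unit_iff)
  then obtain p where p: "prime_elem p" "p dvd a + gI" using gint_prime_divisor by blast
  have pI: "\<not> p dvd gI"
  proof
    assume "p dvd gI"
    then have "gnorm p dvd 1" by (metis dvd_imp_gnorm_dvd gI_simps gnorm_def mult_zero_left add_0 mult_1)
    then show False using gnorm_prime_ge_2[OF p(1)] by auto
  qed
  have pa: "\<not> p dvd a" using p(2) pI dvd_add_right_iff[of p a gI] by blast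
  have small: "\<not> p dvd of_nat m" if "1 \<le> m" "m \<le> n" for m
  proof
    assume pm: "p dvd of_nat m"
    have "m dvd fact n" using that by (simp add: dvd_fact)
    then obtain q where q: "fact n = m * q" by (auto simp: dvd_def)
    have "a = of_nat m * of_nat q" by (simp only: a_def q of_nat_mult)
    then have "of_nat m dvd a" by simp
    then show False using pa pm by (meson dvd_trans)
  qed
  have "gnorm p > b"
  proof (rule ccontr)
    assume "\<not> gnorm p > b"
    then have "1 \<le> nat (gnorm p)" "nat (gnorm p) \<le> n"
      using gnorm_prime_ge_2[OF p(1)] by (auto simp: n_def)
    moreover have "p dvd of_nat (nat (gnorm p))" using dvd_gnorm[of p] by (simp add: of_nat_nat)
    ultimately show False using small by blast
  qed
  moreover have "\<not> p dvd gcnj p"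
  proof
    assume "p dvd gcnj p"
    moreover have "gcnj p dvd gcnj (a + gI)" using p(2) by (simp only: gcnj_dvd_iff)
    ultimately have "p dvd gcnj (a + gI)" by (rule dvd_trans)
    also have "gcnj (a + gI) = a - gI" by (simp add: gint_eq_iff gre_a)
    finally have "p dvd (a + gI) + (a - gI)" using p(2) by (rule dvd_add[rotated])
    also have "(a + gI) + (a - gI) = of_nat 2 * a" by simp
    finally have "p dvd of_nat 2 \<or> p dvd a" using p(1) by (metis prime_elem_dvd_multD)
    moreover have "2 \<le> n" by (simp add: n_def)
    ultimately show False using pa small[of 2] by auto
  qed
  ultimately show ?thesis using p prime_comaximal by blast
qed

section \<open>Patterns of \<open>k\<close>-free Gaussian integers\<close>

definition kfree :: "nat \<Rightarrow> gint \<Rightarrow> bool" where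
  "kfree k z \<longleftrightarrow> \<not> (\<exists>p. prime_elem p \<and> p ^ k dvd z)"

definition admissible :: "nat \<Rightarrow> gint set \<Rightarrow> bool" where
  "admissible k U \<longleftrightarrow> (\<forall>p. prime_elem p \<longrightarrow> (\<exists>c. \<forall>u\<in>U. \<not> p ^ k dvd u - c))"

lemma admissible_subset: "admissible k U \<Longrightarrow> W \<subseteq> U \<Longrightarrow> admissible k W"
  unfolding admissible_def by blast

lemma gnorm_le_gnorm_power:
  assumes "k \<ge> 1" shows "gnorm p \<le> gnorm (p ^ k)"
proof (cases "p = 0")
  case False
  then have "1 \<le> gnorm p" using gnorm_pos_iff[of p] by linarith
  then show ?thesis using assms self_le_power[of "gnorm p" k] by (simp add: gnorm_power)
qed (use assms in simp)

lemma gnorm_prime_power_gt_1: "prime_elem p \<Longrightarrow> k \<ge> 1 \<Longrightarrow> gnorm (p ^ k) > 1"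
  using gnorm_le_gnorm_power[of k p] gnorm_prime_ge_2[of p] by linarith

text \<open>The ideals generated by \<open>p ^ k\<close> and by its conjugate are comaximal and proper, so neither contains
  the other.\<close>

lemma conj_prime_powers_not_dvd:
  assumes "prime_elem p" "comaximal p (gcnj p)" "k \<ge> 1"
  shows "\<not> p ^ k dvd gcnj p ^ k" "\<not> gcnj p ^ k dvd p ^ k"
proof -
  have "comaximal (p ^ k) (gcnj p ^ k)" using assms(2) by (rule comaximal_power)
  moreover have "r dvd 1" if "comaximal r s" "r dvd s" for r s :: gint
    using comaximal_dvd_mult[OF that(1), of 1] that(2) by simp
  moreover have "\<not> q ^ k dvd 1" if "prime_elem q" for q :: gint
    using gnorm_prime_power_gt_1[OF that assms(3)] by (simp add: gint_unit_iff)
  ultimately show "\<not> p ^ k dvd gcnj p ^ k" "\<not> gcnj p ^ k dvd p ^ k"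
    using assms(1) prime_elem_gcnj comaximal_sym by blast+
qed

text \<open>Two of the \<open>card T + 1\<close> integers \<open>0, \<dots>, card T\<close> are represented by the same element of \<open>T\<close>, so \<open>p ^ k\<close>
  divides their difference. Hence a finite set can violate admissibility only at finitely many primes.\<close>

lemma bound_of_full_residues:
  assumes "k \<ge> 1" "prime_elem p" "finite T" and full: "\<And>c. \<exists>t\<in>T. p ^ k dvd t - c"
  shows "gnorm p \<le> (int (card T))\<^sup>2"
proof -
  obtain h where h: "\<And>c. h c \<in> T \<and> p ^ k dvd h c - c" using full by metis
  have "\<not> inj_on (\<lambda>i. h (of_nat i)) {..card T}"
  proof
    assume "inj_on (\<lambda>i. h (of_nat i)) {..card T}"
    then have "card {..card T} \<le> card T"
      by (rule card_inj_on_le) (use h assms in auto)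
    then show False by simp
  qed
  then obtain i j where ij: "i < j" "j \<le> card T" "h (of_nat i) = h (of_nat j)"
    unfolding inj_on_def by (metis atMost_iff linorder_neqE_nat)
  have "p ^ k dvd (h (of_nat i) - of_nat i) - (h (of_nat j) - of_nat j)"
    by (rule dvd_diff) (use h in blast)+
  also have "\<dots> = of_int (int j - int i)" using ij(3) by simp
  finally have "gnorm (p ^ k) \<le> gnorm (of_int (int j - int i))"
    by (rule dvd_imp_gnorm_le) (use ij in \<open>simp add: gint_eq_iff\<close>)
  also have "\<dots> = (int j - int i)\<^sup>2" by (simp only: gnorm_of_int power2_eq_square)
  finally have "gnorm (p ^ k) \<le> (int j - int i)\<^sup>2" .
  moreover have "(int j - int i)\<^sup>2 \<le> (int (card T))\<^sup>2" using ij by (intro power_mono) auto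
  ultimately show ?thesis using gnorm_le_gnorm_power[OF assms(1), of p] by linarith
qed

lemma sum_inverse_squares_bounded:
  fixes n :: nat
  shows "(\<Sum>m\<le>n. 1 / (1 + (real m)\<^sup>2)) \<le> 3 - 2 / (real n + 1)"
proof (induction n)
  case (Suc n)
  define x where "x = real n"
  have "x \<ge> 0" by (simp add: x_def)
  have "1 / (1 + (x + 1)\<^sup>2) \<le> 2 / ((x + 1) * (x + 2))"
    using \<open>x \<ge> 0\<close> by (simp add: divide_simps power2_eq_square) (simp add: algebra_simps add_pos_nonneg)
  also have "\<dots> = 2 / (x + 1) - 2 / (x + 2)" using \<open>x \<ge> 0\<close> by (simp add: field_simps)
  finally show ?case using Suc by (simp add: x_def add.commute algebra_simps)
qed simp

text \<open>The summand is at most \<open>4 / ((1 + a\<^sup>2) (1 + b\<^sup>2))\<close> at \<open>a + b \<i>\<close>, and the sum of the latter over a square is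
  a product of two bounded sums.\<close>

lemma sum_inverse_gnorm_bounded:
  assumes "finite F"
  shows "(\<Sum>g\<in>F. 1 / (real_of_int (gnorm g))\<^sup>2) \<le> 144"
proof -
  define h where "h = (\<lambda>a::int. 1 / (1 + (real_of_int a)\<^sup>2))"
  have h0: "h a \<ge> 0" for a by (simp add: h_def)
  obtain n :: nat where n: "\<And>g. g \<in> F \<Longrightarrow> \<bar>gre g\<bar> \<le> int n \<and> \<bar>gim g\<bar> \<le> int n"
  proof -
    define n where "n = Max ((\<lambda>g. nat \<bar>gre g\<bar> + nat \<bar>gim g\<bar>) ` F)"
    have "nat \<bar>gre g\<bar> + nat \<bar>gim g\<bar> \<le> n" if "g \<in> F" for g
      unfolding n_def using assms that by (intro Max_ge) auto
    then have "\<bar>gre g\<bar> \<le> int n \<and> \<bar>gim g\<bar> \<le> int n" if "g \<in> F" for g using that by fastforce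
    then show ?thesis using that by blast
  qed
  have hsum: "(\<Sum>a\<in>{-int n..int n}. h a) \<le> 6"
  proof -
    have "x \<in> int ` {..n} \<union> (\<lambda>m. - int m) ` {..n}" if "x \<in> {-int n..int n}" for x
    proof (cases "x \<ge> 0")
      case True
      then show ?thesis using that by (intro UnI1 image_eqI[of _ _ "nat x"]) auto
    next
      case False
      then show ?thesis using that by (intro UnI2 image_eqI[of _ _ "nat (- x)"]) auto
    qed
    then have "{-int n..int n} \<subseteq> int ` {..n} \<union> (\<lambda>m. - int m) ` {..n}" by blast
    then have "(\<Sum>a\<in>{-int n..int n}. h a) \<le> sum h (int ` {..n} \<union> (\<lambda>m. - int m) ` {..n})"
      by (rule sum_mono2[rotated]) (simp_all add: h0)
    also have "\<dots> \<le> sum h (int ` {..n}) + sum h ((\<lambda>m. - int m) ` {..n})"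
      by (simp add: sum_Un h0 sum_nonneg)
    also have "\<dots> = 2 * (\<Sum>m\<le>n. 1 / (1 + (real m)\<^sup>2))"
      by (subst (1 2) sum.reindex) (auto simp: inj_on_def h_def)
    also have "\<dots> \<le> 2 * 3"
      using sum_inverse_squares_bounded[of n] by (smt (verit) divide_nonneg_nonneg of_nat_0_le_iff)
    finally show ?thesis by simp
  qed
  have pt: "1 / (real_of_int (gnorm g))\<^sup>2 \<le> 4 * (h (gre g) * h (gim g))" for g
  proof (cases "g = 0")
    case False
    define a b where "a = (real_of_int (gre g))\<^sup>2" and "b = (real_of_int (gim g))\<^sup>2"
    have N: "real_of_int (gnorm g) = a + b" by (simp add: gnorm_def a_def b_def power2_eq_square)
    have "gnorm g \<ge> 1" using False gnorm_pos_iff[of g] by linarith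
    then have ab: "a + b \<ge> 1" using N by linarith
    have nn: "a \<ge> 0" "b \<ge> 0" by (simp_all add: a_def b_def)
    have "(1 + a) * (1 + b) \<le> (1 + (a + b)) * (1 + (a + b))"
      using nn by (intro mult_mono) auto
    also have "\<dots> \<le> (2 * (a + b)) * (2 * (a + b))"
      using ab by (intro mult_mono) auto
    finally have "(1 + a) * (1 + b) \<le> 4 * (a + b)\<^sup>2" by (simp add: power2_eq_square algebra_simps)
    moreover have "(1 + a) * (1 + b) > 0" using nn by (simp add: add_pos_nonneg)
    ultimately have "1 / (4 * (a + b)\<^sup>2) \<le> 1 / ((1 + a) * (1 + b))"
      by (intro divide_left_mono) (use ab in auto)
    then show ?thesis by (simp add: N h_def a_def b_def)
  qed (simp add: h0)
  have "(\<Sum>g\<in>F. 1 / (real_of_int (gnorm g))\<^sup>2) \<le> (\<Sum>g\<in>F. 4 * (h (gre g) * h (gim g)))"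
    by (intro sum_mono pt)
  also have "\<dots> = (\<Sum>(a, b)\<in>(\<lambda>g. (gre g, gim g)) ` F. 4 * (h a * h b))"
    by (subst sum.reindex) (auto simp: inj_on_def gint_eq_iff)
  also have "\<dots> \<le> (\<Sum>(a, b)\<in>{-int n..int n} \<times> {-int n..int n}. 4 * (h a * h b))"
    using n by (intro sum_mono2) (fastforce simp: h0 abs_le_iff)+
  also have "\<dots> = 4 * ((\<Sum>a\<in>{-int n..int n}. h a) * (\<Sum>a\<in>{-int n..int n}. h a))"
    unfolding sum.cartesian_product[symmetric] by (subst sum_product) (simp only: sum_distrib_left)
  also have "\<dots> \<le> 4 * (6 * 6)"
    using hsum by (intro mult_left_mono mult_mono) (auto simp: h0 sum_nonneg)
  finally show ?thesis by simp
qed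

text \<open>The set \<open>G\<close> carries all but \<open>\<epsilon>\<close> of the supremum of the finite sums.\<close>

lemma small_tail:
  fixes f :: "'a \<Rightarrow> real"
  assumes nn: "\<And>x. f x \<ge> 0" and bd: "\<And>F. finite F \<Longrightarrow> sum f F \<le> C" and "\<epsilon> > 0"
  shows "\<exists>G. finite G \<and> (\<forall>F. finite F \<longrightarrow> F \<inter> G = {} \<longrightarrow> sum f F \<le> \<epsilon>)"
proof -
  define S where "S = sum f ` {F. finite F}"
  have bdd: "bdd_above S" using bd by (auto simp: S_def bdd_above_def)
  have "Sup S - \<epsilon> < Sup S" using \<open>\<epsilon> > 0\<close> by simp
  moreover have "S \<noteq> {}" by (auto simp: S_def)
  ultimately obtain G where G: "finite G" "Sup S - \<epsilon> < sum f G"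
    using less_cSupD[of S "Sup S - \<epsilon>"] by (auto simp: S_def)
  have "sum f F \<le> \<epsilon>" if "finite F" "F \<inter> G = {}" for F
  proof -
    have "sum f (F \<union> G) \<le> Sup S"
      using that G bdd by (intro cSup_upper) (auto simp: S_def)
    then show ?thesis using that G by (simp add: sum.union_disjoint)
  qed
  then show ?thesis using G by blast
qed

definition box :: "nat \<Rightarrow> gint set" where
  "box R = {z. gre z \<in> {0..<int R} \<and> gim z \<in> {0..<int R}}"

lemma box_altdef: "box R = case_prod GInt ` ({0..<int R} \<times> {0..<int R})"
proof (rule equalityI)
  show "box R \<subseteq> case_prod GInt ` ({0..<int R} \<times> {0..<int R})"
  proof
    fix z assume "z \<in> box R"
    then show "z \<in> case_prod GInt ` ({0..<int R} \<times> {0..<int R})"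
      by (intro image_eqI[of _ _ "(gre z, gim z)"]) (auto simp: box_def)
  qed
  show "case_prod GInt ` ({0..<int R} \<times> {0..<int R}) \<subseteq> box R"
    by (rule image_subsetI) (simp add: box_def case_prod_beta mem_Times_iff)
qed

lemma finite_box [simp]: "finite (box R)"
  unfolding box_altdef by (intro finite_imageI finite_cartesian_product finite_atLeastLessThan_int)

lemma card_box: "card (box R) = R\<^sup>2"
proof -
  have "inj_on (case_prod GInt) A" for A
    by (rule inj_onI) (simp add: case_prod_beta prod_eq_iff)
  then show ?thesis unfolding box_altdef by (simp add: card_image power2_eq_square)
qed

text \<open>The box is cut into squares with \<open>s\<close> lattice points along each side, \<open>s\<close> being half the minimal distance \<open>d\<close>
  rounded up; each of them contains at most one point of \<open>Z\<close>.\<close>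

lemma separated_card_le:
  assumes "Z \<subseteq> box R" "d > 0"
    and sep: "\<And>z w. z \<in> Z \<Longrightarrow> w \<in> Z \<Longrightarrow> z \<noteq> w \<Longrightarrow> d\<^sup>2 \<le> gnorm (z - w)"
  shows "real (card Z) \<le> 8 * (real R)\<^sup>2 * (1 / (real_of_int d)\<^sup>2) + 2"
proof -
  define s where "s = (d + 1) div 2"
  have s: "s \<ge> 1" "d \<le> 2 * s" "2 * (s - 1) < d" using \<open>d > 0\<close> by (auto simp: s_def)
  define c where "c = (\<lambda>z. (gre z div s, gim z div s))"
  have "inj_on c Z"
  proof (rule inj_onI, rule ccontr)
    fix z w assume zw: "z \<in> Z" "w \<in> Z" "c z = c w" "z \<noteq> w"
    have cell: "\<bar>x - y\<bar> \<le> s - 1" if "x div s = y div s" for x y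
    proof -
      have "x - y = x mod s - y mod s"
        using that by (metis add_diff_cancel_left mult_div_mod_eq)
      moreover have "0 \<le> x mod s" "x mod s < s" "0 \<le> y mod s" "y mod s < s" using s by auto
      ultimately show ?thesis by linarith
    qed
    have sq: "4 * (x * x) \<le> (d - 1) * (d - 1)" if "\<bar>x\<bar> \<le> s - 1" for x :: int
    proof -
      have "\<bar>2 * x\<bar> * \<bar>2 * x\<bar> \<le> (d - 1) * (d - 1)"
        using that s \<open>d > 0\<close> by (intro mult_mono) auto
      then show ?thesis by (simp only: abs_mult_self_eq)
    qed
    have zw': "\<bar>gre (z - w)\<bar> \<le> s - 1" "\<bar>gim (z - w)\<bar> \<le> s - 1"
      using cell zw(3) by (auto simp: c_def)
    have "4 * gnorm (z - w) \<le> 2 * ((d - 1) * (d - 1))"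
      using sq[OF zw'(1)] sq[OF zw'(2)] unfolding gnorm_def distrib_left by linarith
    also have "(d - 1) * (d - 1) < d * d" using \<open>d > 0\<close> by (simp add: algebra_simps)
    finally have "4 * gnorm (z - w) < 2 * d\<^sup>2" by (simp add: power2_eq_square)
    moreover have "0 \<le> d\<^sup>2" by simp
    ultimately show False using sep[OF zw(1,2,4)] by linarith
  qed
  moreover have "c ` Z \<subseteq> {0..int R div s} \<times> {0..int R div s}"
  proof (rule image_subsetI)
    fix z assume "z \<in> Z"
    then have "z \<in> box R" using assms(1) by blast
    then show "c z \<in> {0..int R div s} \<times> {0..int R div s}"
      using s by (simp add: c_def box_def pos_imp_zdiv_nonneg_iff zdiv_mono1)
  qed
  ultimately have "card Z \<le> card ({0..int R div s} \<times> {0..int R div s})"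
    by (metis card_image card_mono finite_SigmaI finite_atLeastAtMost_int)
  also have "\<dots> = nat (int R div s + 1) * nat (int R div s + 1)" by simp
  finally have "real (card Z) \<le> real (nat (int R div s + 1) * nat (int R div s + 1))"
    by (simp only: of_nat_le_iff)
  also have "\<dots> = (real_of_int (int R div s) + 1)\<^sup>2"
    using s by (simp add: power2_eq_square pos_imp_zdiv_nonneg_iff)
  also have "\<dots> \<le> (2 * (real R / real_of_int d) + 1)\<^sup>2"
  proof (rule power_mono)
    have "real_of_int (int R div s) \<le> real_of_int (int R) / real_of_int s"
      by (rule real_of_int_div4)
    also have "\<dots> \<le> real R / (real_of_int d / 2)"
    proof (rule frac_le)
      have "real_of_int d \<le> real_of_int (2 * s)" using s(2) by (simp only: of_int_le_iff)
      then show "real_of_int d / 2 \<le> real_of_int s" by simp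
    qed (use \<open>d > 0\<close> in simp_all)
    finally show "real_of_int (int R div s) + 1 \<le> 2 * (real R / real_of_int d) + 1"
      by (simp add: mult.commute)
  qed (use s in \<open>simp add: pos_imp_zdiv_nonneg_iff\<close>)
  also have "\<dots> \<le> 8 * (real R / real_of_int d)\<^sup>2 + 2"
  proof -
    have "(2 * x + 1)\<^sup>2 \<le> 8 * x\<^sup>2 + 2" for x :: real
      using zero_le_power2[of "2 * x - 1"] by (simp add: power2_eq_square algebra_simps)
    then show ?thesis .
  qed
  finally show ?thesis by (simp add: power_divide)
qed

lemma card_gnorm_le:
  fixes n :: int
  assumes "n \<ge> 1"
  shows "int (card {z. gnorm z \<le> n}) \<le> 9 * n"
proof -
  define m where "m = \<lfloor>sqrt (real_of_int n)\<rfloor>"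
  have m1: "m \<ge> 1" using assms by (simp add: m_def le_floor_iff)
  have "real_of_int m \<le> sqrt (real_of_int n)" by (simp add: m_def)
  then have "(real_of_int m)\<^sup>2 \<le> real_of_int n"
    using m1 by (metis assms of_int_0_le_iff order_trans real_le_rsqrt real_sqrt_le_iff real_sqrt_abs abs_of_nonneg zero_le_one)
  then have mm: "m * m \<le> n" by (simp add: power2_eq_square flip: of_int_mult)
  have bd: "\<bar>x\<bar> \<le> m" if "x * x \<le> n" for x :: int
  proof -
    have "(real_of_int \<bar>x\<bar>)\<^sup>2 \<le> real_of_int n"
      using that by (simp add: power2_eq_square flip: of_int_mult)
    then have "real_of_int \<bar>x\<bar> \<le> sqrt (real_of_int n)" by (rule real_le_rsqrt)
    then show ?thesis by (simp add: m_def le_floor_iff)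
  qed
  have "{z. gnorm z \<le> n} \<subseteq> case_prod GInt ` ({-m..m} \<times> {-m..m})"
  proof
    fix z assume "z \<in> {z. gnorm z \<le> n}"
    then have "gre z * gre z + gim z * gim z \<le> n" by (simp add: gnorm_def)
    then have "gre z * gre z \<le> n" "gim z * gim z \<le> n"
      using zero_le_square[of "gre z"] zero_le_square[of "gim z"] by linarith+
    then have "\<bar>gre z\<bar> \<le> m" "\<bar>gim z\<bar> \<le> m" using bd by auto
    then show "z \<in> case_prod GInt ` ({-m..m} \<times> {-m..m})"
      by (intro image_eqI[of _ _ "(gre z, gim z)"]) auto
  qed
  then have "card {z. gnorm z \<le> n} \<le> card (case_prod GInt ` ({-m..m} \<times> {-m..m}))"
    by (rule card_mono[rotated]) auto
  also have "\<dots> \<le> card ({-m..m} \<times> {-m..m})" by (rule card_image_le) auto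
  also have "int \<dots> = (2 * m + 1) * (2 * m + 1)" using m1 by simp
  also have "\<dots> \<le> (3 * m) * (3 * m)" using m1 by (intro mult_mono) auto
  also have "\<dots> \<le> 9 * n" using mm by simp
  finally show ?thesis by simp
qed

text \<open>The sieve. A progression \<open>y + Q z\<close> takes \<open>k\<close>-free values simultaneously at all shifts \<open>x \<in> F\<close> provided that it does so
  at the primes dividing \<open>Q\<close> and that \<open>Q\<close> is divisible by the finitely many primes in a set \<open>G\<close> depending only
  on \<open>F\<close>. Among the \<open>R\<^sup>2\<close> values of \<open>z\<close> in a large box, a prime \<open>p\<close> not dividing \<open>Q\<close> rules out at most
  \<open>8 R\<^sup>2 / (gnorm p)\<^sup>2 + 2\<close>, since \<open>k \<ge> 2\<close> makes the bad \<open>z\<close> differ by numbers of norm at least \<open>(gnorm p)\<^sup>2\<close>. The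
  main terms sum to a small multiple of \<open>R\<^sup>2\<close> because \<open>G\<close> has been removed. As the values of the
  progression have norm \<open>O(R\<^sup>2)\<close>, only primes of norm \<open>O(R)\<close> matter; there are \<open>O(R)\<close> of them, so the error terms
  are negligible.\<close>

lemma sieve_exists:
  assumes "k \<ge> 2" "finite F"
  shows "\<exists>G :: gint set. finite G \<and>
    (\<forall>Q y. Q > 0 \<longrightarrow> (\<forall>p\<in>G. prime_elem p \<longrightarrow> p dvd of_int Q) \<longrightarrow>
    (\<forall>p. prime_elem p \<longrightarrow> p dvd of_int Q \<longrightarrow> p ^ k dvd of_int Q \<and> (\<forall>x\<in>F. \<not> p ^ k dvd x + y)) \<longrightarrow>
    (\<exists>z. \<forall>x\<in>F. kfree k (x + (y + of_int Q * z))))"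
proof -
  define c where "c = card F"
  define f where "f = (\<lambda>g. 1 / (real_of_int (gnorm g))\<^sup>2)"
  obtain G where G: "finite G"
    and tail: "\<And>A. finite A \<Longrightarrow> A \<inter> G = {} \<Longrightarrow> sum f A \<le> 1 / (16 * (real c + 1))"
    using small_tail[of f 144 "1 / (16 * (real c + 1))"] sum_inverse_gnorm_bounded
    by (auto simp: f_def)
  have "\<exists>z. \<forall>x\<in>F. kfree k (x + (y + of_int Q * z))"
    if Q: "Q > 0" and QG: "\<forall>p\<in>G. prime_elem p \<longrightarrow> p dvd of_int Q"
      and Qy: "\<forall>p. prime_elem p \<longrightarrow> p dvd of_int Q \<longrightarrow>
        p ^ k dvd of_int Q \<and> (\<forall>x\<in>F. \<not> p ^ k dvd x + y)" for Q y
  proof (rule ccontr)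
    assume no: "\<nexists>z. \<forall>x\<in>F. kfree k (x + (y + of_int Q * z))"
    define w where "w = (\<lambda>x z. x + (y + of_int Q * z))"
    obtain K where K: "K \<ge> 0" "\<And>x. x \<in> F \<Longrightarrow> \<bar>gre (x + y)\<bar> \<le> K \<and> \<bar>gim (x + y)\<bar> \<le> K"
    proof -
      define K where "K = (\<Sum>x\<in>F. \<bar>gre (x + y)\<bar> + \<bar>gim (x + y)\<bar>)"
      have "\<bar>gre (x + y)\<bar> + \<bar>gim (x + y)\<bar> \<le> K" if "x \<in> F" for x
        unfolding K_def using assms(2) that
          sum_nonneg_leq_bound[of F "\<lambda>x. \<bar>gre (x + y)\<bar> + \<bar>gim (x + y)\<bar>" K x]
        by (auto simp: K_def)
      moreover have "K \<ge> 0" unfolding K_def by (intro sum_nonneg) auto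
      ultimately show ?thesis using that[of K] by fastforce
    qed
    define C where "C = 2 * (K + Q)"
    have C: "C \<ge> 2" using K(1) Q by (simp add: C_def)
    \<comment> \<open>large enough for the linear error terms \<open>2 c + 36 c C R\<close> to stay below \<open>R\<^sup>2\<close>\<close>
    define R :: nat where "R = 2 * c + 36 * c * nat C + 1"
    \<comment> \<open>the primes that can divide a nonzero value of the progression over the box of side \<open>R\<close>\<close>
    define P where "P = {p. prime_elem p \<and> \<not> p dvd of_int Q \<and> gnorm p \<le> C * int R}"
    \<comment> \<open>the values \<open>z\<close> ruled out by \<open>p\<close> at the shift \<open>x\<close>; \<open>Z0\<close> collects those at which every prime is bad\<close>
    define Z where "Z = (\<lambda>x p. {z \<in> box R. p ^ k dvd w x z})"
    define Z0 where "Z0 = (\<lambda>x. {z \<in> box R. w x z = 0})"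
    have finP: "finite P"
      by (rule finite_subset[OF _ finite_gnorm_le[of "C * int R"]]) (auto simp: P_def)
    have w_diff: "w x z - w x z' = of_int Q * (z - z')" for x z z'
      by (simp add: w_def algebra_simps)
    have w_bound: "gnorm (w x z) \<le> (C * int R)\<^sup>2" if "x \<in> F" "z \<in> box R" for x z
    proof -
      have R1: "1 \<le> int R" by (simp add: R_def)
      have co: "\<bar>u + Q * v\<bar> \<le> (K + Q) * int R" if "\<bar>u\<bar> \<le> K" "v \<in> {0..<int R}" for u v
      proof -
        have "\<bar>u + Q * v\<bar> \<le> \<bar>u\<bar> + \<bar>Q * v\<bar>" by (rule abs_triangle_ineq)
        also have "\<dots> = \<bar>u\<bar> + Q * v" using that Q by (simp add: abs_mult)
        also have "\<dots> \<le> K * int R + Q * int R"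
        proof (rule add_mono)
          have "K * 1 \<le> K * int R" using K(1) R1 by (intro mult_left_mono) auto
          then show "\<bar>u\<bar> \<le> K * int R" using that by simp
          show "Q * v \<le> Q * int R" using that Q by (intro mult_left_mono) auto
        qed
        finally show ?thesis by (simp add: algebra_simps)
      qed
      have "\<bar>gre (w x z)\<bar> \<le> (K + Q) * int R" "\<bar>gim (w x z)\<bar> \<le> (K + Q) * int R"
        using co[of "gre (x + y)" "gre z"] co[of "gim (x + y)" "gim z"] K(2)[OF that(1)] that(2)
        by (auto simp: w_def box_def algebra_simps)
      then have "\<bar>gre (w x z)\<bar> * \<bar>gre (w x z)\<bar> \<le> ((K + Q) * int R) * ((K + Q) * int R)"
        "\<bar>gim (w x z)\<bar> * \<bar>gim (w x z)\<bar> \<le> ((K + Q) * int R) * ((K + Q) * int R)"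
        by (intro mult_mono; simp)+
      then have "gnorm (w x z) \<le> 2 * (((K + Q) * int R) * ((K + Q) * int R))"
        unfolding gnorm_def abs_mult_self_eq by linarith
      moreover have "4 * (((K + Q) * int R) * ((K + Q) * int R)) = (C * int R)\<^sup>2"
        by (simp add: C_def power2_eq_square algebra_simps)
      moreover have "0 \<le> ((K + Q) * int R) * ((K + Q) * int R)" by (rule zero_le_square)
      ultimately show ?thesis by linarith
    qed
    have cover: "box R \<subseteq> (\<Union>x\<in>F. Z0 x \<union> (\<Union>p\<in>P. Z x p))"
    proof
      fix z assume z: "z \<in> box R"
      obtain x p where x: "x \<in> F" and p: "prime_elem p" "p ^ k dvd w x z"
        using no unfolding w_def kfree_def by blast
      show "z \<in> (\<Union>x\<in>F. Z0 x \<union> (\<Union>p\<in>P. Z x p))"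
      proof (cases "w x z = 0")
        case False
        have "gnorm (p ^ k) \<le> gnorm (w x z)" using dvd_imp_gnorm_le[OF p(2) False] .
        also have "\<dots> \<le> (C * int R)\<^sup>2" using w_bound x z by blast
        finally have "gnorm p ^ k \<le> (C * int R)\<^sup>2" by (simp add: gnorm_power)
        moreover have "(gnorm p)\<^sup>2 \<le> gnorm p ^ k"
          using assms(1) gnorm_prime_ge_2[OF p(1)] by (intro power_increasing) auto
        ultimately have "(gnorm p)\<^sup>2 \<le> (C * int R)\<^sup>2" by linarith
        then have "gnorm p \<le> C * int R" by (rule power2_le_imp_le) (use C in simp)
        moreover have "\<not> p dvd of_int Q"
        proof
          assume "p dvd of_int Q"
          then have pQ: "p ^ k dvd of_int Q" "\<not> p ^ k dvd x + y" using Qy p(1) x by auto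
          have "p ^ k dvd w x z - of_int Q * z" using p(2) pQ(1) by (intro dvd_diff) auto
          then show False using pQ(2) by (simp add: w_def add.assoc)
        qed
        ultimately have "p \<in> P" using p(1) by (simp add: P_def)
        then show ?thesis using x z p(2) by (auto simp: Z_def)
      qed (use x z in \<open>auto simp: Z0_def\<close>)
    qed
    have Z0: "card (Z0 x) \<le> 1" for x
    proof -
      have "z = z'" if "z \<in> Z0 x" "z' \<in> Z0 x" for z z'
      proof -
        have "of_int Q * (z - z') = 0" using that w_diff[of x z z'] by (simp add: Z0_def)
        then show ?thesis using Q by simp
      qed
      then show ?thesis
        by (metis (no_types, lifting) card_le_Suc0_iff_eq One_nat_def finite_box finite_subset
            mem_Collect_eq Z0_def subsetI)
    qed
    have Z: "real (card (Z x p)) \<le> 8 * (real R)\<^sup>2 * f p + 2" if "p \<in> P" for x p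
      unfolding f_def
    proof (rule separated_card_le)
      have p: "prime_elem p" "\<not> p dvd of_int Q" using that by (auto simp: P_def)
      show "gnorm p > 0" using gnorm_prime_ge_2[OF p(1)] by linarith
      fix z z' assume zz: "z \<in> Z x p" "z' \<in> Z x p" "z \<noteq> z'"
      have "p ^ k dvd w x z - w x z'" using zz by (intro dvd_diff) (auto simp: Z_def)
      then have "p ^ k dvd of_int Q * (z - z')" by (simp only: w_diff)
      moreover have "comaximal (p ^ k) (of_int Q)"
        by (intro comaximal_power_left prime_comaximal p)
      ultimately have "p ^ k dvd z - z'" by (rule comaximal_dvd_mult[rotated])
      then have "gnorm p ^ k \<le> gnorm (z - z')"
        using dvd_imp_gnorm_le[of "p ^ k" "z - z'"] zz(3) by (simp add: gnorm_power)
      moreover have "(gnorm p)\<^sup>2 \<le> gnorm p ^ k"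
        using assms(1) gnorm_prime_ge_2[OF p(1)] by (intro power_increasing) auto
      ultimately show "(gnorm p)\<^sup>2 \<le> gnorm (z - z')" by linarith
    qed (auto simp: Z_def)
    have cardP: "real (card P) \<le> 9 * (real_of_int C * real R)"
    proof -
      have "1 * 1 \<le> C * int R" using C by (intro mult_mono) (auto simp: R_def)
      then have "int (card {z. gnorm z \<le> C * int R}) \<le> 9 * (C * int R)"
        by (intro card_gnorm_le) simp
      moreover have "card P \<le> card {z. gnorm z \<le> C * int R}"
        by (intro card_mono finite_gnorm_le) (auto simp: P_def)
      ultimately have "int (card P) \<le> 9 * (C * int R)" by linarith
      then have "real_of_int (int (card P)) \<le> real_of_int (9 * (C * int R))"
        by (simp only: of_int_le_iff)
      then show ?thesis by simp
    qed
    have "P \<inter> G = {}" using QG by (auto simp: P_def)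
    then have sumf: "sum f P \<le> 1 / (16 * (real c + 1))" using tail finP by blast
    have one: "real (card (Z0 x \<union> (\<Union>p\<in>P. Z x p)))
        \<le> 1 + (8 * (real R)\<^sup>2 * (1 / (16 * (real c + 1))) + 2 * (9 * (real_of_int C * real R)))" for x
    proof -
      have "card (Z0 x \<union> (\<Union>p\<in>P. Z x p)) \<le> card (Z0 x) + (\<Sum>p\<in>P. card (Z x p))"
        by (rule order_trans[OF card_Un_le add_left_mono[OF card_UN_le[OF finP]]])
      then have "real (card (Z0 x \<union> (\<Union>p\<in>P. Z x p)))
          \<le> real (card (Z0 x)) + (\<Sum>p\<in>P. real (card (Z x p)))"
        by (simp flip: of_nat_sum of_nat_add)
      also have "\<dots> \<le> 1 + (\<Sum>p\<in>P. 8 * (real R)\<^sup>2 * f p + 2)"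
        using Z0[of x] Z by (intro add_mono sum_mono) auto
      also have "(\<Sum>p\<in>P. 8 * (real R)\<^sup>2 * f p + 2) = 8 * (real R)\<^sup>2 * sum f P + 2 * real (card P)"
        by (simp add: sum.distrib sum_distrib_left)
      also have "\<dots> \<le> 8 * (real R)\<^sup>2 * (1 / (16 * (real c + 1))) + 2 * (9 * (real_of_int C * real R))"
        by (intro add_mono mult_left_mono sumf cardP) auto
      finally show ?thesis by simp
    qed
    have "card (box R) \<le> card (\<Union>x\<in>F. Z0 x \<union> (\<Union>p\<in>P. Z x p))"
      by (rule card_mono[OF _ cover]) (use assms(2) finP in \<open>auto simp: Z_def Z0_def\<close>)
    also have "\<dots> \<le> (\<Sum>x\<in>F. card (Z0 x \<union> (\<Union>p\<in>P. Z x p)))"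
      by (rule card_UN_le[OF assms(2)])
    finally have "real (card (box R)) \<le> (\<Sum>x\<in>F. real (card (Z0 x \<union> (\<Union>p\<in>P. Z x p))))"
      by (simp flip: of_nat_sum)
    also have "\<dots> \<le> (\<Sum>x\<in>F. 1 + (8 * (real R)\<^sup>2 * (1 / (16 * (real c + 1))) + 2 * (9 * (real_of_int C * real R))))"
      by (intro sum_mono one)
    also have "\<dots> = real c + 8 * (real R)\<^sup>2 * (real c / (16 * (real c + 1))) + 18 * real c * real_of_int C * real R"
      by (simp add: c_def algebra_simps)
    also have "8 * (real R)\<^sup>2 * (real c / (16 * (real c + 1))) \<le> 8 * (real R)\<^sup>2 * (1 / 16)"
      by (intro mult_left_mono) (auto simp: field_simps)
    finally have "(real R)\<^sup>2 \<le> 2 * real c + 36 * real c * real_of_int C * real R"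
      by (simp add: card_box)
    also have "\<dots> \<le> 2 * real c * real R + 36 * real c * real_of_int C * real R"
      by (intro add_right_mono) (simp add: R_def mult_le_cancel_left1)
    also have "\<dots> = (real R - 1) * real R"
      using C by (simp add: R_def algebra_simps of_nat_nat)
    also have "\<dots> < (real R)\<^sup>2"
    proof -
      have "R > 0" by (simp add: R_def)
      then show ?thesis by (simp add: power2_eq_square left_diff_distrib)
    qed
    finally show False by simp
  qed
  then show ?thesis using G by blast
qed

text \<open>Distinct norms keep the chosen primes pairwise non-associated.\<close>

lemma distinct_large_primes:
  assumes "finite W"
  shows "\<exists>f. \<forall>x\<in>W. prime_elem (f x) \<and> gnorm (f x) > b \<and> (\<forall>y\<in>W. gnorm (f x) = gnorm (f y) \<longrightarrow> x = y)"
  using assms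
proof (induction W rule: finite_induct)
  case (insert a W)
  then obtain f where f: "\<And>x. x \<in> W \<Longrightarrow> prime_elem (f x) \<and> gnorm (f x) > b"
    "\<And>x y. x \<in> W \<Longrightarrow> y \<in> W \<Longrightarrow> gnorm (f x) = gnorm (f y) \<Longrightarrow> x = y" by blast
  obtain p where p: "prime_elem p" "gnorm p > max b (\<Sum>x\<in>W. gnorm (f x))"
    using large_split_prime by blast
  have less: "gnorm (f x) < gnorm p" if "x \<in> W" for x
    using p(2) member_le_sum[of x W "\<lambda>x. gnorm (f x)"] that insert.hyps by simp
  define g where "g = f(a := p)"
  have "\<forall>x\<in>insert a W. prime_elem (g x) \<and> gnorm (g x) > b \<and>
      (\<forall>y\<in>insert a W. gnorm (g x) = gnorm (g y) \<longrightarrow> x = y)"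
    using f p less insert.hyps by (auto simp: g_def) (metis less_irrefl)+
  then show ?case by blast
qed simp

lemma prime_power_dvd_cong: "p dvd q \<Longrightarrow> q ^ k dvd z \<Longrightarrow> p ^ k dvd (z :: gint)"
  by (meson dvd_power_same dvd_trans)

text \<open>The points of \<open>B - F\<close> are removed by a congruence modulo the \<open>k\<close>-th power of a large prime of their own; every
  other prime dividing \<open>Q\<close> is steered by the Chinese remainder theorem into a class missed by \<open>F\<close>. The large
  primes do no harm to \<open>F\<close>, because their norms exceed those of all differences of points of \<open>B\<close>. The sieve
  takes care of the primes that do not divide \<open>Q\<close>.\<close>

lemma pattern_occurs:
  assumes k: "k \<ge> 2" and "finite B" "F \<subseteq> B" and adm: "admissible k F"
  shows "\<exists>y. \<forall>x\<in>B. kfree k (x + y) \<longleftrightarrow> x \<in> F"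
proof -
  have finF: "finite F" using assms finite_subset by blast
  obtain G :: "gint set" where G: "finite G" and sieve: "\<And>Q y. Q > 0 \<Longrightarrow>
      (\<forall>p\<in>G. prime_elem p \<longrightarrow> p dvd of_int Q) \<Longrightarrow>
      (\<forall>p. prime_elem p \<longrightarrow> p dvd of_int Q \<longrightarrow> p ^ k dvd of_int Q \<and> (\<forall>x\<in>F. \<not> p ^ k dvd x + y)) \<Longrightarrow>
      (\<exists>z. \<forall>x\<in>F. kfree k (x + (y + of_int Q * z)))"
    using sieve_exists[OF k finF] by blast
  define b where "b = (\<Sum>u\<in>(\<lambda>(x, x'). x - x') ` (B \<times> B). gnorm u)"
  have b: "gnorm (x - x') \<le> b" if "x \<in> B" "x' \<in> B" for x x'
    unfolding b_def
  proof (rule member_le_sum)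
    show "x - x' \<in> (\<lambda>(x, x'). x - x') ` (B \<times> B)"
      by (rule image_eqI[of _ _ "(x, x')"]) (use that in simp_all)
  qed (use assms(2) in simp_all)
  obtain f where f: "\<And>x. x \<in> B - F \<Longrightarrow> prime_elem (f x) \<and> gnorm (f x) > b"
    "\<And>x y. x \<in> B - F \<Longrightarrow> y \<in> B - F \<Longrightarrow> gnorm (f x) = gnorm (f y) \<Longrightarrow> x = y"
    using distinct_large_primes[of "B - F" b] assms(2) by blast
  define D where "D = (\<Prod>p\<in>{p \<in> G. prime_elem p} \<union> f ` (B - F). gnorm p)"
  define Q where "Q = D ^ k"
  have D_dvd: "p dvd of_int D" if "p \<in> {p \<in> G. prime_elem p} \<union> f ` (B - F)" for p
  proof -
    have "gnorm p dvd D" unfolding D_def using that G assms(2) by (intro dvd_prodI) auto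
    then have "(of_int (gnorm p) :: gint) dvd of_int D" by (simp add: of_int_dvd_iff)
    then show ?thesis using dvd_gnorm dvd_trans by blast
  qed
  have "gnorm p > 0" if "p \<in> {p \<in> G. prime_elem p} \<union> f ` (B - F)" for p
  proof -
    have "prime_elem p" using that f(1) by blast
    then show ?thesis using gnorm_prime_ge_2[of p] by linarith
  qed
  then have "D > 0" unfolding D_def by (rule prod_pos)
  then have Q: "Q > 0" by (simp add: Q_def)
  have Q_dvd: "p ^ k dvd of_int Q" if "prime_elem p" "p dvd of_int Q" for p
    using that by (simp add: Q_def) (meson dvd_power_same prime_elem_dvd_power)
  \<comment> \<open>one prime from each class of associates\<close>
  define r where "r = (\<lambda>p :: gint. SOME q. prime_elem q \<and> q dvd p)"
  have r: "prime_elem (r p) \<and> r p dvd p" if "prime_elem p" for p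
    unfolding r_def by (rule someI[of _ p]) (use that in simp)
  have r': "p dvd r p" if "prime_elem p" for p
    using r[OF that] that prime_dvd_prime_imp_dvd by blast
  have r_eq: "r p = r q" if "p dvd q" "q dvd p" for p q
  proof -
    have "(q' dvd p) = (q' dvd q)" for q' using that dvd_trans by blast
    then show ?thesis by (simp add: r_def)
  qed
  define A where "A = r ` {p. prime_elem p \<and> p dvd of_int Q}"
  have "finite {p :: gint. prime_elem p \<and> p dvd of_int Q}"
    by (rule finite_subset[OF _ finite_gnorm_le[of "gnorm (of_int Q)"]])
      (use Q in \<open>auto intro!: dvd_imp_gnorm_le\<close>)
  then have finA: "finite A" by (simp add: A_def)
  have primeA: "prime_elem a" if "a \<in> A" for a using that r by (auto simp: A_def)
  have comaxA: "comaximal (a ^ k) (a' ^ k)" if aa: "a \<in> A" "a' \<in> A" "a \<noteq> a'" for a a'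
  proof -
    have "\<not> a dvd a'"
    proof
      assume dv: "a dvd a'"
      obtain p p' where pp: "a = r p" "a' = r p'" "prime_elem p" "prime_elem p'"
        using aa by (auto simp: A_def)
      have "a' dvd a" using dv primeA aa prime_dvd_prime_imp_dvd by blast
      then have "p dvd p'" "p' dvd p" using dv r r' pp by (meson dvd_trans)+
      then show False using r_eq[of p p'] pp aa(3) by simp
    qed
    then show ?thesis using primeA aa by (intro comaximal_power prime_comaximal) auto
  qed
  obtain c where c: "\<And>p u. prime_elem p \<Longrightarrow> u \<in> F \<Longrightarrow> \<not> p ^ k dvd u - c p"
    using adm unfolding admissible_def by metis
  \<comment> \<open>the residue of \<open>y\<close> prescribed modulo \<open>a ^ k\<close>: either \<open>a\<close> is reserved for removing a point, or it must spare \<open>F\<close>\<close>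
  define t where "t = (\<lambda>a. if \<exists>x\<in>B - F. a dvd f x then - (SOME x. x \<in> B - F \<and> a dvd f x) else - c a)"
  obtain y where y: "\<And>a. a \<in> A \<Longrightarrow> a ^ k dvd y - t a"
    using chinese_remainder_comaximal[OF finA, of "\<lambda>a. a ^ k" t] comaxA by blast
  have t_x: "t a = - x" if "prime_elem a" "x \<in> B - F" "a dvd f x" for a x
  proof -
    define x' where "x' = (SOME x. x \<in> B - F \<and> a dvd f x)"
    have x': "x' \<in> B - F \<and> a dvd f x'"
      unfolding x'_def by (rule someI[of _ x]) (use that in simp)
    have "f x dvd a" "f x' dvd a" using prime_dvd_prime_imp_dvd f(1) that x' by blast+
    then have "f x dvd f x'" "f x' dvd f x" using that x' dvd_trans by blast+
    then have "gnorm (f x) = gnorm (f x')"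
      by (metis dvd_imp_gnorm_dvd gnorm_nonneg zdvd_antisym_nonneg)
    then have "x = x'" using f(2) that x' by blast
    then show ?thesis using that by (auto simp: t_def x'_def)
  qed
  have F_ok: "\<not> p ^ k dvd x + y" if p: "prime_elem p" "p dvd of_int Q" and x: "x \<in> F" for p x
  proof
    assume "p ^ k dvd x + y"
    define a where "a = r p"
    have a: "a \<in> A" "prime_elem a" using p r by (auto simp: A_def a_def)
    have "a ^ k dvd x + y" using \<open>p ^ k dvd x + y\<close> r[OF p(1)] prime_power_dvd_cong a_def by blast
    from this y[OF a(1)] have "a ^ k dvd (x + y) - (y - t a)" by (rule dvd_diff)
    then have at: "a ^ k dvd x + t a" by simp
    show False
    proof (cases "\<exists>x\<in>B - F. a dvd f x")
      case True
      then obtain x' where x': "x' \<in> B - F" "a dvd f x'" by blast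
      have "a ^ k dvd x - x'" using at t_x[OF a(2) x'] by simp
      moreover have "x - x' \<noteq> 0" using x x' by auto
      ultimately have "gnorm (a ^ k) \<le> gnorm (x - x')" by (rule dvd_imp_gnorm_le)
      then have "gnorm a \<le> b"
        using gnorm_le_gnorm_power[of k a] k b[of x x'] x x' assms(3) by fastforce
      moreover have "f x' dvd a" using prime_dvd_prime_imp_dvd a(2) f(1) x' by blast
      then have "gnorm (f x') \<le> gnorm a"
        using a(2) by (intro dvd_imp_gnorm_le) auto
      ultimately show False using f(1)[OF x'(1)] by linarith
    next
      case False
      then have "t a = - c a" by (simp add: t_def)
      then show False using at c[OF a(2) x] by simp
    qed
  qed
  obtain z where z: "\<And>x. x \<in> F \<Longrightarrow> kfree k (x + (y + of_int Q * z))"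
  proof -
    have "\<forall>p\<in>G. prime_elem p \<longrightarrow> p dvd of_int Q"
      using D_dvd k by (auto simp: Q_def intro!: dvd_power_le[of _ _ 1, simplified] dvd_trans[OF _ dvd_power])
    then have "\<exists>z. \<forall>x\<in>F. kfree k (x + (y + of_int Q * z))"
      by (rule sieve[OF Q]) (use Q_dvd F_ok in \<open>intro allI impI conjI ballI; simp\<close>)
    then show ?thesis using that by blast
  qed
  have "\<not> kfree k (x + (y + of_int Q * z))" if x: "x \<in> B - F" for x
  proof -
    have px: "prime_elem (f x)" using f(1) x by blast
    have fD: "f x dvd of_int D" using D_dvd x by blast
    then have fQ: "f x ^ k dvd of_int Q" by (simp add: Q_def dvd_power_same)
    moreover have "f x dvd f x ^ k" using k by (simp add: dvd_power)
    ultimately have "f x dvd of_int Q" using dvd_trans by blast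
    then have a: "r (f x) \<in> A" using px by (auto simp: A_def)
    have "t (r (f x)) = - x" using t_x r[OF px] x by blast
    then have "r (f x) ^ k dvd y + x" using y[OF a] by simp
    then have "f x ^ k dvd y + x" using r'[OF px] prime_power_dvd_cong by blast
    then have "f x ^ k dvd (y + x) + of_int Q * z" by (rule dvd_add) (simp add: fQ)
    then have "f x ^ k dvd x + (y + of_int Q * z)" by (simp add: algebra_simps)
    then show ?thesis using px by (auto simp: kfree_def)
  qed
  then show ?thesis using z by (intro exI[of _ "y + of_int Q * z"]) blast
qed

section \<open>Sparse admissible sets\<close>

text \<open>Infinitely many candidates for each point leave enough room to avoid finitely many forbidden
  differences.\<close>

lemma sparse_selection:
  fixes D U :: "'b::ab_group_add set"
  assumes "finite R" "finite D" "finite U" and inf: "\<And>z. z \<in> R \<Longrightarrow> infinite {t. P z t}"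
  shows "\<exists>f. \<forall>z\<in>R. P z (f z) \<and> f z \<notin> U \<and> (\<forall>s\<in>U. f z - s \<notin> D \<and> s - f z \<notin> D) \<and>
    (\<forall>z'\<in>R. z' \<noteq> z \<longrightarrow> f z - f z' \<notin> D)"
  using assms(1,4)
proof (induction R rule: finite_induct)
  case (insert a R)
  then obtain f where f: "\<And>z. z \<in> R \<Longrightarrow> P z (f z) \<and> f z \<notin> U \<and> (\<forall>s\<in>U. f z - s \<notin> D \<and> s - f z \<notin> D) \<and>
      (\<forall>z'\<in>R. z' \<noteq> z \<longrightarrow> f z - f z' \<notin> D)"
    by (metis insertCI)
  define E where "E = U \<union> (\<lambda>(s, d). s + d) ` ((U \<union> f ` R) \<times> D) \<union> (\<lambda>(s, d). s - d) ` ((U \<union> f ` R) \<times> D)"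
  have "finite E" using insert.hyps assms by (simp add: E_def)
  then have "infinite ({t. P a t} - E)" using insert.prems[of a] by (simp add: Diff_infinite_finite)
  then have "{t. P a t} - E \<noteq> {}" by (metis finite.emptyI)
  then obtain t where t: "P a t" "t \<notin> E" by auto
  have tD: "t - s \<notin> D \<and> s - t \<notin> D" if s: "s \<in> U \<union> f ` R" for s
  proof (intro conjI notI)
    assume "t - s \<in> D"
    then have "t \<in> (\<lambda>(s, d). s + d) ` ((U \<union> f ` R) \<times> D)"
      by (intro image_eqI[of _ _ "(s, t - s)"]) (use s in simp_all)
    then show False using t by (simp add: E_def)
  next
    assume "s - t \<in> D"
    then have "t \<in> (\<lambda>(s, d). s - d) ` ((U \<union> f ` R) \<times> D)"
      by (intro image_eqI[of _ _ "(s, s - t)"]) (use s in simp_all)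
    then show False using t by (simp add: E_def)
  qed
  have "t \<notin> U" using t by (simp add: E_def)
  show ?case
  proof (intro exI[of _ "f(a := t)"] ballI)
    fix z assume z: "z \<in> insert a R"
    show "P z ((f(a := t)) z) \<and> (f(a := t)) z \<notin> U \<and>
        (\<forall>s\<in>U. (f(a := t)) z - s \<notin> D \<and> s - (f(a := t)) z \<notin> D) \<and>
        (\<forall>z'\<in>insert a R. z' \<noteq> z \<longrightarrow> (f(a := t)) z - (f(a := t)) z' \<notin> D)"
      using z f[of z] t tD \<open>t \<notin> U\<close> insert.hyps by (cases "z = a") auto
  qed
qed simp

lemma admissible_singleton:
  assumes "k \<ge> 1" shows "admissible k {u}"
  unfolding admissible_def
proof (intro allI impI exI[of _ "u - 1"] ballI)
  fix p v :: gint assume "prime_elem p" "v \<in> {u}"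
  then show "\<not> p ^ k dvd v - (u - 1)"
    using gnorm_prime_power_gt_1[of p k] assms gint_unit_iff[of "p ^ k"] by simp
qed

lemma prime_dvd_of_int_gnorm:
  assumes "prime_elem p" "p dvd of_int (gnorm q)"
  shows "p dvd q \<or> p dvd gcnj q"
  using assms prime_elem_dvd_multD[of p q "gcnj q"] by (simp add: mult_gcnj)

text \<open>Every residue class that differs from \<open>x\<close> both modulo \<open>p ^ k\<close> and modulo its conjugate can be hit by a sparse
  finite set without spoiling admissibility: modulo the remaining primes of small norm the new points
  are all placed in one class, which \<open>U\<close> already meets unless it is empty, and a finite set cannot
  exhaust the classes modulo the \<open>k\<close>-th power of a prime of large norm. The prime \<open>p\<close> and its conjugate
  are treated together because they divide the same rational integers.\<close>

lemma exists_sparse_cover: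
  assumes k: "k \<ge> 1" and p: "prime_elem p" "comaximal p (gcnj p)"
    and "finite D" "finite U" and adm: "admissible k U"
    and x: "\<And>u. u \<in> U \<Longrightarrow> \<not> p ^ k dvd u - x \<and> \<not> gcnj p ^ k dvd u - x"
  shows "\<exists>T. finite T \<and> T \<inter> U = {} \<and> admissible k (U \<union> T) \<and>
    (\<forall>t\<in>T. \<forall>s\<in>U \<union> T. s \<noteq> t \<longrightarrow> t - s \<notin> D \<and> s - t \<notin> D) \<and>
    (\<forall>z. \<not> p ^ k dvd z - x \<longrightarrow> \<not> gcnj p ^ k dvd z - x \<longrightarrow> (\<exists>t\<in>T. of_int (gnorm p ^ k) dvd t - z))"
proof -
  define N where "N = gnorm p ^ k"
  have Npos: "N > 0" using gnorm_prime_ge_2[OF p(1)] unfolding N_def by (intro zero_less_power) linarith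
  have N_eq: "of_int N = p ^ k * gcnj p ^ k"
    by (simp add: N_def power_mult_distrib[symmetric] mult_gcnj)
  have pN: "p ^ k dvd of_int N" "gcnj p ^ k dvd of_int N" by (simp_all add: N_eq)
  define R where "R = {z \<in> box (nat N). \<not> p ^ k dvd z - x \<and> \<not> gcnj p ^ k dvd z - x}"
  have finR: "finite R" by (simp add: R_def)
  define b where "b = (int (card U + card R))\<^sup>2"
  define Ps where "Ps = {q. prime_elem q \<and> gnorm q \<le> b \<and> \<not> p dvd q \<and> \<not> gcnj p dvd q}"
  have finPs: "finite Ps" by (rule finite_subset[OF _ finite_gnorm_le[of b]]) (auto simp: Ps_def)
  \<comment> \<open>a rational modulus prime to \<open>N\<close> that controls all primes of norm at most \<open>b\<close> other than \<open>p\<close> and its conjugate\<close>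
  define S where "S = (\<Prod>q\<in>Ps. gnorm q) ^ k"
  have Spos: "S > 0" unfolding S_def Ps_def
    using gnorm_prime_ge_2 by (intro zero_less_power prod_pos) fastforce
  have dvdS: "q ^ k dvd of_int S" if "q \<in> Ps" for q
  proof -
    have "gnorm q dvd (\<Prod>q\<in>Ps. gnorm q)" using finPs that by (rule dvd_prodI)
    then have "(of_int (gnorm q) :: gint) dvd of_int (\<Prod>q\<in>Ps. gnorm q)"
      unfolding of_int_dvd_iff gre_gim_of_int by simp
    then have "q dvd of_int (\<Prod>q\<in>Ps. gnorm q)" using dvd_gnorm dvd_trans by blast
    then show ?thesis by (simp only: S_def of_int_power dvd_power_same)
  qed
  have "comaximal (of_int (gnorm q) :: gint) (of_int (gnorm p))" if "q \<in> Ps" for q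
  proof -
    have q: "prime_elem q" "\<not> p dvd q" "\<not> gcnj p dvd q" using that by (auto simp: Ps_def)
    have "comaximal p (of_int (gnorm q))" "comaximal (gcnj p) (of_int (gnorm q))"
      using q p(1) prime_dvd_of_int_gnorm[of p q] prime_dvd_of_int_gnorm[of "gcnj p" q]
        prime_comaximal gcnj_dvd_iff[of p q] gcnj_dvd_swap[of p q] prime_elem_gcnj[of p]
      by (auto intro: prime_comaximal)
    then have "comaximal (p * gcnj p) (of_int (gnorm q))" by (rule comaximal_mult_left)
    then show ?thesis unfolding mult_gcnj by (rule comaximal_sym)
  qed
  then have "comaximal (\<Prod>q\<in>Ps. of_int (gnorm q)) (of_int (gnorm p) :: gint)"
    by (intro comaximal_prod_left)
  then have "comaximal (of_int (gnorm p) ^ k :: gint) ((\<Prod>q\<in>Ps. of_int (gnorm q)) ^ k)"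
    by (rule comaximal_power[OF comaximal_sym])
  then have coNS: "comaximal (of_int N :: gint) (of_int S)"
    by (simp add: N_def S_def)
  obtain u0 where u0: "admissible k (insert u0 U)"
  proof (cases "U = {}")
    case True
    then show ?thesis using that[of 0] admissible_singleton[OF k] by simp
  next
    case False
    then obtain u where "u \<in> U" by blast
    then show ?thesis using that[of u] adm by (simp add: insert_absorb)
  qed
  have inf: "infinite {t. of_int N dvd t - z \<and> of_int S dvd t - u0}" for z
  proof -
    obtain t where t: "of_int N dvd t - z" "of_int S dvd t - u0"
      using comaximal_solve[OF coNS] by blast
    have "inj (\<lambda>n :: nat. t + of_int N * of_int S * of_nat n)"
      using Npos Spos by (intro injI) simp
    then have "infinite (range (\<lambda>n :: nat. t + of_int N * of_int S * of_nat n))"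
      by (simp add: finite_image_iff)
    moreover have "range (\<lambda>n :: nat. t + of_int N * of_int S * of_nat n)
        \<subseteq> {t. of_int N dvd t - z \<and> of_int S dvd t - u0}"
    proof (rule image_subsetI, rule CollectI, rule conjI)
      fix n :: nat
      have eq: "t + of_int N * of_int S * of_nat n - y = (t - y) + of_int N * of_int S * of_nat n" for y
        by simp
      show "of_int N dvd t + of_int N * of_int S * of_nat n - z"
        unfolding eq using t(1) by (rule dvd_add) (simp add: mult.assoc)
      show "of_int S dvd t + of_int N * of_int S * of_nat n - u0"
        unfolding eq using t(2) by (rule dvd_add) (simp add: mult.assoc mult.left_commute)
    qed
    ultimately show ?thesis by (meson finite_subset)
  qed
  have "\<exists>f. \<forall>z\<in>R. (of_int N dvd f z - z \<and> of_int S dvd f z - u0) \<and> f z \<notin> U \<and>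
      (\<forall>s\<in>U. f z - s \<notin> D \<and> s - f z \<notin> D) \<and> (\<forall>z'\<in>R. z' \<noteq> z \<longrightarrow> f z - f z' \<notin> D)"
    by (rule sparse_selection[OF finR \<open>finite D\<close> \<open>finite U\<close>,
        of "\<lambda>z t. of_int N dvd t - z \<and> of_int S dvd t - u0"]) (rule inf)
  then obtain f where "\<forall>z\<in>R. (of_int N dvd f z - z \<and> of_int S dvd f z - u0) \<and> f z \<notin> U \<and>
      (\<forall>s\<in>U. f z - s \<notin> D \<and> s - f z \<notin> D) \<and> (\<forall>z'\<in>R. z' \<noteq> z \<longrightarrow> f z - f z' \<notin> D)" ..
  note f = bspec[OF this]
  define T where "T = f ` R"
  have finT: "finite T" using finR by (simp add: T_def)
  have cover: "\<exists>t\<in>T. of_int N dvd t - z"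
    if z: "\<not> p ^ k dvd z - x" "\<not> gcnj p ^ k dvd z - x" for z
  proof -
    define z' where "z' = GInt (gre z mod N) (gim z mod N)"
    have "of_int N dvd z - z'"
      by (simp add: of_int_dvd_iff z'_def mod_eq_dvd_iff[symmetric])
    then have "of_int N dvd - (z - z')" by (simp only: dvd_minus_iff)
    then have zz: "of_int N dvd z' - z" by (simp only: minus_diff_eq)
    have "z' \<in> R"
    proof -
      have "\<not> r dvd z' - x" if "r dvd of_int N" "\<not> r dvd z - x" for r
      proof
        assume "r dvd z' - x"
        moreover have "r dvd z' - z" using that(1) zz by (rule dvd_trans)
        ultimately have "r dvd (z' - x) - (z' - z)" by (rule dvd_diff)
        then show False using that by simp
      qed
      then show ?thesis using pN z Npos by (simp add: R_def box_def z'_def)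
    qed
    then have "f z' \<in> T" "of_int N dvd f z' - z'" using f by (auto simp: T_def)
    moreover have "of_int N dvd (f z' - z') + (z' - z)" using calculation(2) zz by (rule dvd_add)
    ultimately show ?thesis by (intro bexI[of _ "f z'"]) simp_all
  qed
  have Tx: "\<not> p ^ k dvd t - x \<and> \<not> gcnj p ^ k dvd t - x" if "t \<in> T" for t
  proof -
    obtain z where z: "z \<in> R" "t = f z" using \<open>t \<in> T\<close> by (auto simp: T_def)
    have "\<not> r dvd t - x" if "r dvd of_int N" "\<not> r dvd z - x" for r
    proof
      assume "r dvd t - x"
      moreover have "r dvd t - z" using that(1) f[OF z(1)] z(2) by (meson dvd_trans)
      ultimately have "r dvd (t - x) - (t - z)" by (rule dvd_diff)
      then show False using that by simp
    qed
    then show ?thesis using z(1) pN by (simp add: R_def)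
  qed
  have "admissible k (U \<union> T)"
    unfolding admissible_def
  proof (intro allI impI)
    fix q :: gint assume q: "prime_elem q"
    consider "p dvd q" | "gcnj p dvd q" | "q \<in> Ps" | "gnorm q > b"
      using q unfolding Ps_def by fastforce
    then show "\<exists>c. \<forall>u\<in>U \<union> T. \<not> q ^ k dvd u - c"
    proof cases
      case 1
      then show ?thesis using x Tx prime_power_dvd_cong[of p q k] by (intro exI[of _ x]) blast
    next
      case 2
      then show ?thesis using x Tx prime_power_dvd_cong[of "gcnj p" q k] by (intro exI[of _ x]) blast
    next
      case 3
      obtain c where c: "\<And>u. u \<in> insert u0 U \<Longrightarrow> \<not> q ^ k dvd u - c"
        using u0 q unfolding admissible_def by meson
      have "\<not> q ^ k dvd t - c" if "t \<in> T" for t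
      proof
        assume "q ^ k dvd t - c"
        moreover have "of_int S dvd t - u0" using that f by (auto simp: T_def)
        then have "q ^ k dvd t - u0" using dvdS[OF 3] by (rule dvd_trans[rotated])
        ultimately have "q ^ k dvd (t - c) - (t - u0)" by (rule dvd_diff)
        then show False using c[of u0] by simp
      qed
      then show ?thesis using c by blast
    next
      case 4
      show ?thesis
      proof (rule ccontr)
        assume "\<nexists>c. \<forall>u\<in>U \<union> T. \<not> q ^ k dvd u - c"
        then have "\<exists>t\<in>U \<union> T. q ^ k dvd t - c" for c by blast
        then have "gnorm q \<le> (int (card (U \<union> T)))\<^sup>2"
          using bound_of_full_residues[OF k q, of "U \<union> T"] finT \<open>finite U\<close> by blast
        also have "\<dots> \<le> b"
          unfolding b_def
        proof (rule power_mono)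
          have "card (U \<union> T) \<le> card U + card T" by (rule card_Un_le)
          also have "card T \<le> card R" unfolding T_def using finR by (rule card_image_le)
          finally show "int (card (U \<union> T)) \<le> int (card U + card R)" by simp
        qed simp
        finally show False using 4 by simp
      qed
    qed
  qed
  moreover have "\<forall>t\<in>T. \<forall>s\<in>U \<union> T. s \<noteq> t \<longrightarrow> t - s \<notin> D \<and> s - t \<notin> D"
  proof (intro ballI impI)
    fix t s assume t: "t \<in> T" and s: "s \<in> U \<union> T" and "s \<noteq> t"
    obtain z where z: "z \<in> R" "t = f z" using t by (auto simp: T_def)
    show "t - s \<notin> D \<and> s - t \<notin> D"
    proof (cases "s \<in> U")
      case False
      then obtain z' where "z' \<in> R" "s = f z'" using s by (auto simp: T_def)
      then show ?thesis using f[of z] f[of z'] z \<open>s \<noteq> t\<close> by metis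
    qed (use f z in blast)
  qed
  moreover have "T \<inter> U = {}" using f by (auto simp: T_def)
  ultimately show ?thesis using finT cover unfolding N_def by blast
qed

section \<open>Additive maps of the Gaussian integers\<close>

text \<open>Additivity alone already yields linearity over the rational integers.\<close>

lemma additive_of_int:
  assumes "\<And>x y. Q (x + y) = Q x + (Q y :: gint)"
  shows "Q 0 = 0" "Q (- x) = - Q x" "Q (x - y) = Q x - Q y" "Q (of_int n * x) = of_int n * Q x"
proof -
  show 0: "Q 0 = 0" using assms[of 0 0] by simp
  show m: "Q (- x) = - Q x" for x using assms[of x "- x"] 0 by (simp add: eq_neg_iff_add_eq_0 add.commute)
  show d: "Q (x - y) = Q x - Q y" using assms[of x "- y"] m[of y] by simp
  have nat: "Q (of_nat j * x) = of_nat j * Q x" for j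
    by (induction j) (simp_all add: 0 assms distrib_right)
  show "Q (of_int n * x) = of_int n * Q x"
    using nat m[of "of_nat (nat (- n)) * x"] by (cases n rule: int_cases2) (simp_all add: m nat)
qed

text \<open>Of the three points \<open>w\<close>, \<open>w + s\<close>, \<open>w + 2 s\<close> two lie in the same one of the two lattices, so
  \<open>s\<close> lies there as well.\<close>

lemma subgroup_in_union_of_ideals:
  assumes add: "\<And>s t. s \<in> S \<Longrightarrow> t \<in> S \<Longrightarrow> s + t \<in> (S :: gint set)" and "0 \<in> S"
    and two: "comaximal a 2" "comaximal b 2"
    and cov: "\<And>s. s \<in> S \<Longrightarrow> a dvd w + s \<or> b dvd w + s"
  shows "(\<forall>s\<in>S. a dvd s) \<or> (\<forall>s\<in>S. b dvd s)"
proof -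
  have each: "a dvd s \<or> b dvd s" if s: "s \<in> S" for s
  proof -
    have pair: "c dvd s" if "comaximal c 2" "c dvd w + i * s" "c dvd w + j * s" "j - i = 1 \<or> j - i = 2" for c i j
    proof -
      have "c dvd (w + j * s) - (w + i * s)" using that by (intro dvd_diff)
      also have "(w + j * s) - (w + i * s) = (j - i) * s" by (simp add: algebra_simps)
      finally have "c dvd (j - i) * s" .
      then show ?thesis using that comaximal_dvd_mult by auto
    qed
    have e: "(1 :: gint) - 0 = 1 \<or> (1 :: gint) - 0 = 2" "(2 :: gint) - 0 = 1 \<or> (2 :: gint) - 0 = 2"
      "(2 :: gint) - 1 = 1 \<or> (2 :: gint) - 1 = 2"
      by (simp_all add: gint_eq_iff)
    have "a dvd w + 0 * s \<or> b dvd w + 0 * s" using cov[OF \<open>0 \<in> S\<close>] by (simp only: mult_zero_left)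
    moreover have "a dvd w + 1 * s \<or> b dvd w + 1 * s" using cov[OF s] by (simp only: mult_1)
    moreover have "a dvd w + 2 * s \<or> b dvd w + 2 * s"
      using cov[OF add[OF s s]] by (simp only: mult_2)
    ultimately show ?thesis
      using pair[OF two(1) _ _ e(1)] pair[OF two(1) _ _ e(2)] pair[OF two(1) _ _ e(3)]
        pair[OF two(2) _ _ e(1)] pair[OF two(2) _ _ e(2)] pair[OF two(2) _ _ e(3)]
      by blast
  qed
  show ?thesis
  proof (rule ccontr)
    assume "\<not> ?thesis"
    then obtain s t where st: "s \<in> S" "t \<in> S" "\<not> a dvd s" "\<not> b dvd t" by blast
    then have "b dvd s" "a dvd t" using each by blast+
    then have "\<not> a dvd s + t" "\<not> b dvd s + t"
      using st dvd_add_left_iff[of a t s] dvd_add_right_iff[of b s t] by auto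
    then show False using each add st by blast
  qed
qed

lemma comaximal_2:
  assumes "prime_elem p" "gnorm p > 4"
  shows "comaximal (p ^ k) 2"
proof -
  have "\<not> p dvd 2" using dvd_imp_gnorm_le[of p 2] assms by (auto simp: gnorm_def gint_eq_iff)
  then show ?thesis using assms by (intro comaximal_power_left prime_comaximal)
qed

text \<open>Every additive map is \<open>z \<mapsto> (a z + b gcnj z) / 2\<close>; if it maps the multiples of \<open>p ^ k\<close> into
  themselves or into the multiples of \<open>(gcnj p) ^ k\<close>, then one of the two coefficients is divisible by
  a number of large norm and hence zero.\<close>

lemma additive_preserving_ideal:
  assumes add: "\<And>x y. P (x + y) = P x + (P y :: gint)" and surj: "surj P"
    and k: "k \<ge> 1" and p: "prime_elem p" "comaximal p (gcnj p)"
    and large: "gnorm p > gnorm (P 1 - gI * P gI)" "gnorm p > gnorm (P 1 + gI * P gI)"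
    and pres: "(\<forall>z. p ^ k dvd z \<longrightarrow> p ^ k dvd P z) \<or> (\<forall>z. p ^ k dvd z \<longrightarrow> gcnj p ^ k dvd P z)"
  shows "\<exists>u. gnorm u = 1 \<and> ((\<forall>z. P z = u * z) \<or> (\<forall>z. P z = u * gcnj z))"
proof -
  define a b where "a = P 1 - gI * P gI" and "b = P 1 + gI * P gI"
  have two0: "(2 :: gint) \<noteq> 0" by (simp add: gint_eq_iff)
  have form: "2 * P z = a * z + b * gcnj z" for z
  proof -
    have z: "z = of_int (gre z) * 1 + of_int (gim z) * gI" by (simp add: gint_eq_iff)
    have "P z = of_int (gre z) * P 1 + of_int (gim z) * P gI"
      by (subst z) (simp only: add additive_of_int[of P, OF add])
    then have "2 * P z = 2 * of_int (gre z) * P 1 + 2 * of_int (gim z) * P gI"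
      by (simp add: algebra_simps)
    also have "\<dots> = a * z + b * gcnj z"
      by (simp add: a_def b_def gint_eq_iff algebra_simps)
    finally show ?thesis .
  qed
  have unit: "gnorm u = 1" if "(\<forall>z. P z = u * z) \<or> (\<forall>z. P z = u * gcnj z)" for u
  proof -
    obtain z where "P z = 1" using surj by (metis surjD)
    then have "u dvd 1" using that by (metis dvd_triv_left)
    then show ?thesis by (simp add: gint_unit_iff)
  qed
  have zero: "c = 0" if "q ^ k dvd c" "gnorm q > gnorm c" for q c
  proof (rule ccontr)
    assume "c \<noteq> 0"
    then show False
      using dvd_imp_gnorm_le[OF that(1)] that(2) gnorm_le_gnorm_power[OF k, of q] by linarith
  qed
  have cop: "comaximal (p ^ k) (gcnj p ^ k)" using p(2) by (rule comaximal_power)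
  from pres have "a = 0 \<or> b = 0"
  proof
    assume "\<forall>z. p ^ k dvd z \<longrightarrow> p ^ k dvd P z"
    then have "p ^ k dvd 2 * P (p ^ k) - a * p ^ k" by (intro dvd_diff dvd_mult) auto
    then have "p ^ k dvd gcnj p ^ k * b" by (simp add: form mult.commute)
    then have "p ^ k dvd b" by (rule comaximal_dvd_mult[OF cop])
    then show ?thesis using zero large b_def by blast
  next
    assume "\<forall>z. p ^ k dvd z \<longrightarrow> gcnj p ^ k dvd P z"
    then have "gcnj p ^ k dvd 2 * P (p ^ k) - b * gcnj p ^ k" by (intro dvd_diff dvd_mult) auto
    then have "gcnj p ^ k dvd p ^ k * a" by (simp add: form mult.commute)
    then have "gcnj p ^ k dvd a" by (rule comaximal_dvd_mult[OF comaximal_sym[OF cop]])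
    then show ?thesis using zero[of "gcnj p" a] large a_def by simp
  qed
  then show ?thesis
  proof
    assume "a = 0"
    have "b = 2 * P 1" using form[of 1] \<open>a = 0\<close> by simp
    then have "2 * P z = 2 * (P 1 * gcnj z)" for z
      using form[of z] \<open>a = 0\<close> by (simp only: mult_zero_left add_0 mult.assoc)
    then have "\<forall>z. P z = P 1 * gcnj z"
      using mult_left_cancel[THEN iffD1, OF two0] by blast
    then show ?thesis using unit by blast
  next
    assume "b = 0"
    have "a = 2 * P 1" using form[of 1] \<open>b = 0\<close> by simp
    then have "2 * P z = 2 * (P 1 * z)" for z
      using form[of z] \<open>b = 0\<close> by (simp only: mult_zero_left add_0_right mult.assoc)
    then have "\<forall>z. P z = P 1 * z"
      using mult_left_cancel[THEN iffD1, OF two0] by blast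
    then show ?thesis using unit by blast
  qed
qed

section \<open>The configuration space\<close>

text \<open>The basic neighbourhoods of \<open>U\<close> are obtained for finite windows \<open>B\<close>.\<close>

definition cylinder :: "(int ^ 2) set \<Rightarrow> (int ^ 2) set \<Rightarrow> (int ^ 2) set set" where
  "cylinder B U = {W. \<forall>x\<in>B. x \<in> W \<longleftrightarrow> x \<in> U}"

lemma openin_config_iff:
  "openin config_topology S \<longleftrightarrow> (\<forall>U\<in>S. \<exists>B. finite B \<and> cylinder B U \<subseteq> S)"
proof
  assume "openin config_topology S"
  then obtain Q where Q: "openin (product_topology (\<lambda>_::int ^ 2. discrete_topology (UNIV :: bool set)) UNIV) Q"
    and S: "S = (\<lambda>U x. x \<in> U) -` Q"
    by (auto simp: config_topology_def openin_pullback_topology)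
  show "\<forall>U\<in>S. \<exists>B. finite B \<and> cylinder B U \<subseteq> S"
  proof
    fix U assume "U \<in> S"
    then have "(\<lambda>x. x \<in> U) \<in> Q" using S by simp
    then obtain C where C: "finite {i. C i \<noteq> (UNIV :: bool set)}" "(\<lambda>x. x \<in> U) \<in> Pi\<^sub>E UNIV C" "Pi\<^sub>E UNIV C \<subseteq> Q"
      using Q unfolding openin_product_topology_alt by auto
    have "cylinder {i. C i \<noteq> UNIV} U \<subseteq> S"
    proof
      fix W assume W: "W \<in> cylinder {i. C i \<noteq> UNIV} U"
      have "(x \<in> W) \<in> C x" for x
      proof (cases "C x = UNIV")
        case False
        then have "(x \<in> W) = (x \<in> U)" using W by (simp add: cylinder_def)
        then show ?thesis using C(2) by (auto simp: PiE_iff)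
      qed simp
      then have "(\<lambda>x. x \<in> W) \<in> Q" using C(3) by (auto simp: PiE_iff)
      then show "W \<in> S" using S by simp
    qed
    then show "\<exists>B. finite B \<and> cylinder B U \<subseteq> S" using C(1) by blast
  qed
next
  assume *: "\<forall>U\<in>S. \<exists>B. finite B \<and> cylinder B U \<subseteq> S"
  have cyl: "openin config_topology (cylinder B U)" if "finite B" for B U
  proof -
    let ?C = "\<lambda>x. if x \<in> B then {x \<in> U} else (UNIV :: bool set)"
    have "openin (product_topology (\<lambda>_::int ^ 2. discrete_topology (UNIV :: bool set)) UNIV) (Pi\<^sub>E UNIV ?C)"
      by (rule product_topology_basis) (use that in \<open>auto intro: finite_subset[of _ B]\<close>)
    moreover have "cylinder B U = (\<lambda>U x. x \<in> U) -` Pi\<^sub>E UNIV ?C"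
      by (auto simp: cylinder_def PiE_iff split: if_splits)
    ultimately show ?thesis
      by (auto simp: config_topology_def openin_pullback_topology)
  qed
  have "\<exists>T. openin config_topology T \<and> U \<in> T \<and> T \<subseteq> S" if "U \<in> S" for U
  proof -
    obtain B where "finite B" "cylinder B U \<subseteq> S" using * \<open>U \<in> S\<close> by blast
    then show ?thesis using cyl[of B U] by (intro exI[of _ "cylinder B U"]) (simp add: cylinder_def)
  qed
  then show "openin config_topology S" by (subst openin_subopen) blast
qed

lemma openin_cylinder: "finite B \<Longrightarrow> openin config_topology (cylinder B U)"
  unfolding openin_config_iff by (intro ballI exI[of _ B]) (auto simp: cylinder_def)

lemma topspace_config [simp]: "topspace config_topology = UNIV"
  by (auto simp: config_topology_def topspace_pullback_topology)

lemma compact_space_config: "compact_space config_topology"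
proof -
  let ?P = "product_topology (\<lambda>_::int ^ 2. discrete_topology (UNIV :: bool set)) UNIV"
  have "continuous_map ?P config_topology Collect"
    unfolding config_topology_def
  proof (rule continuous_map_pullback')
    show "continuous_map ?P ?P ((\<lambda>U x. x \<in> U) \<circ> Collect)" by (simp add: comp_def)
  qed simp
  moreover have "compact_space ?P"
    by (simp add: compact_space_product_topology compact_space_discrete_topology)
  then have "compactin ?P (topspace ?P)" unfolding compact_space_def .
  ultimately have "compactin config_topology (Collect ` topspace ?P)" by (rule image_compactin[rotated])
  moreover have "Collect ` topspace ?P = UNIV"
  proof (rule UNIV_eq_I[symmetric])
    show "U \<in> Collect ` topspace ?P" for U
      by (rule image_eqI[of _ _ "\<lambda>x. x \<in> U"]) simp_all
  qed
  ultimately show ?thesis by (simp add: compact_space_def)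
qed

lemma closure_of_config_iff:
  "U \<in> config_topology closure_of S \<longleftrightarrow> (\<forall>B. finite B \<longrightarrow> cylinder B U \<inter> S \<noteq> {})"
proof
  assume U: "U \<in> config_topology closure_of S"
  show "\<forall>B. finite B \<longrightarrow> cylinder B U \<inter> S \<noteq> {}"
  proof (intro allI impI)
    fix B :: "(int ^ 2) set" assume "finite B"
    then have "openin config_topology (cylinder B U)" by (rule openin_cylinder)
    moreover have "U \<in> cylinder B U" by (simp add: cylinder_def)
    ultimately show "cylinder B U \<inter> S \<noteq> {}" using U unfolding in_closure_of by blast
  qed
next
  assume *: "\<forall>B. finite B \<longrightarrow> cylinder B U \<inter> S \<noteq> {}"
  show "U \<in> config_topology closure_of S"
    unfolding in_closure_of
  proof (intro conjI allI impI)
    fix T assume "U \<in> T \<and> openin config_topology T"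
    then obtain B where "finite B" "cylinder B U \<subseteq> T" unfolding openin_config_iff by blast
    then show "\<exists>y. y \<in> S \<and> y \<in> T" using * by blast
  qed simp
qed

text \<open>The Curtis--Hedlund--Lyndon principle: whether the origin belongs to the image of \<open>U\<close> is a
  locally constant function of \<open>U\<close> and hence, by compactness, depends on a fixed finite window only.\<close>

lemma continuous_map_finite_window:
  assumes cl: "closedin config_topology \<Omega>"
    and cont: "continuous_map (subtopology config_topology \<Omega>) (subtopology config_topology \<Omega>) \<phi>"
  shows "\<exists>B. finite B \<and> (\<forall>U\<in>\<Omega>. \<forall>W\<in>\<Omega>. W \<in> cylinder B U \<longrightarrow> (0 \<in> \<phi> U \<longleftrightarrow> 0 \<in> \<phi> W))"
proof -
  have "\<exists>b. finite b \<and> (\<forall>W\<in>\<Omega>. W \<in> cylinder b U \<longrightarrow> (0 \<in> \<phi> W \<longleftrightarrow> 0 \<in> \<phi> U))" if U: "U \<in> \<Omega>" for U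
  proof -
    let ?T = "{W \<in> topspace (subtopology config_topology \<Omega>). \<phi> W \<in> cylinder {0} (\<phi> U) \<inter> \<Omega>}"
    have "openin (subtopology config_topology \<Omega>) (cylinder {0} (\<phi> U) \<inter> \<Omega>)"
      by (rule openin_subtopology_Int) (rule openin_cylinder, simp)
    then have "openin (subtopology config_topology \<Omega>) ?T"
      by (rule openin_continuous_map_preimage[OF cont])
    then obtain S where S: "openin config_topology S" "?T = S \<inter> \<Omega>"
      unfolding openin_subtopology by blast
    have "\<phi> U \<in> \<Omega>" using cont U unfolding continuous_map_def by auto
    then have "U \<in> ?T" using U by (simp add: cylinder_def)
    then have "U \<in> S" using S by blast
    then obtain b where b: "finite b" "cylinder b U \<subseteq> S" using S unfolding openin_config_iff by blast
    have "0 \<in> \<phi> W \<longleftrightarrow> 0 \<in> \<phi> U" if "W \<in> \<Omega>" "W \<in> cylinder b U" for W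
    proof -
      have "W \<in> ?T" using that b S by blast
      then show ?thesis by (simp add: cylinder_def)
    qed
    then show ?thesis using b by blast
  qed
  then obtain b where b: "\<And>U. U \<in> \<Omega> \<Longrightarrow> finite (b U)"
    "\<And>U W. U \<in> \<Omega> \<Longrightarrow> W \<in> \<Omega> \<Longrightarrow> W \<in> cylinder (b U) U \<Longrightarrow> (0 \<in> \<phi> W \<longleftrightarrow> 0 \<in> \<phi> U)"
    by metis
  have comp: "compactin config_topology \<Omega>"
    using closedin_compact_space[OF compact_space_config cl] .
  have op: "openin config_topology C" if "C \<in> (\<lambda>U. cylinder (b U) U) ` \<Omega>" for C
    using that b(1) openin_cylinder by blast
  have cov: "\<Omega> \<subseteq> \<Union>((\<lambda>U. cylinder (b U) U) ` \<Omega>)" by (auto simp: cylinder_def)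
  obtain \<F> where F: "finite \<F>" "\<F> \<subseteq> (\<lambda>U. cylinder (b U) U) ` \<Omega>" "\<Omega> \<subseteq> \<Union>\<F>"
    using compactinD[OF comp op cov] by auto
  then obtain E where E: "E \<subseteq> \<Omega>" "finite E" "\<F> = (\<lambda>U. cylinder (b U) U) ` E"
    by (meson finite_subset_image)
  have "0 \<in> \<phi> U \<longleftrightarrow> 0 \<in> \<phi> W" if UW: "U \<in> \<Omega>" "W \<in> \<Omega>" "W \<in> cylinder (\<Union>(b ` E)) U" for U W
  proof -
    obtain D where D: "D \<in> E" "U \<in> cylinder (b D) D" using F(3) E(3) UW(1) by blast
    moreover have "W \<in> cylinder (b D) D" using D UW(3) by (auto simp: cylinder_def)
    ultimately show ?thesis using b(2) E(1) UW by blast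
  qed
  moreover have "finite (\<Union>(b ` E))" using E b(1) by blast
  ultimately show ?thesis by (intro exI[of _ "\<Union>(b ` E)"]) blast
qed

section \<open>The hull as the space of admissible sets\<close>

definition to_gint :: "int ^ 2 \<Rightarrow> gint" where "to_gint x = GInt (x $ 1) (x $ 2)"

definition of_gint :: "gint \<Rightarrow> int ^ 2" where "of_gint z = vector [gre z, gim z]"

lemma of_gint_nth [simp]: "of_gint z $ 1 = gre z" "of_gint z $ 2 = gim z"
  by (simp_all add: of_gint_def)

lemma to_of_gint [simp]: "to_gint (of_gint z) = z"
  by (simp add: to_gint_def)

lemma of_to_gint [simp]: "of_gint (to_gint x) = x"
  by (simp add: to_gint_def vec_eq_iff forall_2)

lemma to_gint_simps [simp]:
  "gre (to_gint x) = x $ 1" "gim (to_gint x) = x $ 2"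
  "to_gint 0 = 0" "to_gint (x + y) = to_gint x + to_gint y" "to_gint (x - y) = to_gint x - to_gint y"
  "to_gint (- x) = - to_gint x"
  by (simp_all add: to_gint_def gint_eq_iff)

lemma of_gint_simps [simp]:
  "of_gint 0 = 0" "of_gint (z + w) = of_gint z + of_gint w" "of_gint (z - w) = of_gint z - of_gint w"
  "of_gint (- z) = - of_gint z"
  by (simp_all add: vec_eq_iff forall_2)

lemma to_gint_eq_iff [simp]: "to_gint x = to_gint y \<longleftrightarrow> x = y"
  by (metis of_to_gint)

definition adm :: "nat \<Rightarrow> (int ^ 2) set \<Rightarrow> bool" where
  "adm k U \<longleftrightarrow> admissible k (to_gint ` U)"

lemma adm_subset: "adm k U \<Longrightarrow> W \<subseteq> U \<Longrightarrow> adm k W"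
  unfolding adm_def by (meson admissible_subset image_mono)

lemma adm_translate:
  assumes "adm k U" shows "adm k ((\<lambda>x. t + x) ` U)"
  unfolding adm_def admissible_def
proof (intro allI impI)
  fix p :: gint assume "prime_elem p"
  then obtain c where c: "\<And>u. u \<in> U \<Longrightarrow> \<not> p ^ k dvd to_gint u - c"
    using assms unfolding adm_def admissible_def by blast
  have "\<not> p ^ k dvd to_gint (t + u) - (to_gint t + c)" if "u \<in> U" for u
    using c[OF that] by simp
  then show "\<exists>c. \<forall>u\<in>to_gint ` (\<lambda>x. t + x) ` U. \<not> p ^ k dvd u - c" by blast
qed

definition kfree_set :: "nat \<Rightarrow> (int ^ 2) set" where
  "kfree_set k = {x. kfree k (to_gint x)}"

lemma shift_hull_iff:
  "U \<in> shift_hull V \<longleftrightarrow> (\<forall>B. finite B \<longrightarrow> (\<exists>t. \<forall>x\<in>B. x \<in> U \<longleftrightarrow> x + t \<in> V))"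
proof -
  have tr: "x \<in> (\<lambda>x. s + x) ` V \<longleftrightarrow> x + - s \<in> V" for x s :: "int ^ 2"
    by (auto simp: image_iff algebra_simps) (metis add_diff_cancel_left' diff_add_cancel)
  have "(cylinder B U \<inter> {(\<lambda>x. t + x) ` V | t. True} \<noteq> {}) \<longleftrightarrow> (\<exists>t. \<forall>x\<in>B. x \<in> U \<longleftrightarrow> x + t \<in> V)" for B
  proof
    assume "cylinder B U \<inter> {(\<lambda>x. t + x) ` V | t. True} \<noteq> {}"
    then obtain s where "(\<lambda>x. s + x) ` V \<in> cylinder B U" by blast
    then have "\<forall>x\<in>B. x \<in> U \<longleftrightarrow> x + - s \<in> V" unfolding cylinder_def mem_Collect_eq tr by blast
    then show "\<exists>t. \<forall>x\<in>B. x \<in> U \<longleftrightarrow> x + t \<in> V" by blast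
  next
    assume "\<exists>t. \<forall>x\<in>B. x \<in> U \<longleftrightarrow> x + t \<in> V"
    then obtain t where t: "\<forall>x\<in>B. x \<in> U \<longleftrightarrow> x + t \<in> V" by blast
    then have "(\<lambda>x. - t + x) ` V \<in> cylinder B U" unfolding cylinder_def mem_Collect_eq tr by simp
    then show "cylinder B U \<inter> {(\<lambda>x. t + x) ` V | t. True} \<noteq> {}" by blast
  qed
  then show ?thesis unfolding shift_hull_def closure_of_config_iff by simp
qed

text \<open>An admissible set is a limit of translates of \<open>V\<close> since its finite patterns occur in \<open>V\<close>. Conversely, a set
  that meets every class modulo \<open>p ^ k\<close> does so within a finite window, and no translate of \<open>V\<close> agrees with
  it there, because \<open>V\<close> contains no multiple of \<open>p ^ k\<close>.\<close>

lemma shift_hull_kfree: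
  assumes k: "k \<ge> 2"
  shows "shift_hull (kfree_set k) = {U. adm k U}"
proof (rule Set.set_eqI, rule iffI)
  fix U assume "U \<in> {U. adm k U}"
  then have U: "adm k U" by simp
  show "U \<in> shift_hull (kfree_set k)"
    unfolding shift_hull_iff
  proof (intro allI impI)
    fix B :: "(int ^ 2) set" assume B: "finite B"
    have "admissible k (to_gint ` (U \<inter> B))"
      using U adm_subset[of k U "U \<inter> B"] by (simp add: adm_def)
    then obtain y where y: "\<forall>x\<in>to_gint ` B. kfree k (x + y) \<longleftrightarrow> x \<in> to_gint ` (U \<inter> B)"
      using pattern_occurs[OF k, of "to_gint ` B" "to_gint ` (U \<inter> B)"] B by auto
    have "x \<in> U \<longleftrightarrow> x + of_gint y \<in> kfree_set k" if "x \<in> B" for x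
      using y that by (auto simp: kfree_set_def)
    then show "\<exists>t. \<forall>x\<in>B. x \<in> U \<longleftrightarrow> x + t \<in> kfree_set k" by blast
  qed
next
  fix U assume U: "U \<in> shift_hull (kfree_set k)"
  show "U \<in> {U. adm k U}"
    unfolding adm_def admissible_def mem_Collect_eq
  proof (intro allI impI)
    fix p :: gint assume p: "prime_elem p"
    show "\<exists>c. \<forall>u\<in>to_gint ` U. \<not> p ^ k dvd u - c"
    proof (rule ccontr)
      assume no: "\<nexists>c. \<forall>u\<in>to_gint ` U. \<not> p ^ k dvd u - c"
      define N where "N = gnorm p ^ k"
      have N: "N > 0" using gnorm_prime_ge_2[OF p] unfolding N_def by (intro zero_less_power) linarith
      have pN: "p ^ k dvd of_int N"
        by (simp add: N_def mult_gcnj[symmetric] power_mult_distrib)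
      obtain h where h: "\<And>c. h c \<in> U \<and> p ^ k dvd to_gint (h c) - c"
      proof -
        have "\<forall>c. \<exists>u. u \<in> U \<and> p ^ k dvd to_gint u - c" using no by blast
        from choice[OF this] show ?thesis using that by blast
      qed
      obtain t where t: "\<And>x. x \<in> h ` box (nat N) \<Longrightarrow> x \<in> U \<longleftrightarrow> x + t \<in> kfree_set k"
        using U[unfolded shift_hull_iff, rule_format, of "h ` box (nat N)"] by auto
      define c where "c = GInt (- (t $ 1) mod N) (- (t $ 2) mod N)"
      have c: "c \<in> box (nat N)" using N by (simp add: c_def box_def)
      have "- (t $ i) mod N - - (t $ i) = - (N * (- (t $ i) div N))" for i
        by (simp add: minus_mult_div_eq_mod[symmetric])
      then have "of_int N dvd c - to_gint (- t)"
        unfolding of_int_dvd_iff by (simp add: c_def dvd_def) (metis minus_mult_right)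
      then have "p ^ k dvd c - to_gint (- t)" using pN dvd_trans by blast
      moreover have "p ^ k dvd to_gint (h c) - c" using h by blast
      ultimately have "p ^ k dvd (c - to_gint (- t)) + (to_gint (h c) - c)" by (rule dvd_add)
      then have "p ^ k dvd to_gint (h c + t)" by (simp add: add.commute)
      then have "\<not> kfree k (to_gint (h c + t))" using p by (auto simp: kfree_def)
      moreover have "h c + t \<in> kfree_set k" using t[of "h c"] c h by blast
      ultimately show False by (simp add: kfree_set_def)
    qed
  qed
qed

section \<open>Homeomorphisms that normalise the shift\<close>

text \<open>A continuous bijection \<open>\<phi>\<close> of the hull that turns the translation by \<open>t\<close> into the translation by \<open>m t\<close>; for \<open>m\<close> the
  identity it is an element of the symmetry group.\<close>

locale hull_code =
  fixes k :: nat and \<Omega> :: "(int ^ 2) set set" and \<phi> :: "(int ^ 2) set \<Rightarrow> (int ^ 2) set"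
    and m :: "int ^ 2 \<Rightarrow> int ^ 2"
  assumes k: "k \<ge> 2"
    and \<Omega>: "\<Omega> = {U. adm k U}"
    and closed: "closedin config_topology \<Omega>"
    and cont: "continuous_map (subtopology config_topology \<Omega>) (subtopology config_topology \<Omega>) \<phi>"
    and bij: "bij_betw \<phi> \<Omega> \<Omega>"
    and m_add: "m (x + y) = m x + m y"
    and m_bij: "bij m"
    and equiv: "U \<in> \<Omega> \<Longrightarrow> \<phi> ((\<lambda>x. t + x) ` U) = (\<lambda>x. m t + x) ` \<phi> U"
begin

lemma m_simps: "m 0 = 0" "m (- x) = - m x" "m (x - y) = m x - m y"
proof -
  show 0: "m 0 = 0" using m_add[of 0 0] by simp
  have neg: "m (- x) = - m x" for x using m_add[of x "- x"] 0 by (simp add: eq_neg_iff_add_eq_0 add.commute)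
  show "m (- x) = - m x" by (rule neg)
  show "m (x - y) = m x - m y" using m_add[of x "- y"] neg[of y] by simp
qed

lemma m_eq_iff [simp]: "m x = m y \<longleftrightarrow> x = y"
  using m_bij by (meson bij_is_inj inj_eq)

lemma in_\<Omega>: "U \<in> \<Omega> \<longleftrightarrow> adm k U" by (simp add: \<Omega>)

lemma \<phi>_in: "U \<in> \<Omega> \<Longrightarrow> \<phi> U \<in> \<Omega>"
  using bij by (auto simp: bij_betw_def)

lemma subset_in_\<Omega>: "U \<in> \<Omega> \<Longrightarrow> W \<subseteq> U \<Longrightarrow> W \<in> \<Omega>"
  using adm_subset by (auto simp: in_\<Omega>)

lemma translate_in_\<Omega>: "U \<in> \<Omega> \<Longrightarrow> (\<lambda>x. t + x) ` U \<in> \<Omega>"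
  using adm_translate by (simp add: in_\<Omega>)

lemma singleton_in_\<Omega>: "{x} \<in> \<Omega>"
  using admissible_singleton[of k "to_gint x"] k by (simp add: in_\<Omega> adm_def)

lemma empty_in_\<Omega>: "{} \<in> \<Omega>"
  using subset_in_\<Omega>[OF singleton_in_\<Omega>[of 0]] by simp

lemma window_exists:
  "\<exists>B. finite B \<and>
     (\<forall>U\<in>\<Omega>. \<forall>W\<in>\<Omega>. \<forall>x. (\<forall>y\<in>B. x + y \<in> U \<longleftrightarrow> x + y \<in> W) \<longrightarrow> (m x \<in> \<phi> U \<longleftrightarrow> m x \<in> \<phi> W))"
proof -
  obtain B where B: "finite B"
    "\<And>U W. U \<in> \<Omega> \<Longrightarrow> W \<in> \<Omega> \<Longrightarrow> W \<in> cylinder B U \<Longrightarrow> (0 \<in> \<phi> U \<longleftrightarrow> 0 \<in> \<phi> W)"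
    using continuous_map_finite_window[OF closed cont] by blast
  have tr: "y \<in> (\<lambda>u. - x + u) ` U \<longleftrightarrow> x + y \<in> U" for x y :: "int ^ 2" and U
    by (auto simp: image_iff) (metis add.commute add_diff_cancel_left' uminus_add_conv_diff)
  have "m x \<in> \<phi> U \<longleftrightarrow> m x \<in> \<phi> W"
    if UW: "U \<in> \<Omega>" "W \<in> \<Omega>" and agree: "\<forall>y\<in>B. x + y \<in> U \<longleftrightarrow> x + y \<in> W" for U W x
  proof -
    have z: "0 \<in> \<phi> ((\<lambda>u. - x + u) ` U) \<longleftrightarrow> m x \<in> \<phi> U" if "U \<in> \<Omega>" for U
    proof -
      have "\<phi> ((\<lambda>u. - x + u) ` U) = (\<lambda>u. - m x + u) ` \<phi> U"
        using equiv[OF that, of "- x"] by (simp only: m_simps)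
      then show ?thesis by (simp only: tr add_0_right)
    qed
    have "(\<lambda>u. - x + u) ` W \<in> cylinder B ((\<lambda>u. - x + u) ` U)"
      using agree unfolding cylinder_def mem_Collect_eq tr by blast
    then show ?thesis using B(2) UW translate_in_\<Omega> z by metis
  qed
  then show ?thesis using B(1) by blast
qed

definition window :: "(int ^ 2) set" where
  "window = (SOME B. finite B \<and>
     (\<forall>U\<in>\<Omega>. \<forall>W\<in>\<Omega>. \<forall>x. (\<forall>y\<in>B. x + y \<in> U \<longleftrightarrow> x + y \<in> W) \<longrightarrow> (m x \<in> \<phi> U \<longleftrightarrow> m x \<in> \<phi> W)))"

lemma finite_window: "finite window"
  and window: "U \<in> \<Omega> \<Longrightarrow> W \<in> \<Omega> \<Longrightarrow>
    (\<And>y. y \<in> window \<Longrightarrow> x + y \<in> U \<longleftrightarrow> x + y \<in> W) \<Longrightarrow> m x \<in> \<phi> U \<longleftrightarrow> m x \<in> \<phi> W"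
  using someI_ex[OF window_exists] unfolding window_def[symmetric] by blast+

text \<open>The image of the empty set is invariant under all translations, and the full lattice is not
  admissible.\<close>

lemma \<phi>_empty: "\<phi> {} = {}"
proof (rule ccontr)
  assume "\<phi> {} \<noteq> {}"
  then obtain a where a: "a \<in> \<phi> {}" by blast
  have "y \<in> \<phi> {}" for y
  proof -
    obtain t where "m t = y - a" using m_bij by (metis bij_pointE)
    then have "y \<in> (\<lambda>x. m t + x) ` \<phi> {}" using a by (intro image_eqI[of _ _ a]) simp_all
    then show ?thesis using equiv[OF empty_in_\<Omega>, of t] by simp
  qed
  then have "\<phi> {} = UNIV" by blast
  moreover have "\<phi> {} \<in> \<Omega>" by (rule \<phi>_in[OF empty_in_\<Omega>])
  ultimately have "admissible k (range to_gint)" by (simp add: in_\<Omega> adm_def)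
  moreover obtain p :: gint where "prime_elem p" using large_split_prime[of 0] by blast
  ultimately obtain c where "\<And>u. \<not> p ^ k dvd to_gint u - c" unfolding admissible_def by blast
  from this[of "of_gint c"] show False by simp
qed

text \<open>Every window meets at most one of the two pieces, and an empty window contributes nothing to the
  image.\<close>

lemma \<phi>_union:
  assumes UW: "U \<union> W \<in> \<Omega>"
    and far: "\<And>u w x y. u \<in> U \<Longrightarrow> w \<in> W \<Longrightarrow> x \<in> window \<Longrightarrow> y \<in> window \<Longrightarrow> u - w \<noteq> x - y"
  shows "\<phi> (U \<union> W) = \<phi> U \<union> \<phi> W"
proof -
  have om: "U \<in> \<Omega>" "W \<in> \<Omega>" using subset_in_\<Omega>[OF UW] by auto
  have "m x \<in> \<phi> (U \<union> W) \<longleftrightarrow> m x \<in> \<phi> U \<union> \<phi> W" for x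
  proof -
    have no_image: "m x \<notin> \<phi> Z" if "Z \<in> \<Omega>" "\<forall>y\<in>window. x + y \<notin> Z" for Z
      using window[OF that(1) empty_in_\<Omega>, of x] that(2) \<phi>_empty by auto
    show ?thesis
    proof (cases "\<exists>y\<in>window. x + y \<in> U")
      case True
      then obtain y0 where y0: "y0 \<in> window" "x + y0 \<in> U" by blast
      have no: "x + y \<notin> W" if "y \<in> window" for y
        using far[of "x + y0" "x + y" y0 y] y0 that by auto
      then have "m x \<in> \<phi> (U \<union> W) \<longleftrightarrow> m x \<in> \<phi> U" by (intro window UW om) auto
      moreover have "m x \<notin> \<phi> W" using no_image[of W] om(2) no by blast
      ultimately show ?thesis by blast
    next
      case False
      then have "m x \<in> \<phi> (U \<union> W) \<longleftrightarrow> m x \<in> \<phi> W" by (intro window UW om) auto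
      moreover have "m x \<notin> \<phi> U" using no_image[of U] om(1) False by blast
      ultimately show ?thesis by blast
    qed
  qed
  then show ?thesis using m_bij by (metis (no_types, lifting) bij_pointE Set.set_eqI)
qed

lemma \<phi>_singleton: "\<phi> {t} = (\<lambda>a. m t + a) ` \<phi> {0}"
  using equiv[OF singleton_in_\<Omega>, of t 0] by simp

lemma \<phi>_finite:
  assumes "finite U" "U \<in> \<Omega>" shows "finite (\<phi> U)"
proof (rule finite_subset)
  show "\<phi> U \<subseteq> (\<lambda>(u, y). m (u - y)) ` (U \<times> window)"
  proof
    fix z assume z: "z \<in> \<phi> U"
    obtain x where x: "m x = z" using m_bij by (metis bij_pointE)
    have "\<exists>y\<in>window. x + y \<in> U"
      using window[OF assms(2) empty_in_\<Omega>, of x] z x \<phi>_empty by auto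
    then obtain y where "y \<in> window" "x + y \<in> U" by blast
    then show "z \<in> (\<lambda>(u, y). m (u - y)) ` (U \<times> window)"
      by (intro image_eqI[of _ _ "(x + y, y)"]) (simp_all add: x)
  qed
qed (use assms finite_window in simp)

text \<open>Two points whose difference lies outside this set are never seen by the same window.\<close>

definition gap :: "gint set" where
  "gap = (\<lambda>(x, y). to_gint (x - y)) ` (window \<times> window)"

lemma finite_gap: "finite gap" using finite_window by (simp add: gap_def)

text \<open>Only \<open>T\<close> has to be sparse; \<open>U\<close> is transformed as a whole.\<close>

lemma \<phi>_sparse:
  assumes "finite T" "U \<union> T \<in> \<Omega>" "T \<inter> U = {}"
    and "\<And>t s. t \<in> T \<Longrightarrow> s \<in> U \<union> T \<Longrightarrow> s \<noteq> t \<Longrightarrow> to_gint (t - s) \<notin> gap \<and> to_gint (s - t) \<notin> gap"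
  shows "\<phi> (U \<union> T) = \<phi> U \<union> (\<Union>t\<in>T. (\<lambda>a. m t + a) ` \<phi> {0})"
  using assms
proof (induction T rule: finite_induct)
  case (insert t T)
  have eq: "U \<union> insert t T = (U \<union> T) \<union> {t}" by auto
  have "\<phi> (U \<union> insert t T) = \<phi> (U \<union> T) \<union> \<phi> {t}"
    unfolding eq
  proof (rule \<phi>_union)
    show "U \<union> T \<union> {t} \<in> \<Omega>" using insert.prems(1) eq by simp
    fix u w x y assume *: "u \<in> U \<union> T" "w \<in> {t}" "x \<in> window" "y \<in> window"
    show "u - w \<noteq> x - y"
    proof
      assume "u - w = x - y"
      then have "to_gint (u - w) \<in> gap" unfolding gap_def using * by (intro image_eqI[of _ _ "(x, y)"]) auto
      moreover have "u \<noteq> t" using * insert by auto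
      ultimately show False using insert.prems(3)[of t u] * by auto
    qed
  qed
  also have "\<phi> (U \<union> T) = \<phi> U \<union> (\<Union>t\<in>T. (\<lambda>a. m t + a) ` \<phi> {0})"
  proof (rule insert.IH)
    show "U \<union> T \<in> \<Omega>" using insert.prems(1) by (rule subset_in_\<Omega>) auto
  qed (use insert.prems in auto)
  finally show ?case using \<phi>_singleton[of t] by auto
qed simp

lemma sparse_test_set:
  assumes p: "prime_elem p" "comaximal p (gcnj p)" and "finite U" "U \<in> \<Omega>"
    and x: "\<And>u. u \<in> U \<Longrightarrow> \<not> p ^ k dvd to_gint u - x \<and> \<not> gcnj p ^ k dvd to_gint u - x"
  obtains T where "\<phi> (U \<union> T) = \<phi> U \<union> (\<Union>t\<in>T. (\<lambda>a. m t + a) ` \<phi> {0})" "U \<union> T \<in> \<Omega>"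
    "\<And>z. \<not> p ^ k dvd z - x \<Longrightarrow> \<not> gcnj p ^ k dvd z - x \<Longrightarrow>
      \<exists>t\<in>T. of_int (gnorm p ^ k) dvd to_gint t - z"
proof -
  have "admissible k (to_gint ` U)" using \<open>U \<in> \<Omega>\<close> by (simp add: in_\<Omega> adm_def)
  then have "\<exists>T. finite T \<and> T \<inter> to_gint ` U = {} \<and> admissible k (to_gint ` U \<union> T) \<and>
      (\<forall>t\<in>T. \<forall>s\<in>to_gint ` U \<union> T. s \<noteq> t \<longrightarrow> t - s \<notin> gap \<and> s - t \<notin> gap) \<and>
      (\<forall>z. \<not> p ^ k dvd z - x \<longrightarrow> \<not> gcnj p ^ k dvd z - x \<longrightarrow>
        (\<exists>t\<in>T. of_int (gnorm p ^ k) dvd t - z))"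
    using k p finite_gap \<open>finite U\<close> x by (intro exists_sparse_cover) auto
  then obtain T where T: "finite T" "T \<inter> to_gint ` U = {}" "admissible k (to_gint ` U \<union> T)"
    "\<forall>t\<in>T. \<forall>s\<in>to_gint ` U \<union> T. s \<noteq> t \<longrightarrow> t - s \<notin> gap \<and> s - t \<notin> gap"
    "\<forall>z. \<not> p ^ k dvd z - x \<longrightarrow> \<not> gcnj p ^ k dvd z - x \<longrightarrow>
        (\<exists>t\<in>T. of_int (gnorm p ^ k) dvd t - z)"
    by (elim exE conjE) (rule that)
  define T' where "T' = of_gint ` T"
  have TT: "to_gint ` T' = T" by (simp add: T'_def image_image)
  have mem: "to_gint t \<in> T \<longleftrightarrow> t \<in> T'" for t
    by (metis TT imageE imageI to_gint_eq_iff)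
  have om: "U \<union> T' \<in> \<Omega>" using T(3) by (simp add: in_\<Omega> adm_def image_Un TT)
  show ?thesis
  proof (rule that[of T'])
    show "\<phi> (U \<union> T') = \<phi> U \<union> (\<Union>t\<in>T'. (\<lambda>a. m t + a) ` \<phi> {0})"
    proof (rule \<phi>_sparse)
      show "finite T'" using T(1) by (simp add: T'_def)
      show "T' \<inter> U = {}" using T(2) mem by blast
      fix t s assume "t \<in> T'" "s \<in> U \<union> T'" "s \<noteq> t"
      then show "to_gint (t - s) \<notin> gap \<and> to_gint (s - t) \<notin> gap"
        using T(4)[rule_format, of "to_gint t" "to_gint s"] mem by auto
    qed (rule om)
    fix z assume "\<not> p ^ k dvd z - x" "\<not> gcnj p ^ k dvd z - x"
    then show "\<exists>t\<in>T'. of_int (gnorm p ^ k) dvd to_gint t - z"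
      using T(5)[rule_format, of z] TT by blast
  qed (rule om)
qed

definition minv :: "int ^ 2 \<Rightarrow> int ^ 2" where "minv = inv_into UNIV m"

text \<open>The map \<open>m\<close> and its inverse, read on Gaussian integers.\<close>

abbreviation "fwd z \<equiv> to_gint (m (of_gint z))"
abbreviation "bwd z \<equiv> to_gint (minv (of_gint z))"

lemma minv [simp]: "minv (m x) = x" "m (minv x) = x"
  using m_bij unfolding minv_def by (simp_all add: bij_is_inj bij_is_surj surj_f_inv_f)

lemma minv_add: "minv (x + y) = minv x + minv y"
  by (metis minv m_add)

lemma fwd_add: "fwd (x + y) = fwd x + fwd y" by (simp add: m_add)
lemma bwd_add: "bwd (x + y) = bwd x + bwd y" by (simp add: minv_add)

lemmas fwd_hom = additive_of_int[of fwd, OF fwd_add]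
lemmas bwd_hom = additive_of_int[of bwd, OF bwd_add]

lemma fwd_of_int_dvd: "of_int n dvd z \<Longrightarrow> of_int n dvd fwd z"
  by (metis dvd_def fwd_hom(4))

lemma surj_bwd: "surj bwd"
  by (rule surjI[of _ fwd]) simp

lemma large_prime_for:
  assumes "finite D"
  obtains p where "prime_elem p" "comaximal p (gcnj p)" "\<And>d. d \<in> D \<Longrightarrow> gnorm d < gnorm p"
proof -
  obtain p where p: "prime_elem p" "gnorm p > (\<Sum>d\<in>D. gnorm d)" "comaximal p (gcnj p)"
    using large_split_prime by blast
  have "gnorm d < gnorm p" if "d \<in> D" for d
    using member_le_sum[of d D gnorm] that assms p(2) by simp
  then show ?thesis using that p by blast
qed

lemma power_dvd_small:
  assumes "gnorm z < gnorm p" "p ^ k dvd z" shows "z = 0"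
proof (rule ccontr)
  assume "z \<noteq> 0"
  then show False
    using dvd_imp_gnorm_le[OF assms(2)] assms(1) gnorm_le_gnorm_power[of k p] k by linarith
qed

text \<open>The test set for \<open>x = 0\<close> meets every class outside the two ideals \<open>(p ^ k)\<close> and \<open>(gcnj p ^ k)\<close>. Its image misses
  a class \<open>c\<close> modulo \<open>p ^ k\<close>; pulling this back along \<open>m\<close>, for each \<open>a\<close> in \<open>\<phi> {0}\<close> the coset \<open>w a + K\<close> of \<open>K\<close>, the
  preimage of \<open>(p ^ k)\<close>, is contained in the union of the two ideals. This determines the inverse of \<open>m\<close> up to a
  unit and conjugation, whence \<open>K\<close> is one of the two ideals and all \<open>w a\<close> lie in it. So the elements of \<open>\<phi> {0}\<close> are
  congruent modulo a number of large norm, and hence equal.\<close>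

lemma image_origin_and_linear_part:
  "\<exists>s u. \<phi> {0} = {s} \<and> gnorm u = 1 \<and> ((\<forall>z. bwd z = u * z) \<or> (\<forall>z. bwd z = u * gcnj z))"
proof -
  define A where "A = \<phi> {0}"
  have finA: "finite A" unfolding A_def by (rule \<phi>_finite) (simp_all add: singleton_in_\<Omega>)
  have "A \<noteq> {}"
    using \<phi>_empty bij singleton_in_\<Omega>[of 0] empty_in_\<Omega>
    unfolding A_def bij_betw_def inj_on_def by (metis insert_not_empty)
  \<comment> \<open>the norm of \<open>p\<close> has to exceed those of the coefficients of the inverse of \<open>m\<close> and of the differences of points of \<open>A\<close>;
    the entry \<open>2\<close> makes \<open>p\<close> prime to \<open>2\<close>\<close>
  define E where "E = insert 2 (insert (bwd 1 - gI * bwd gI) (insert (bwd 1 + gI * bwd gI)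
    ((\<lambda>(a, a'). bwd (to_gint a - to_gint a')) ` (A \<times> A))))"
  have "finite E" using finA by (simp add: E_def)
  then obtain p where p: "prime_elem p" "comaximal p (gcnj p)" "\<And>d. d \<in> E \<Longrightarrow> gnorm d < gnorm p"
    by (rule large_prime_for) blast
  have p': "prime_elem (gcnj p)" using p(1) by (simp add: prime_elem_gcnj)
  have p4: "gnorm p > 4" using p(3)[of 2] by (simp add: E_def gnorm_def)
  obtain T where T: "\<phi> ({} \<union> T) = \<phi> {} \<union> (\<Union>t\<in>T. (\<lambda>a. m t + a) ` \<phi> {0})" "{} \<union> T \<in> \<Omega>"
    "\<And>z. \<not> p ^ k dvd z - 0 \<Longrightarrow> \<not> gcnj p ^ k dvd z - 0 \<Longrightarrow> \<exists>t\<in>T. of_int (gnorm p ^ k) dvd to_gint t - z"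
    by (rule sparse_test_set[of p "{}" 0]) (use p empty_in_\<Omega> in auto)
  have "(\<Union>t\<in>T. (\<lambda>a. m t + a) ` A) \<in> \<Omega>" using \<phi>_in[OF T(2)] T(1) \<phi>_empty by (simp add: A_def)
  then obtain c where c: "\<And>t a. t \<in> T \<Longrightarrow> a \<in> A \<Longrightarrow> \<not> p ^ k dvd to_gint (m t + a) - c"
    using p(1) unfolding in_\<Omega> adm_def admissible_def by blast
  define w where "w = (\<lambda>a. bwd (c - to_gint a))"
  define K where "K = {\<kappa>. p ^ k dvd fwd \<kappa>}"
  have cov: "p ^ k dvd w a + \<kappa> \<or> gcnj p ^ k dvd w a + \<kappa>" if a: "a \<in> A" and \<kappa>: "\<kappa> \<in> K" for a \<kappa>
  proof (rule ccontr)
    assume "\<not> ?thesis"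
    then obtain t where t: "t \<in> T" "of_int (gnorm p ^ k) dvd to_gint t - (w a + \<kappa>)"
      using T(3)[of "w a + \<kappa>"] by auto
    have "of_int (gnorm p ^ k) dvd fwd (to_gint t - (w a + \<kappa>))"
      by (rule fwd_of_int_dvd[OF t(2)])
    moreover have "p ^ k dvd of_int (gnorm p ^ k)"
      by (simp add: mult_gcnj[symmetric] power_mult_distrib)
    ultimately have "p ^ k dvd fwd (to_gint t - (w a + \<kappa>))" by (meson dvd_trans)
    moreover have "p ^ k dvd fwd \<kappa>" using \<kappa> by (simp add: K_def)
    ultimately have "p ^ k dvd fwd (to_gint t - (w a + \<kappa>)) + fwd \<kappa>" by (rule dvd_add)
    also have "fwd (to_gint t - (w a + \<kappa>)) + fwd \<kappa> = to_gint (m t + a) - c"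
      by (simp add: m_add m_simps w_def algebra_simps)
    finally show False using c t(1) a by blast
  qed
  have co2: "comaximal (p ^ k) 2" "comaximal (gcnj p ^ k) 2"
    using comaximal_2 p(1) p' p4 by simp_all
  have K0: "0 \<in> K" by (simp add: K_def m_simps)
  obtain a0 where a0: "a0 \<in> A" using \<open>A \<noteq> {}\<close> by blast
  have Kcases: "(\<forall>\<kappa>\<in>K. p ^ k dvd \<kappa>) \<or> (\<forall>\<kappa>\<in>K. gcnj p ^ k dvd \<kappa>)"
    by (rule subgroup_in_union_of_ideals[of K "p ^ k" "gcnj p ^ k" "w a0", OF _ K0 co2 cov[OF a0]])
      (simp_all add: K_def m_add dvd_add)
  have bwdK: "bwd z \<in> K" if "p ^ k dvd z" for z using that by (simp add: K_def)
  have "\<exists>u. gnorm u = 1 \<and> ((\<forall>z. bwd z = u * z) \<or> (\<forall>z. bwd z = u * gcnj z))"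
  proof (rule additive_preserving_ideal[OF bwd_add surj_bwd _ p(1,2)])
    show "(\<forall>z. p ^ k dvd z \<longrightarrow> p ^ k dvd bwd z) \<or> (\<forall>z. p ^ k dvd z \<longrightarrow> gcnj p ^ k dvd bwd z)"
      using Kcases bwdK by blast
  qed (use k p(3) in \<open>simp_all add: E_def\<close>)
  then obtain u where u: "gnorm u = 1" "(\<forall>z. bwd z = u * z) \<or> (\<forall>z. bwd z = u * gcnj z)" by blast
  have notdvd: "\<not> p ^ k dvd gcnj p ^ k" "\<not> gcnj p ^ k dvd p ^ k"
    using conj_prime_powers_not_dvd[OF p(1,2)] k by simp_all
  \<comment> \<open>a coset of the ideal \<open>(q)\<close> inside \<open>(q) \<union> (r)\<close> is \<open>(q)\<close> itself\<close>
  have coset: "q dvd v" if "\<not> r dvd q" and cv: "\<And>\<kappa>. q dvd \<kappa> \<Longrightarrow> q dvd v + \<kappa> \<or> r dvd v + \<kappa>" for q r v :: gint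
  proof (rule ccontr)
    assume nq: "\<not> q dvd v"
    then have "r dvd v" using cv[of 0] by simp
    moreover have "r dvd v + q" using cv[of q] nq dvd_add_left_iff[of q q v] by auto
    ultimately show False using that(1) dvd_add_right_iff[of r v q] by blast
  qed
  have diff0: "a = a'" if aa: "a \<in> A" "a' \<in> A" for a a'
  proof -
    have bwd_diff: "bwd (to_gint a - to_gint a') = w a' - w a"
      unfolding w_def bwd_hom(3)[symmetric] by simp
    have "\<exists>q. gnorm q = gnorm p \<and> (\<forall>a\<in>A. q ^ k dvd w a)"
      using u(2)
    proof
      assume f: "\<forall>z. bwd z = u * z"
      have "\<kappa> \<in> K" if "p ^ k dvd \<kappa>" for \<kappa>
      proof -
        have "\<kappa> = u * fwd \<kappa>" using f[rule_format, of "fwd \<kappa>"] by simp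
        then show ?thesis using that unit_dvd_iff[OF u(1), of "p ^ k" "fwd \<kappa>"] by (simp add: K_def)
      qed
      then have "\<forall>a\<in>A. p ^ k dvd w a" using coset[OF notdvd(2)] cov by blast
      then show ?thesis by blast
    next
      assume f: "\<forall>z. bwd z = u * gcnj z"
      have "\<kappa> \<in> K" if "gcnj p ^ k dvd \<kappa>" for \<kappa>
      proof -
        have "\<kappa> = u * gcnj (fwd \<kappa>)" using f[rule_format, of "fwd \<kappa>"] by simp
        then have "gcnj p ^ k dvd gcnj (fwd \<kappa>)"
          using that unit_dvd_iff[OF u(1), of "gcnj p ^ k" "gcnj (fwd \<kappa>)"] by simp
        then have "gcnj (p ^ k) dvd gcnj (fwd \<kappa>)" by simp
        then show ?thesis by (simp only: gcnj_dvd_iff K_def mem_Collect_eq)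
      qed
      then have "\<forall>a\<in>A. gcnj p ^ k dvd w a" using coset[OF notdvd(1)] cov by blast
      then show ?thesis by (intro exI[of _ "gcnj p"]) simp
    qed
    then obtain q where q: "gnorm q = gnorm p" "q ^ k dvd w a' - w a" using aa by (meson dvd_diff)
    have "bwd (to_gint a - to_gint a') \<in> E"
      unfolding E_def using aa by (intro insertI2 image_eqI[of _ _ "(a, a')"]) simp_all
    then have "bwd (to_gint a - to_gint a') = 0"
      using power_dvd_small[of _ q] p(3) q bwd_diff by metis
    then have "minv (a - a') = 0" by (metis of_gint_simps(3) of_to_gint to_gint_simps(3))
    then have "a - a' = 0" by (metis minv(2) m_simps(1))
    then show ?thesis by simp
  qed
  have "A = {a0}" using a0 diff0 by blast
  then show ?thesis using u A_def by blast
qed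

definition offset :: "int ^ 2" where "offset = (SOME s. \<phi> {0} = {s})"

lemma \<phi>_origin: "\<phi> {0} = {offset}"
  unfolding offset_def by (rule someI_ex) (use image_origin_and_linear_part in blast)

text \<open>A point \<open>m y + offset\<close> of the image with \<open>y \<notin> U\<close> is unmasked by the test set for \<open>x = y\<close>: it can be added to \<open>U\<close>, but
  its image together with \<open>m y + offset\<close> meets every class modulo \<open>p ^ k\<close>.\<close>

lemma \<phi>_finite_subset:
  assumes "finite U" "U \<in> \<Omega>"
  shows "\<phi> U \<subseteq> (\<lambda>x. m x + offset) ` U"
proof (rule ccontr)
  assume "\<not> ?thesis"
  then obtain x where x: "x \<in> \<phi> U" "x \<notin> (\<lambda>x. m x + offset) ` U" by blast
  define y where "y = minv (x - offset)"
  have my: "m y + offset = x" by (simp add: y_def)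
  then have yU: "y \<notin> U" using x(2) by blast
  obtain u where u: "gnorm u = 1" "(\<forall>z. bwd z = u * z) \<or> (\<forall>z. bwd z = u * gcnj z)"
    using image_origin_and_linear_part by blast
  have "finite ((\<lambda>v. to_gint v - to_gint y) ` U)" using assms(1) by simp
  then obtain p where p: "prime_elem p" "comaximal p (gcnj p)"
    "\<And>d. d \<in> (\<lambda>v. to_gint v - to_gint y) ` U \<Longrightarrow> gnorm d < gnorm p"
    by (rule large_prime_for) blast
  have p': "prime_elem (gcnj p)" using p(1) by (simp add: prime_elem_gcnj)
  have far: "\<not> p ^ k dvd to_gint v - to_gint y \<and> \<not> gcnj p ^ k dvd to_gint v - to_gint y" if "v \<in> U" for v
  proof -
    have "to_gint v - to_gint y \<noteq> 0" using that yU by auto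
    then show ?thesis
      using power_dvd_small[of "to_gint v - to_gint y" p] power_dvd_small[of "to_gint v - to_gint y" "gcnj p"]
        p(3)[OF imageI[OF that]] by auto
  qed
  obtain T where T: "\<phi> (U \<union> T) = \<phi> U \<union> (\<Union>t\<in>T. (\<lambda>a. m t + a) ` \<phi> {0})" "U \<union> T \<in> \<Omega>"
    "\<And>z. \<not> p ^ k dvd z - to_gint y \<Longrightarrow> \<not> gcnj p ^ k dvd z - to_gint y \<Longrightarrow>
      \<exists>t\<in>T. of_int (gnorm p ^ k) dvd to_gint t - z"
    by (rule sparse_test_set[OF p(1,2) assms far]) blast+
  obtain c where c: "\<And>v. v \<in> \<phi> (U \<union> T) \<Longrightarrow> \<not> p ^ k dvd to_gint v - c"
    using \<phi>_in[OF T(2)] p(1) unfolding in_\<Omega> adm_def admissible_def by blast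
  define z0 where "z0 = bwd (c - to_gint offset)"
  have fwd_z0: "fwd (to_gint v - z0) = to_gint (m v + offset) - c" for v
    by (simp add: z0_def m_simps)
  have miss: "\<not> p ^ k dvd fwd (to_gint v - z0)" if "v \<in> insert y T" for v
  proof -
    have "m v + offset \<in> \<phi> (U \<union> T)" using that x(1) my T(1) \<phi>_origin by auto
    then show ?thesis unfolding fwd_z0 by (rule c)
  qed
  \<comment> \<open>\<open>z0\<close> is the preimage of the missed class; it is moved within its class modulo \<open>q\<close> so as to avoid \<open>y\<close> modulo \<open>r\<close> as well,
    where \<open>q\<close> and \<open>r\<close> are \<open>p ^ k\<close> and its conjugate in the order dictated by the linear part\<close>
  have contra: False
    if q: "\<not> q dvd to_gint y - z0" "\<And>t. t \<in> T \<Longrightarrow> \<not> q dvd to_gint t - z0"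
      and qr: "q = p ^ k \<and> r = gcnj p ^ k \<or> q = gcnj p ^ k \<and> r = p ^ k" for q r
  proof -
    have "\<not> r dvd q" using qr conj_prime_powers_not_dvd[OF p(1,2)] k by auto
    have "\<exists>z. q dvd z - z0 \<and> \<not> r dvd z - to_gint y"
    proof (cases "r dvd z0 - to_gint y")
      case True
      then have "\<not> r dvd (z0 - to_gint y) + q"
        using \<open>\<not> r dvd q\<close> dvd_add_right_iff[of r "z0 - to_gint y" q] by blast
      then show ?thesis by (intro exI[of _ "z0 + q"]) (simp add: algebra_simps)
    qed (intro exI[of _ z0], simp)
    then obtain z where z: "q dvd z - z0" "\<not> r dvd z - to_gint y" by blast
    have "\<not> q dvd z - to_gint y"
    proof
      assume "q dvd z - to_gint y"
      with z(1) have "q dvd (z - z0) - (z - to_gint y)" by (rule dvd_diff)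
      then show False using q(1) by simp
    qed
    then obtain t where t: "t \<in> T" "of_int (gnorm p ^ k) dvd to_gint t - z"
      using T(3)[of z] z(2) qr by blast
    have "of_int (gnorm p ^ k) = p ^ k * gcnj p ^ k"
      by (simp add: mult_gcnj[symmetric] power_mult_distrib)
    then have "q dvd of_int (gnorm p ^ k)" using qr by auto
    then have "q dvd to_gint t - z" using t(2) by (rule dvd_trans)
    then have "q dvd (to_gint t - z) + (z - z0)" using z(1) by (rule dvd_add)
    then show False using q(2)[OF t(1)] by simp
  qed
  from u(2) show False
  proof
    assume f: "\<forall>z. bwd z = u * z"
    have "\<not> p ^ k dvd z" if "\<not> p ^ k dvd fwd z" for z
    proof -
      have "z = u * fwd z" using f[rule_format, of "fwd z"] by simp
      then show ?thesis using that unit_dvd_iff[OF u(1), of "p ^ k" "fwd z"] by simp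
    qed
    then show False using contra[of "p ^ k" "gcnj p ^ k"] miss by blast
  next
    assume f: "\<forall>z. bwd z = u * gcnj z"
    have "\<not> gcnj p ^ k dvd z" if "\<not> p ^ k dvd fwd z" for z
    proof -
      have "z = u * gcnj (fwd z)" using f[rule_format, of "fwd z"] by simp
      moreover have "\<not> gcnj (p ^ k) dvd gcnj (fwd z)" using that unfolding gcnj_dvd_iff .
      ultimately show ?thesis using unit_dvd_iff[OF u(1), of "gcnj p ^ k" "gcnj (fwd z)"] by simp
    qed
    then show False using contra[of "gcnj p ^ k" "p ^ k"] miss by blast
  qed
qed

text \<open>If the image of \<open>U\<close> came from a proper subset \<open>W\<close>, then by induction \<open>\<phi>\<close> would take the same value at \<open>W\<close> and
  at \<open>U\<close>.\<close>

lemma \<phi>_finite_eq: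
  assumes "finite U" "U \<in> \<Omega>"
  shows "\<phi> U = (\<lambda>x. m x + offset) ` U"
  using assms
proof (induction "card U" arbitrary: U rule: less_induct)
  case less
  obtain W where W: "W \<subseteq> U" "\<phi> U = (\<lambda>x. m x + offset) ` W"
    using \<phi>_finite_subset[OF less.prems] by (meson subset_imageE)
  show ?case
  proof (cases "W = U")
    case False
    then have "card W < card U" using W(1) less.prems(1) by (simp add: psubset_card_mono psubsetI)
    moreover have "finite W" "W \<in> \<Omega>" using W(1) less.prems finite_subset subset_in_\<Omega> by blast+
    ultimately have "\<phi> W = \<phi> U" using less.hyps W(2) by simp
    then have "W = U" using bij \<open>W \<in> \<Omega>\<close> less.prems(2) by (meson bij_betw_def inj_onD)
    then show ?thesis using False by simp
  qed (use W in simp)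
qed

text \<open>Membership of a point in the image depends on a finite part of \<open>U\<close> only, which is again a member of
  the hull.\<close>

lemma \<phi>_affine:
  assumes "U \<in> \<Omega>"
  shows "\<phi> U = (\<lambda>x. m x + offset) ` U"
proof -
  have "m x \<in> \<phi> U \<longleftrightarrow> m x \<in> (\<lambda>x. m x + offset) ` U" for x
  proof -
    define y where "y = x - minv offset"
    have my: "m y + offset = m x" by (simp add: y_def m_simps)
    define W where "W = U \<inter> insert y ((\<lambda>b. x + b) ` window)"
    have W: "finite W" "W \<in> \<Omega>" using finite_window subset_in_\<Omega>[OF assms] by (auto simp: W_def)
    have "m x \<in> \<phi> U \<longleftrightarrow> m x \<in> \<phi> W" by (intro window assms W) (auto simp: W_def)
    also have "\<dots> \<longleftrightarrow> y \<in> W"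
      unfolding \<phi>_finite_eq[OF W] my[symmetric] by auto
    also have "\<dots> \<longleftrightarrow> y \<in> U" by (auto simp: W_def)
    also have "\<dots> \<longleftrightarrow> m x \<in> (\<lambda>x. m x + offset) ` U"
      unfolding my[symmetric] by auto
    finally show ?thesis .
  qed
  then show ?thesis using m_bij by (metis (no_types, lifting) bij_pointE Set.set_eqI)
qed

end

section \<open>The symmetries of the Gaussian lattice\<close>

lemma group_GL2Z: "group GL2Z"
proof (rule groupI)
  fix A assume "A \<in> carrier GL2Z"
  then obtain B where "A ** B = mat 1" "B ** A = mat 1" by (auto simp: GL2Z_def invertible_def)
  then show "\<exists>B\<in>carrier GL2Z. B \<otimes>\<^bsub>GL2Z\<^esub> A = \<one>\<^bsub>GL2Z\<^esub>"
    by (intro bexI[of _ B]) (auto simp: GL2Z_def invertible_def)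
next
  fix A B assume "A \<in> carrier GL2Z" "B \<in> carrier GL2Z"
  then obtain A' B' where *: "A ** A' = mat 1" "A' ** A = mat 1" "B ** B' = mat 1" "B' ** B = mat 1"
    by (auto simp: GL2Z_def invertible_def)
  have "(A ** B) ** (B' ** A') = A ** (B ** B') ** A'" "(B' ** A') ** (A ** B) = B' ** (A' ** A) ** B"
    by (simp_all only: matrix_mul_assoc)
  then have "invertible (A ** B)" unfolding invertible_def using * by (intro exI[of _ "B' ** A'"]) simp
  then show "A \<otimes>\<^bsub>GL2Z\<^esub> B \<in> carrier GL2Z" by (simp add: GL2Z_def)
qed (auto simp: GL2Z_def matrix_mul_assoc invertible_def intro: exI[of _ "mat 1"])

definition mulmat :: "gint \<Rightarrow> int ^ 2 ^ 2" where
  "mulmat u = vector [vector [gre u, - gim u], vector [gim u, gre u]]"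

definition cnjmat :: "int ^ 2 ^ 2" where
  "cnjmat = vector [vector [1, 0], vector [0, - 1]]"

lemma mulmat_nth [simp]:
  "mulmat u $ 1 $ 1 = gre u" "mulmat u $ 1 $ 2 = - gim u" "mulmat u $ 2 $ 1 = gim u" "mulmat u $ 2 $ 2 = gre u"
  by (simp_all add: mulmat_def)

lemma cnjmat_nth [simp]:
  "cnjmat $ 1 $ 1 = 1" "cnjmat $ 1 $ 2 = 0" "cnjmat $ 2 $ 1 = 0" "cnjmat $ 2 $ 2 = - 1"
  by (simp_all add: cnjmat_def)

lemma mat2_eq_iff:
  "(A :: 'a ^ 2 ^ 2) = B \<longleftrightarrow> A $ 1 $ 1 = B $ 1 $ 1 \<and> A $ 1 $ 2 = B $ 1 $ 2 \<and> A $ 2 $ 1 = B $ 2 $ 1 \<and> A $ 2 $ 2 = B $ 2 $ 2"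
  by (auto simp: vec_eq_iff forall_2)

lemma mat2_mult_nth: "((A :: 'a :: semiring_1 ^ 2 ^ 2) ** B) $ i $ j = A $ i $ 1 * B $ 1 $ j + A $ i $ 2 * B $ 2 $ j"
  by (simp add: matrix_matrix_mult_def sum_2)

lemma mat2_vec_nth: "((A :: 'a :: semiring_1 ^ 2 ^ 2) *v x) $ i = A $ i $ 1 * x $ 1 + A $ i $ 2 * x $ 2"
  by (simp add: matrix_vector_mult_def sum_2)

lemma mat2_one_nth [simp]:
  "(mat 1 :: 'a :: semiring_1 ^ 2 ^ 2) $ 1 $ 1 = 1" "(mat 1 :: 'a ^ 2 ^ 2) $ 1 $ 2 = 0"
  "(mat 1 :: 'a ^ 2 ^ 2) $ 2 $ 1 = 0" "(mat 1 :: 'a ^ 2 ^ 2) $ 2 $ 2 = 1"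
  by (simp_all add: mat_def)

lemma mulmat_mult: "mulmat u ** mulmat v = mulmat (u * v)"
  by (simp add: mat2_eq_iff mat2_mult_nth)

lemma cnjmat_mulmat: "cnjmat ** mulmat u = mulmat (gcnj u) ** cnjmat"
  by (simp add: mat2_eq_iff mat2_mult_nth)

lemma cnjmat_cnjmat: "cnjmat ** cnjmat = mat 1"
  by (simp add: mat2_eq_iff mat2_mult_nth)

lemma mulmat_1: "mulmat 1 = mat 1"
  by (simp add: mat2_eq_iff)

lemma to_gint_mulmat: "to_gint (mulmat u *v x) = u * to_gint x"
  by (simp add: gint_eq_iff mat2_vec_nth)

lemma to_gint_cnjmat: "to_gint (cnjmat *v x) = gcnj (to_gint x)"
  by (simp add: gint_eq_iff mat2_vec_nth)

lemma inj_mulmat: "mulmat u = mulmat v \<longleftrightarrow> u = v"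
  by (auto simp: mat2_eq_iff gint_eq_iff)

lemma mulmat_neq_cnj: "gnorm u = 1 \<Longrightarrow> mulmat u \<noteq> mulmat v ** cnjmat"
  by (auto simp: mat2_eq_iff mat2_mult_nth gnorm_def)

text \<open>The unit multiplications, with and without a preceding conjugation.\<close>

definition dihedral_mats :: "(int ^ 2 ^ 2) set" where
  "dihedral_mats = {mulmat u | u. gnorm u = 1} \<union> {mulmat u ** cnjmat | u. gnorm u = 1}"

lemma mulmat_in: "gnorm u = 1 \<Longrightarrow> mulmat u \<in> dihedral_mats"
  and mulmat_cnj_in: "gnorm u = 1 \<Longrightarrow> mulmat u ** cnjmat \<in> dihedral_mats"
  by (auto simp: dihedral_mats_def)

lemma dihedral_mats_cases:
  assumes "M \<in> dihedral_mats"
  obtains u where "gnorm u = 1" "M = mulmat u" | u where "gnorm u = 1" "M = mulmat u ** cnjmat"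
  using assms by (auto simp: dihedral_mats_def)

lemma mulmat_cnj_products:
  "mulmat u ** (mulmat v ** cnjmat) = mulmat (u * v) ** cnjmat"
  "(mulmat u ** cnjmat) ** mulmat v = mulmat (u * gcnj v) ** cnjmat"
  "(mulmat u ** cnjmat) ** (mulmat v ** cnjmat) = mulmat (u * gcnj v)"
proof -
  show "mulmat u ** (mulmat v ** cnjmat) = mulmat (u * v) ** cnjmat"
    by (simp only: matrix_mul_assoc mulmat_mult)
  show *: "(mulmat u ** cnjmat) ** mulmat v = mulmat (u * gcnj v) ** cnjmat"
    by (simp only: matrix_mul_assoc[symmetric] cnjmat_mulmat) (simp only: matrix_mul_assoc mulmat_mult)
  show "(mulmat u ** cnjmat) ** (mulmat v ** cnjmat) = mulmat (u * gcnj v)"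
    by (simp only: matrix_mul_assoc *) (simp only: matrix_mul_assoc[symmetric] cnjmat_cnjmat matrix_mul_rid)
qed

lemma dihedral_mats_mult: "A \<in> dihedral_mats \<Longrightarrow> B \<in> dihedral_mats \<Longrightarrow> A ** B \<in> dihedral_mats"
  by (elim dihedral_mats_cases)
    (simp_all add: mulmat_mult mulmat_cnj_products mulmat_in mulmat_cnj_in gnorm_mult)

lemma dihedral_mats_inverse:
  assumes "A \<in> dihedral_mats"
  shows "\<exists>B\<in>dihedral_mats. B ** A = mat 1 \<and> A ** B = mat 1"
  using assms
proof (cases rule: dihedral_mats_cases)
  case (1 u)
  then show ?thesis
    by (intro bexI[of _ "mulmat (gcnj u)"]) (simp_all add: mulmat_mult gnorm_1_inverse mulmat_1 mulmat_in)
next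
  case (2 u)
  then show ?thesis
    by (intro bexI[of _ "mulmat u ** cnjmat"])
      (simp_all add: mulmat_cnj_products gnorm_1_inverse mulmat_1 mulmat_cnj_in)
qed

lemma dihedral_mats_invertible: "A \<in> dihedral_mats \<Longrightarrow> invertible A"
  using dihedral_mats_inverse by (auto simp: invertible_def)

lemma subgroup_dihedral_mats: "subgroup dihedral_mats GL2Z"
proof (rule group.subgroupI[OF group_GL2Z])
  show "dihedral_mats \<subseteq> carrier GL2Z" using dihedral_mats_invertible by (auto simp: GL2Z_def)
  show "dihedral_mats \<noteq> {}" using mulmat_in[of 1] by auto
  fix A assume A: "A \<in> dihedral_mats"
  obtain B where B: "B \<in> dihedral_mats" "B ** A = mat 1" using dihedral_mats_inverse[OF A] by blast
  have "inv\<^bsub>GL2Z\<^esub> A = B"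
    by (rule group.inv_equality[OF group_GL2Z])
      (use A B dihedral_mats_invertible in \<open>auto simp: GL2Z_def\<close>)
  then show "inv\<^bsub>GL2Z\<^esub> A \<in> dihedral_mats" using B by simp
  fix B assume "B \<in> dihedral_mats"
  then show "A \<otimes>\<^bsub>GL2Z\<^esub> B \<in> dihedral_mats" using A dihedral_mats_mult by (simp add: GL2Z_def)
qed

lemma int_sum_squares_1:
  fixes a b :: int
  assumes "a * a + b * b = 1"
  shows "(a = 1 \<or> a = - 1) \<and> b = 0 \<or> a = 0 \<and> (b = 1 \<or> b = - 1)"
proof -
  have "\<bar>a\<bar> \<le> 1" "\<bar>b\<bar> \<le> 1"
    using abs_le_square_iff[of a 1] abs_le_square_iff[of b 1] assms zero_le_square[of a] zero_le_square[of b]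
    by (auto simp: power2_eq_square)
  then have "a \<in> {-1, 0, 1}" "b \<in> {-1, 0, 1}" by auto
  then show ?thesis using assms by auto
qed

lemma gnorm_eq_1_iff: "gnorm u = 1 \<longleftrightarrow> u \<in> {1, gI, - 1, - gI}"
proof
  assume "gnorm u = 1"
  then have "gre u * gre u + gim u * gim u = 1" by (simp add: gnorm_def)
  from int_sum_squares_1[OF this] show "u \<in> {1, gI, - 1, - gI}" by (auto simp: gint_eq_iff)
qed (auto simp: gnorm_def)

text \<open>This form of membership is the one that compares directly with orthogonality over the reals and
  with invariance of a quadratic form.\<close>

lemma dihedral_mats_iff:
  "M \<in> dihedral_mats \<longleftrightarrow> M $ 1 $ 1 * M $ 1 $ 1 + M $ 2 $ 1 * M $ 2 $ 1 = 1 \<and>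
     M $ 1 $ 2 * M $ 1 $ 2 + M $ 2 $ 2 * M $ 2 $ 2 = 1 \<and>
     M $ 1 $ 1 * M $ 1 $ 2 + M $ 2 $ 1 * M $ 2 $ 2 = 0"
proof
  assume "M \<in> dihedral_mats"
  then show "M $ 1 $ 1 * M $ 1 $ 1 + M $ 2 $ 1 * M $ 2 $ 1 = 1 \<and>
     M $ 1 $ 2 * M $ 1 $ 2 + M $ 2 $ 2 * M $ 2 $ 2 = 1 \<and>
     M $ 1 $ 1 * M $ 1 $ 2 + M $ 2 $ 1 * M $ 2 $ 2 = 0"
    by (cases rule: dihedral_mats_cases) (auto simp: mat2_mult_nth gnorm_def)
next
  assume *: "M $ 1 $ 1 * M $ 1 $ 1 + M $ 2 $ 1 * M $ 2 $ 1 = 1 \<and>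
     M $ 1 $ 2 * M $ 1 $ 2 + M $ 2 $ 2 * M $ 2 $ 2 = 1 \<and>
     M $ 1 $ 1 * M $ 1 $ 2 + M $ 2 $ 1 * M $ 2 $ 2 = 0"
  define u where "u = GInt (M $ 1 $ 1) (M $ 2 $ 1)"
  have u: "gnorm u = 1" using * by (simp add: u_def gnorm_def)
  have "M = mulmat u \<or> M = mulmat u ** cnjmat"
    using int_sum_squares_1[of "M $ 1 $ 1" "M $ 2 $ 1"] int_sum_squares_1[of "M $ 1 $ 2" "M $ 2 $ 2"] *
    by (auto simp: u_def mat2_eq_iff mat2_mult_nth)
  then show "M \<in> dihedral_mats" using u mulmat_in mulmat_cnj_in by auto
qed

lemma finite_dihedral_mats: "finite dihedral_mats"
proof -
  have "finite {u. gnorm u = 1}" by (rule finite_subset[OF _ finite_gnorm_le[of 1]]) auto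
  then have "finite (mulmat ` {u. gnorm u = 1} \<union> (\<lambda>u. mulmat u ** cnjmat) ` {u. gnorm u = 1})" by simp
  moreover have "dihedral_mats \<subseteq> mulmat ` {u. gnorm u = 1} \<union> (\<lambda>u. mulmat u ** cnjmat) ` {u. gnorm u = 1}"
    by (auto simp: dihedral_mats_def)
  ultimately show ?thesis by (rule finite_subset[rotated])
qed

text \<open>Averaging the standard scalar product over a finite group \<open>K\<close> that contains the symmetries of the
  square gives a \<open>K\<close>-invariant form; invariance under the square makes it a positive multiple of
  the standard one, so \<open>K\<close> consists of orthogonal integer matrices.\<close>

lemma maximal_finite_dihedral_mats: "maximal_finite_subgroup dihedral_mats GL2Z"
  unfolding maximal_finite_subgroup_def
proof (intro conjI allI impI)
  fix K assume K: "subgroup K GL2Z \<and> finite K \<and> dihedral_mats \<subseteq> K"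
  define q where "q = (\<lambda>x y :: int ^ 2. \<Sum>A\<in>K. (A *v x) $ 1 * (A *v y) $ 1 + (A *v x) $ 2 * (A *v y) $ 2)"
  have inv: "q (B *v x) (B *v y) = q x y" if B: "B \<in> K" for B x y
  proof -
    have bij: "bij_betw (\<lambda>A. A ** B) K K"
    proof -
      have "inj_on (\<lambda>A. A ** B) K"
      proof (rule inj_onI)
        fix A A' assume eq: "A ** B = A' ** B"
        obtain C where "B ** C = mat 1"
          using K B subgroup.subset[of K GL2Z] by (auto simp: GL2Z_def invertible_def)
        then show "A = A'" using arg_cong[OF eq, of "\<lambda>M. M ** C"]
          by (simp add: matrix_mul_assoc[symmetric])
      qed
      moreover have "(\<lambda>A. A ** B) ` K \<subseteq> K"
        using K B subgroup.m_closed[of K GL2Z _ B] by (auto simp: GL2Z_def)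
      ultimately show ?thesis using K by (simp add: bij_betw_def endo_inj_surj)
    qed
    show ?thesis unfolding q_def
      using sum.reindex_bij_betw[OF bij, of "\<lambda>A. (A *v x) $ 1 * (A *v y) $ 1 + (A *v x) $ 2 * (A *v y) $ 2"]
      by (simp add: matrix_vector_mul_assoc)
  qed
  define e1 e2 :: "int ^ 2" where "e1 = vector [1, 0]" and "e2 = vector [0, 1]"
  define c where "c = q e1 e1"
  have form: "q x y = x $ 1 * y $ 1 * q e1 e1 + (x $ 1 * y $ 2 + x $ 2 * y $ 1) * q e1 e2 + x $ 2 * y $ 2 * q e2 e2" for x y
  proof -
    have "q x y = (\<Sum>A\<in>K. x $ 1 * y $ 1 * ((A *v e1) $ 1 * (A *v e1) $ 1 + (A *v e1) $ 2 * (A *v e1) $ 2)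
        + (x $ 1 * y $ 2 + x $ 2 * y $ 1) * ((A *v e1) $ 1 * (A *v e2) $ 1 + (A *v e1) $ 2 * (A *v e2) $ 2)
        + x $ 2 * y $ 2 * ((A *v e2) $ 1 * (A *v e2) $ 1 + (A *v e2) $ 2 * (A *v e2) $ 2))"
      unfolding q_def by (rule sum.cong) (simp_all add: mat2_vec_nth e1_def e2_def algebra_simps)
    then show ?thesis unfolding q_def by (simp only: sum.distrib[symmetric] sum_distrib_left)
  qed
  have "cnjmat \<in> K" "mulmat gI \<in> K"
    using K mulmat_cnj_in[of 1] mulmat_in[of gI] by (auto simp: mulmat_1 gnorm_def)
  then have "q (cnjmat *v e1) (cnjmat *v e2) = q e1 e2" "q (mulmat gI *v e1) (mulmat gI *v e1) = q e1 e1"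
    by (simp_all only: inv)
  then have off: "q e1 e2 = 0" and diag: "q e2 e2 = c"
    using form[of "cnjmat *v e1" "cnjmat *v e2"] form[of "mulmat gI *v e1" "mulmat gI *v e1"]
    by (simp_all add: mat2_vec_nth e1_def e2_def c_def)
  have q_eq: "q x y = c * (x $ 1 * y $ 1 + x $ 2 * y $ 2)" for x y
    using form[of x y] off diag by (simp add: c_def algebra_simps)
  have "c > 0"
  proof -
    have "mat 1 \<in> K" using K subgroup.one_closed[of K GL2Z] by (simp add: GL2Z_def)
    then have "(mat 1 *v e1) $ 1 * (mat 1 *v e1) $ 1 + (mat 1 *v e1) $ 2 * (mat 1 *v e1) $ 2 \<le> c"
      unfolding c_def q_def using K by (intro member_le_sum) auto
    then show ?thesis by (simp add: e1_def)
  qed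
  have "K \<subseteq> dihedral_mats"
  proof
    fix A assume "A \<in> K"
    then have "q (A *v x) (A *v y) = q x y" for x y by (rule inv)
    then have "(A *v x) $ 1 * (A *v y) $ 1 + (A *v x) $ 2 * (A *v y) $ 2 = x $ 1 * y $ 1 + x $ 2 * y $ 2" for x y
      using \<open>c > 0\<close> by (simp add: q_eq)
    from this[of e1 e1] this[of e2 e2] this[of e1 e2] show "A \<in> dihedral_mats"
      by (simp add: dihedral_mats_iff e1_def e2_def mat2_vec_nth)
  qed
  then show "K = dihedral_mats" using K by blast
qed (use subgroup_dihedral_mats finite_dihedral_mats in auto)

lemma real_matrix_nth [simp]: "real_matrix M $ i $ j = real_of_int (M $ i $ j)"
  by (simp add: real_matrix_def)

text \<open>The two corners \<open>(1, 1)\<close> and \<open>(1, - 1)\<close> of the square must stay inside it, which forces the unit rows of an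
  orthogonal matrix to be axial.\<close>

lemma real_matrix_dihedral_mats: "real_matrix ` dihedral_mats = square_symmetries"
proof (rule equalityI)
  define Sq where "Sq = {x :: real ^ 2. \<forall>i. \<bar>x $ i\<bar> \<le> 1}"
  have entries: "(M $ 1 $ 1 = 1 \<or> M $ 1 $ 1 = - 1) \<and> M $ 2 $ 1 = 0 \<and> M $ 1 $ 2 = 0 \<and> (M $ 2 $ 2 = 1 \<or> M $ 2 $ 2 = - 1) \<or>
      (M $ 2 $ 1 = 1 \<or> M $ 2 $ 1 = - 1) \<and> M $ 1 $ 1 = 0 \<and> M $ 2 $ 2 = 0 \<and> (M $ 1 $ 2 = 1 \<or> M $ 1 $ 2 = - 1)"
    if "M \<in> dihedral_mats" for M
    using that unfolding dihedral_mats_iff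
    using int_sum_squares_1[of "M $ 1 $ 1" "M $ 2 $ 1"] int_sum_squares_1[of "M $ 1 $ 2" "M $ 2 $ 2"]
    by auto
  have ortho: "orthogonal_matrix (real_matrix M)" if "M \<in> dihedral_mats" for M
    using entries[OF that] by (auto simp: orthogonal_matrix mat2_eq_iff mat2_mult_nth transpose_def)
  have into: "real_matrix M *v x \<in> Sq" "transpose (real_matrix M) *v x \<in> Sq"
    if "M \<in> dihedral_mats" "x \<in> Sq" for M x
    using entries[OF that(1)] that(2) by (auto simp: Sq_def forall_2 mat2_vec_nth transpose_def)
  show "real_matrix ` dihedral_mats \<subseteq> square_symmetries"
  proof (rule image_subsetI)
    fix M assume M: "M \<in> dihedral_mats"
    have "(\<lambda>x. real_matrix M *v x) ` Sq = Sq"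
    proof (rule equalityI)
      show "Sq \<subseteq> (\<lambda>x. real_matrix M *v x) ` Sq"
      proof
        fix x assume x: "x \<in> Sq"
        have "real_matrix M *v (transpose (real_matrix M) *v x) = mat 1 *v x"
          using ortho[OF M] unfolding matrix_vector_mul_assoc orthogonal_matrix_def by metis
        then have "real_matrix M *v (transpose (real_matrix M) *v x) = x"
          by (simp only: matrix_vector_mul_lid)
        then show "x \<in> (\<lambda>x. real_matrix M *v x) ` Sq" using into(2)[OF M x] by (metis imageI)
      qed
    qed (use into(1)[OF M] in blast)
    then show "real_matrix M \<in> square_symmetries"
      using ortho[OF M] by (simp add: square_symmetries_def Sq_def)
  qed
  show "square_symmetries \<subseteq> real_matrix ` dihedral_mats"
  proof
    fix A assume "A \<in> square_symmetries"
    then have A: "orthogonal_matrix A" "\<And>x. x \<in> Sq \<Longrightarrow> A *v x \<in> Sq"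
      unfolding square_symmetries_def Sq_def by auto
    have "vector [1, 1] \<in> Sq" "vector [1, - 1] \<in> Sq" by (simp_all add: Sq_def forall_2)
    from A(2)[OF this(1)] A(2)[OF this(2)]
    have sq: "\<bar>A $ 1 $ 1 + A $ 1 $ 2\<bar> \<le> 1" "\<bar>A $ 1 $ 1 - A $ 1 $ 2\<bar> \<le> 1"
      "\<bar>A $ 2 $ 1 + A $ 2 $ 2\<bar> \<le> 1" "\<bar>A $ 2 $ 1 - A $ 2 $ 2\<bar> \<le> 1"
      by (simp_all add: Sq_def forall_2 mat2_vec_nth)
    have "transpose A ** A = mat 1" "A ** transpose A = mat 1"
      using A(1) by (simp_all add: orthogonal_matrix_def)
    then have o: "A $ 1 $ 1 * A $ 1 $ 1 + A $ 2 $ 1 * A $ 2 $ 1 = 1"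
      "A $ 1 $ 2 * A $ 1 $ 2 + A $ 2 $ 2 * A $ 2 $ 2 = 1"
      "A $ 1 $ 1 * A $ 1 $ 2 + A $ 2 $ 1 * A $ 2 $ 2 = 0"
      "A $ 1 $ 1 * A $ 1 $ 1 + A $ 1 $ 2 * A $ 1 $ 2 = 1"
      "A $ 2 $ 1 * A $ 2 $ 1 + A $ 2 $ 2 * A $ 2 $ 2 = 1"
      by (simp_all add: mat2_eq_iff mat2_mult_nth transpose_def)
    \<comment> \<open>the squares of \<open>a + b\<close> and \<open>a - b\<close> are \<open>1 + 2 a b\<close> and \<open>1 - 2 a b\<close>, so both are at most \<open>1\<close> only if \<open>a b = 0\<close>\<close>
    have axial: "a = 0 \<and> (b = 1 \<or> b = - 1) \<or> b = 0 \<and> (a = 1 \<or> a = - 1)"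
      if "\<bar>a + b\<bar> \<le> 1" "\<bar>a - b\<bar> \<le> 1" "a * a + b * b = 1" for a b :: real
    proof -
      have "(a + b)\<^sup>2 \<le> 1" "(a - b)\<^sup>2 \<le> 1"
        using that(1,2) by (simp_all add: abs_square_le_1)
      moreover have "(a + b)\<^sup>2 = (a * a + b * b) + 2 * (a * b)" "(a - b)\<^sup>2 = (a * a + b * b) - 2 * (a * b)"
        by (simp_all add: power2_eq_square algebra_simps)
      ultimately have "a * b = 0" using that(3) by linarith
      then show ?thesis using that(3) by (auto simp: square_eq_1_iff)
    qed
    define M where "M = (\<chi> i j. \<lfloor>A $ i $ j\<rfloor>)"
    have cases: "(A $ 1 $ 1 = 0 \<and> (A $ 1 $ 2 = 1 \<or> A $ 1 $ 2 = - 1) \<or> A $ 1 $ 2 = 0 \<and> (A $ 1 $ 1 = 1 \<or> A $ 1 $ 1 = - 1))"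
      "(A $ 2 $ 1 = 0 \<and> (A $ 2 $ 2 = 1 \<or> A $ 2 $ 2 = - 1) \<or> A $ 2 $ 2 = 0 \<and> (A $ 2 $ 1 = 1 \<or> A $ 2 $ 1 = - 1))"
      using axial sq o by blast+
    then have AM: "A = real_matrix M" by (auto simp: mat2_eq_iff M_def)
    have "real_of_int (M $ 1 $ 1 * M $ 1 $ 1 + M $ 2 $ 1 * M $ 2 $ 1) = 1"
      "real_of_int (M $ 1 $ 2 * M $ 1 $ 2 + M $ 2 $ 2 * M $ 2 $ 2) = 1"
      "real_of_int (M $ 1 $ 1 * M $ 1 $ 2 + M $ 2 $ 1 * M $ 2 $ 2) = 0"
      using o(1-3) unfolding AM by simp_all
    then have "M \<in> dihedral_mats"
      unfolding dihedral_mats_iff of_int_eq_1_iff of_int_eq_0_iff by (intro conjI)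
    then show "A \<in> real_matrix ` dihedral_mats" using AM by blast
  qed
qed

text \<open>For the explicit models \<open>H\<close> below, the map from \<open>H\<close> to \<open>G\<close> is the one that can be written down; its inverse is the
  isomorphism.\<close>

lemma is_iso_from_inverse:
  assumes "bij_betw h (carrier H) (carrier G)"
    and "\<And>a b. a \<in> carrier H \<Longrightarrow> b \<in> carrier H \<Longrightarrow> a \<otimes>\<^bsub>H\<^esub> b \<in> carrier H \<and> h (a \<otimes>\<^bsub>H\<^esub> b) = h a \<otimes>\<^bsub>G\<^esub> h b"
  shows "G \<cong> H"
proof (rule is_isoI)
  show "inv_into (carrier H) h \<in> iso G H"
    unfolding iso_def
  proof (intro CollectI conjI)
    show "bij_betw (inv_into (carrier H) h) (carrier G) (carrier H)"
      using assms(1) by (rule bij_betw_inv_into)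
    show "inv_into (carrier H) h \<in> hom G H"
    proof (rule homI)
      fix x y assume "x \<in> carrier G" "y \<in> carrier G"
      then obtain a b where ab: "a \<in> carrier H" "b \<in> carrier H" "x = h a" "y = h b"
        using assms(1) unfolding bij_betw_def by blast
      then show "inv_into (carrier H) h (x \<otimes>\<^bsub>G\<^esub> y) =
          inv_into (carrier H) h x \<otimes>\<^bsub>H\<^esub> inv_into (carrier H) h y"
        using assms(2)[OF ab(1,2)] assms(1) by (metis bij_betw_inv_into_left)
    qed (use assms(1) bij_betw_inv_into bij_betwE in metis)
  qed
qed

lemma gI_powers: "gI ^ 2 = - 1" "gI ^ 3 = - gI" "gI ^ nat 0 = 1" "gI ^ nat 1 = gI" "gI ^ nat 2 = - 1" "gI ^ nat 3 = - gI"
  by (simp_all add: gint_eq_iff power2_eq_square numeral_3_eq_3)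

lemma atLeastLessThan_4: "{0..<4 :: int} = {0, 1, 2, 3}"
  by auto

lemma gI_powers_units: "(\<lambda>a. gI ^ nat a) ` {0..<4} = {u. gnorm u = 1}"
  unfolding atLeastLessThan_4 image_insert gI_powers gnorm_eq_1_iff by auto

lemma gI_powers_inj: "inj_on (\<lambda>a. gI ^ nat a) {0..<4}"
  unfolding atLeastLessThan_4 inj_on_def by (auto simp: gI_powers gint_eq_iff)

lemma dihedral_mats_cong_dihedral_group:
  "GL2Z \<lparr>carrier := dihedral_mats\<rparr> \<cong> dihedral_group 4"
proof (rule is_iso_from_inverse)
  define h where "h = (\<lambda>(a :: int, s). if s then mulmat (gI ^ nat a) ** cnjmat else mulmat (gI ^ nat a))"
  note powers = gI_powers_units and inj = gI_powers_inj
  have norm: "gnorm (gI ^ nat a) = 1" for a by (simp add: gnorm_power) (simp add: gnorm_def)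
  show "bij_betw h (carrier (dihedral_group 4)) (carrier (GL2Z \<lparr>carrier := dihedral_mats\<rparr>))"
    unfolding bij_betw_def
  proof
    have can: "A = B" if "A ** cnjmat = B ** cnjmat" for A B :: "int ^ 2 ^ 2"
      using arg_cong[OF that, of "\<lambda>M. M ** cnjmat"] by (simp add: matrix_mul_assoc[symmetric] cnjmat_cnjmat)
    show "inj_on h (carrier (dihedral_group 4))"
    proof (rule inj_onI)
      fix x y assume xy: "x \<in> carrier (dihedral_group 4)" "y \<in> carrier (dihedral_group 4)" "h x = h y"
      obtain a s b t where ab: "x = (a, s)" "y = (b, t)" by fastforce
      have mem: "a \<in> {0..<4}" "b \<in> {0..<4}" using xy ab by (auto simp: dihedral_group_def)
      have "s = t" using xy(3) mulmat_neq_cnj norm by (auto simp: h_def ab split: if_splits) metis+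
      then have "gI ^ nat a = gI ^ nat b"
        using xy(3) can[of "mulmat (gI ^ nat a)" "mulmat (gI ^ nat b)"]
        by (auto simp: h_def ab inj_mulmat split: if_splits)
      then show "x = y" using inj mem \<open>s = t\<close> ab by (auto dest: inj_onD)
    qed
    show "h ` carrier (dihedral_group 4) = carrier (GL2Z \<lparr>carrier := dihedral_mats\<rparr>)"
    proof (rule equalityI)
      show "h ` carrier (dihedral_group 4) \<subseteq> carrier (GL2Z \<lparr>carrier := dihedral_mats\<rparr>)"
        using norm by (auto simp: h_def mulmat_in mulmat_cnj_in)
      show "carrier (GL2Z \<lparr>carrier := dihedral_mats\<rparr>) \<subseteq> h ` carrier (dihedral_group 4)"
      proof
        fix M assume "M \<in> carrier (GL2Z \<lparr>carrier := dihedral_mats\<rparr>)"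
        then have "M \<in> dihedral_mats" by simp
        then show "M \<in> h ` carrier (dihedral_group 4)"
        proof (cases rule: dihedral_mats_cases)
          case (1 u)
          then obtain a where "a \<in> {0..<4}" "u = gI ^ nat a" using powers by blast
          then show ?thesis using 1 by (intro image_eqI[of _ _ "(a, False)"]) (auto simp: h_def dihedral_group_def)
        next
          case (2 u)
          then obtain a where "a \<in> {0..<4}" "u = gI ^ nat a" using powers by blast
          then show ?thesis using 2 by (intro image_eqI[of _ _ "(a, True)"]) (auto simp: h_def dihedral_group_def)
        qed
      qed
    qed
  qed
  fix x y assume xy: "x \<in> carrier (dihedral_group 4)" "y \<in> carrier (dihedral_group 4)"
  obtain a s b t where ab: "x = (a, s)" "y = (b, t)" by fastforce
  have mem: "a \<in> {0, 1, 2, 3}" "b \<in> {0, 1, 2, 3}"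
    using xy ab atLeastLessThan_4 by (auto simp: dihedral_group_def)
  have pw: "gI ^ nat ((a + b) mod 4) = gI ^ nat a * gI ^ nat b"
    "gI ^ nat ((a - b) mod 4) = gI ^ nat a * gcnj (gI ^ nat b)"
    using mem by (auto simp: gI_powers gint_eq_iff simp del: gcnj_power)
  show "x \<otimes>\<^bsub>dihedral_group 4\<^esub> y \<in> carrier (dihedral_group 4) \<and>
      h (x \<otimes>\<^bsub>dihedral_group 4\<^esub> y) = h x \<otimes>\<^bsub>GL2Z \<lparr>carrier := dihedral_mats\<rparr>\<^esub> h y"
    using pw by (auto simp: ab dihedral_group_def h_def GL2Z_def mulmat_mult mulmat_cnj_products)
qed

lemma rotation_mats_cong:
  "GL2Z \<lparr>carrier := mulmat ` {u. gnorm u = 1}\<rparr> \<cong> integer_mod_group 4"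
proof (rule is_iso_from_inverse)
  note powers = gI_powers_units and inj = gI_powers_inj
  show "bij_betw (\<lambda>a. mulmat (gI ^ nat a)) (carrier (integer_mod_group 4))
      (carrier (GL2Z \<lparr>carrier := mulmat ` {u. gnorm u = 1}\<rparr>))"
    unfolding bij_betw_def
  proof
    show "inj_on (\<lambda>a. mulmat (gI ^ nat a)) (carrier (integer_mod_group 4))"
    proof (rule inj_onI)
      fix a b assume "a \<in> carrier (integer_mod_group 4)" "b \<in> carrier (integer_mod_group 4)"
        "mulmat (gI ^ nat a) = mulmat (gI ^ nat b)"
      then show "a = b" using inj_onD[OF inj, of a b] by (simp add: inj_mulmat carrier_integer_mod_group)
    qed
    have "(\<lambda>a. mulmat (gI ^ nat a)) ` {0..<4} = mulmat ` (\<lambda>a. gI ^ nat a) ` {0..<4}"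
      by (simp only: image_image)
    then show "(\<lambda>a. mulmat (gI ^ nat a)) ` carrier (integer_mod_group 4) =
        carrier (GL2Z \<lparr>carrier := mulmat ` {u. gnorm u = 1}\<rparr>)"
      by (simp only: powers carrier_integer_mod_group) simp
  qed
  fix a b assume "a \<in> carrier (integer_mod_group 4)" "b \<in> carrier (integer_mod_group 4)"
  then have mem: "a \<in> {0, 1, 2, 3}" "b \<in> {0, 1, 2, 3}"
    using atLeastLessThan_4 by (auto simp: carrier_integer_mod_group)
  have "gI ^ nat ((a + b) mod 4) = gI ^ nat a * gI ^ nat b"
    using mem by (auto simp: gI_powers gint_eq_iff)
  then show "a \<otimes>\<^bsub>integer_mod_group 4\<^esub> b \<in> carrier (integer_mod_group 4) \<and>
      mulmat (gI ^ nat (a \<otimes>\<^bsub>integer_mod_group 4\<^esub> b)) =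
      mulmat (gI ^ nat a) \<otimes>\<^bsub>GL2Z \<lparr>carrier := mulmat ` {u. gnorm u = 1}\<rparr>\<^esub> mulmat (gI ^ nat b)"
    by (simp add: GL2Z_def mulmat_mult carrier_integer_mod_group)
qed

lemma reflection_mats_cong:
  "GL2Z \<lparr>carrier := {mat 1, cnjmat}\<rparr> \<cong> integer_mod_group 2"
proof (rule is_iso_from_inverse)
  have c: "carrier (integer_mod_group 2) = {0, 1}" by (auto simp: carrier_integer_mod_group)
  show "bij_betw (\<lambda>a. if a = 0 then mat 1 else cnjmat) (carrier (integer_mod_group 2))
      (carrier (GL2Z \<lparr>carrier := {mat 1, cnjmat}\<rparr>))"
    unfolding bij_betw_def c by (auto simp: inj_on_def mat2_eq_iff)
  fix a b assume "a \<in> carrier (integer_mod_group 2)" "b \<in> carrier (integer_mod_group 2)"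
  then show "a \<otimes>\<^bsub>integer_mod_group 2\<^esub> b \<in> carrier (integer_mod_group 2) \<and>
      (if a \<otimes>\<^bsub>integer_mod_group 2\<^esub> b = 0 then mat 1 else cnjmat) =
      (if a = 0 then mat 1 else cnjmat) \<otimes>\<^bsub>GL2Z \<lparr>carrier := {mat 1, cnjmat}\<rparr>\<^esub> (if b = 0 then mat 1 else cnjmat)"
    unfolding c by (auto simp: GL2Z_def cnjmat_cnjmat)
qed

lemma semidirect_dihedral_mats:
  "internal_semidirect (GL2Z \<lparr>carrier := dihedral_mats\<rparr>) (mulmat ` {u. gnorm u = 1}) {mat 1, cnjmat}"
proof -
  let ?D = "GL2Z \<lparr>carrier := dihedral_mats\<rparr>"
  have D: "group ?D" using group.subgroup_imp_group[OF group_GL2Z subgroup_dihedral_mats] .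
  have inv: "inv\<^bsub>?D\<^esub> A = B" if "A \<in> dihedral_mats" "B \<in> dihedral_mats" "B ** A = mat 1" for A B
    by (rule group.inv_equality[OF D]) (use that in \<open>auto simp: GL2Z_def\<close>)
  have c: "cnjmat \<in> dihedral_mats" "mat 1 \<in> dihedral_mats"
    using mulmat_cnj_in[of 1] mulmat_in[of 1] by (simp_all add: mulmat_1)
  have sub1: "subgroup (mulmat ` {u. gnorm u = 1}) ?D"
  proof (rule group.subgroupI[OF D])
    show "mulmat ` {u. gnorm u = 1} \<subseteq> carrier ?D" by (auto simp: mulmat_in)
    show "mulmat ` {u. gnorm u = 1} \<noteq> {}" by (auto intro: exI[of _ 1])
    fix A assume "A \<in> mulmat ` {u. gnorm u = 1}"
    then obtain u where u: "gnorm u = 1" "A = mulmat u" by blast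
    have "inv\<^bsub>?D\<^esub> A = mulmat (gcnj u)"
      by (rule inv) (use u in \<open>simp_all add: mulmat_in mulmat_mult gnorm_1_inverse mulmat_1\<close>)
    then show "inv\<^bsub>?D\<^esub> A \<in> mulmat ` {u. gnorm u = 1}" using u by simp
    fix B assume "B \<in> mulmat ` {u. gnorm u = 1}"
    then show "A \<otimes>\<^bsub>?D\<^esub> B \<in> mulmat ` {u. gnorm u = 1}"
      using u by (auto simp: GL2Z_def mulmat_mult gnorm_mult)
  qed
  have sub2: "subgroup {mat 1, cnjmat} ?D"
  proof (rule group.subgroupI[OF D])
    fix A assume A: "A \<in> {mat 1, cnjmat}"
    have "inv\<^bsub>?D\<^esub> A = A" by (rule inv) (use A c in \<open>auto simp: cnjmat_cnjmat\<close>)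
    then show "inv\<^bsub>?D\<^esub> A \<in> {mat 1, cnjmat}" using A by simp
    fix B assume "B \<in> {mat 1, cnjmat}"
    then show "A \<otimes>\<^bsub>?D\<^esub> B \<in> {mat 1, cnjmat}" using A by (auto simp: GL2Z_def cnjmat_cnjmat)
  qed (use c in auto)
  have normal: "normal (mulmat ` {u. gnorm u = 1}) ?D"
    unfolding group.normal_inv_iff[OF D]
  proof (intro conjI ballI sub1)
    fix A B assume A: "A \<in> carrier ?D" and B: "B \<in> mulmat ` {u. gnorm u = 1}"
    then obtain v where v: "gnorm v = 1" "B = mulmat v" by blast
    have "A \<in> dihedral_mats" using A by simp
    then show "A \<otimes>\<^bsub>?D\<^esub> B \<otimes>\<^bsub>?D\<^esub> inv\<^bsub>?D\<^esub> A \<in> mulmat ` {u. gnorm u = 1}"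
    proof (cases rule: dihedral_mats_cases)
      case (1 u)
      have "inv\<^bsub>?D\<^esub> A = mulmat (gcnj u)"
        by (rule inv) (use 1 in \<open>simp_all add: mulmat_in mulmat_mult gnorm_1_inverse mulmat_1\<close>)
      then show ?thesis using 1 v by (simp add: GL2Z_def mulmat_mult gnorm_mult)
    next
      case (2 u)
      have "inv\<^bsub>?D\<^esub> A = A"
        by (rule inv) (use 2 in \<open>simp_all add: mulmat_cnj_in mulmat_cnj_products gnorm_1_inverse mulmat_1\<close>)
      then show ?thesis using 2 v by (simp add: GL2Z_def mulmat_cnj_products gnorm_mult)
    qed
  qed
  have "mulmat ` {u. gnorm u = 1} \<inter> {mat 1, cnjmat} = {\<one>\<^bsub>?D\<^esub>}"
    using mulmat_1 by (auto simp: GL2Z_def image_iff mat2_eq_iff intro!: exI[of _ 1])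
  moreover have "mulmat ` {u. gnorm u = 1} <#>\<^bsub>?D\<^esub> {mat 1, cnjmat} = carrier ?D"
    by (auto simp: set_mult_def GL2Z_def dihedral_mats_def)
  ultimately show ?thesis using normal sub2 unfolding internal_semidirect_def by blast
qed

section \<open>Gaussian integers as complex numbers\<close>

definition cpx :: "gint \<Rightarrow> complex" where
  "cpx z = Complex (of_int (gre z)) (of_int (gim z))"

lemma cpx_simps [simp]:
  "cpx 0 = 0" "cpx 1 = 1" "cpx (z + w) = cpx z + cpx w" "cpx (z * w) = cpx z * cpx w"
  "cpx (- z) = - cpx z" "cpx (gcnj z) = cnj (cpx z)" "cpx gI = \<i>"
  by (simp_all add: cpx_def complex_eq_iff)

lemma cpx_eq_iff [simp]: "cpx z = cpx w \<longleftrightarrow> z = w"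
  by (simp add: cpx_def gint_eq_iff)

lemma cpx_eq_0_iff [simp]: "cpx z = 0 \<longleftrightarrow> z = 0"
  using cpx_eq_iff[of z 0] by simp

lemma cpx_power: "cpx (z ^ n) = cpx z ^ n"
  by (induction n) auto

lemma to_gauss_eq_cpx: "to_gauss x = cpx (to_gint x)"
  by (simp add: to_gauss_def cpx_def complex_eq_iff)

lemma range_to_gauss: "range to_gauss = range cpx"
  unfolding to_gauss_eq_cpx by (auto simp: image_iff) (metis to_of_gint)

lemma of_gauss_cpx: "of_gauss (cpx z) = of_gint z"
  by (simp add: of_gauss_def of_gint_def cpx_def)

lemma gauss_ring_simps [simp]:
  "carrier gauss_ring = range cpx" "x \<otimes>\<^bsub>gauss_ring\<^esub> y = x * y" "\<one>\<^bsub>gauss_ring\<^esub> = 1" "\<zero>\<^bsub>gauss_ring\<^esub> = 0"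
  by (simp_all add: gauss_ring_def ring_of_type_algebra_def range_to_gauss)

lemma gauss_ring_pow: "x [^]\<^bsub>gauss_ring\<^esub> (n :: nat) = x ^ n"
  by (induction n) (simp_all add: nat_pow_def mult.commute)

lemma gauss_ring_divides: "cpx a divides\<^bsub>gauss_ring\<^esub> cpx b \<longleftrightarrow> a dvd b"
proof -
  have "cpx b = cpx a * cpx c \<longleftrightarrow> b = a * c" for c
    using cpx_eq_iff[of b "a * c"] by simp
  then show ?thesis by (auto simp: factor_def dvd_def)
qed

lemma gauss_ring_Units: "cpx u \<in> Units gauss_ring \<longleftrightarrow> gnorm u = 1"
proof -
  have "cpx c * cpx u = 1 \<longleftrightarrow> c * u = 1" for c
    using cpx_eq_iff[of "c * u" 1] by simp
  then have "cpx u \<in> Units gauss_ring \<longleftrightarrow> u dvd 1"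
    by (auto simp: Units_def dvd_def mult.commute)
  then show ?thesis by (simp add: gint_unit_iff)
qed

lemma Units_gauss_ring: "Units gauss_ring = cpx ` {u. gnorm u = 1}"
proof -
  have "Units gauss_ring \<subseteq> range cpx" by (auto simp: Units_def)
  then show ?thesis using gauss_ring_Units by blast
qed

lemma gauss_ring_prime: "ring_prime\<^bsub>gauss_ring\<^esub> (cpx p) \<longleftrightarrow> prime_elem p"
proof -
  have mult: "cpx p divides\<^bsub>gauss_ring\<^esub> (cpx a * cpx b) \<longleftrightarrow> p dvd a * b" for a b
    using gauss_ring_divides[of p "a * b"] by simp
  show ?thesis
    by (simp add: ring_prime_def Divisibility.prime_def prime_elem_def gauss_ring_Units gint_unit_iff
        gauss_ring_divides mult)
qed

lemma gauss_kfree_eq: "gauss_kfree k = kfree_set k"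
proof -
  have "(\<exists>p\<in>carrier gauss_ring. ring_prime\<^bsub>gauss_ring\<^esub> p \<and> (p [^]\<^bsub>gauss_ring\<^esub> k) divides\<^bsub>gauss_ring\<^esub> to_gauss x)
      \<longleftrightarrow> (\<exists>p. prime_elem p \<and> p ^ k dvd to_gint x)" for x
    by (simp add: gauss_ring_prime gauss_ring_pow to_gauss_eq_cpx cpx_power[symmetric] gauss_ring_divides)
  then show ?thesis by (simp add: gauss_kfree_def kfree_set_def kfree_def)
qed

text \<open>An additive map is determined by its values on the two basis vectors.\<close>

lemma matrix_of_additive:
  fixes f :: "int ^ 2 \<Rightarrow> int ^ 2"
  assumes "\<And>x y. f (x + y) = f x + f y"
  shows "matrix f *v x = f x"
proof -
  define g where "g = (\<lambda>z. to_gint (f (of_gint z)))"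
  have g_add: "g (z + w) = g z + g w" for z w by (simp add: g_def assms)
  have "f x = of_gint (g (to_gint x))" by (simp add: g_def)
  also have "to_gint x = of_int (x $ 1) * 1 + of_int (x $ 2) * gI" by (simp add: gint_eq_iff)
  also have "g \<dots> = of_int (x $ 1) * g 1 + of_int (x $ 2) * g gI"
    by (simp only: g_add additive_of_int(4)[of g, OF g_add])
  also have "of_gint \<dots> = matrix f *v x"
  proof -
    have ax: "axis 1 1 = of_gint 1" "axis 2 1 = of_gint gI" by (simp_all add: vec_eq_iff forall_2 axis_def)
    show ?thesis by (simp add: vec_eq_iff forall_2 mat2_vec_nth matrix_def ax g_def mult.commute)
  qed
  finally show ?thesis ..
qed

text \<open>The maps whose matrices are needed are given on \<open>complex\<close>; \<open>g\<close> is the corresponding map of \<open>gint\<close>.\<close>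

lemma gauss_matrix_eq:
  assumes "\<And>z. f (cpx z) = cpx (g z)" "\<And>z w. g (z + w) = g z + g w"
    "\<And>x. to_gint (M *v x) = g (to_gint x)"
  shows "gauss_matrix f = M"
proof -
  have fx: "of_gauss (f (to_gauss x)) = of_gint (g (to_gint x))" for x
    by (simp add: to_gauss_eq_cpx assms(1) of_gauss_cpx)
  have "gauss_matrix f *v x = of_gint (g (to_gint x))" for x
    unfolding gauss_matrix_def fx by (rule matrix_of_additive) (simp add: assms(2))
  moreover have "of_gint (g (to_gint x)) = M *v x" for x by (simp add: assms(3)[symmetric])
  ultimately show ?thesis unfolding matrix_eq by simp
qed

lemma unit_matrix_cpx: "unit_matrix (cpx u) = mulmat u"
  unfolding unit_matrix_def
  by (rule gauss_matrix_eq[where g = "\<lambda>z. u * z"]) (simp_all add: to_gint_mulmat distrib_left)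

lemma C4_eq: "C4 = mulmat ` {u. gnorm u = 1}"
  by (simp add: C4_def Units_gauss_ring image_image unit_matrix_cpx)

lemma unit_matrix_iso: "unit_matrix \<in> iso (units_of gauss_ring) (GL2Z \<lparr>carrier := C4\<rparr>)"
proof -
  have "unit_matrix \<in> hom (units_of gauss_ring) (GL2Z \<lparr>carrier := C4\<rparr>)"
  proof (rule homI)
    fix x y assume "x \<in> carrier (units_of gauss_ring)" "y \<in> carrier (units_of gauss_ring)"
    then obtain u v where "x = cpx u" "y = cpx v" by (auto simp: units_of_def Units_gauss_ring)
    then show "unit_matrix (x \<otimes>\<^bsub>units_of gauss_ring\<^esub> y) =
        unit_matrix x \<otimes>\<^bsub>GL2Z \<lparr>carrier := C4\<rparr>\<^esub> unit_matrix y"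
      using unit_matrix_cpx[of "u * v"] by (simp add: units_of_def GL2Z_def mulmat_mult unit_matrix_cpx)
  qed (simp add: units_of_def C4_def)
  moreover have "bij_betw unit_matrix (carrier (units_of gauss_ring)) (carrier (GL2Z \<lparr>carrier := C4\<rparr>))"
    unfolding bij_betw_def
    by (auto simp: units_of_def C4_def Units_gauss_ring inj_on_def unit_matrix_cpx inj_mulmat)
  ultimately show ?thesis by (simp add: iso_def)
qed

section \<open>The automorphisms of the Gaussian field\<close>

abbreviation "cfield \<equiv> (ring_of_type_algebra :: complex ring)"

lemma field_cfield: "field cfield" by (rule field_from_type_algebra)

lemma cfield_simps [simp]:
  "carrier cfield = UNIV" "x \<otimes>\<^bsub>cfield\<^esub> y = x * y" "x \<oplus>\<^bsub>cfield\<^esub> y = x + y" "\<one>\<^bsub>cfield\<^esub> = 1" "\<zero>\<^bsub>cfield\<^esub> = 0"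
  by (simp_all add: ring_of_type_algebra_def)

lemma cfield_minus [simp]: "\<ominus>\<^bsub>cfield\<^esub> x = - x"
proof -
  interpret field cfield by (rule field_cfield)
  show ?thesis using minus_equality[of "- x" x] by simp
qed

lemma cfield_inv [simp]: "x \<noteq> 0 \<Longrightarrow> inv\<^bsub>cfield\<^esub> x = inverse x"
proof -
  assume "x \<noteq> 0"
  interpret field cfield by (rule field_cfield)
  show ?thesis using inv_char[of x "inverse x"] \<open>x \<noteq> 0\<close> by simp
qed

definition gauss_numbers :: "complex set" where "gauss_numbers = generate_field cfield {\<i>}"

lemma gauss_numbers_induct [consumes 1, case_names one i minus inverse add mult]:
  assumes "x \<in> gauss_numbers"
    and "P 1" "P \<i>"
    and "\<And>x. x \<in> gauss_numbers \<Longrightarrow> P x \<Longrightarrow> P (- x)"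
    and "\<And>x. x \<in> gauss_numbers \<Longrightarrow> P x \<Longrightarrow> x \<noteq> 0 \<Longrightarrow> P (inverse x)"
    and "\<And>x y. x \<in> gauss_numbers \<Longrightarrow> y \<in> gauss_numbers \<Longrightarrow> P x \<Longrightarrow> P y \<Longrightarrow> P (x + y)"
    and "\<And>x y. x \<in> gauss_numbers \<Longrightarrow> y \<in> gauss_numbers \<Longrightarrow> P x \<Longrightarrow> P y \<Longrightarrow> P (x * y)"
  shows "P x"
  using assms(1) unfolding gauss_numbers_def
  by (induction rule: generate_field.induct) (auto simp: assms(2-) gauss_numbers_def[symmetric])

lemma gauss_numbers_closed [simp]:
  "1 \<in> gauss_numbers" "\<i> \<in> gauss_numbers" "0 \<in> gauss_numbers"
  "x \<in> gauss_numbers \<Longrightarrow> - x \<in> gauss_numbers"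
  "x \<in> gauss_numbers \<Longrightarrow> inverse x \<in> gauss_numbers"
  "x \<in> gauss_numbers \<Longrightarrow> y \<in> gauss_numbers \<Longrightarrow> x + y \<in> gauss_numbers"
  "x \<in> gauss_numbers \<Longrightarrow> y \<in> gauss_numbers \<Longrightarrow> x * y \<in> gauss_numbers"
proof -
  show one: "1 \<in> gauss_numbers" and i: "\<i> \<in> gauss_numbers"
    using generate_field.one[of cfield "{\<i>}"] generate_field.incl[of \<i> "{\<i>}" cfield]
    by (simp_all add: gauss_numbers_def)
  show minus: "- x \<in> gauss_numbers" if "x \<in> gauss_numbers" for x
    using generate_field.a_inv[of x cfield "{\<i>}"] that by (simp add: gauss_numbers_def)
  show add: "x + y \<in> gauss_numbers" if "x \<in> gauss_numbers" "y \<in> gauss_numbers" for x y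
    using generate_field.eng_add[of x cfield "{\<i>}" y] that by (simp add: gauss_numbers_def)
  show "x * y \<in> gauss_numbers" if "x \<in> gauss_numbers" "y \<in> gauss_numbers" for x y
    using generate_field.eng_mult[of x cfield "{\<i>}" y] that by (simp add: gauss_numbers_def)
  show zero: "0 \<in> gauss_numbers" using add[OF one minus[OF one]] by simp
  show "inverse x \<in> gauss_numbers" if "x \<in> gauss_numbers" for x
    using generate_field.m_inv[of x cfield "{\<i>}"] that zero
    by (cases "x = 0") (simp_all add: gauss_numbers_def)
qed

lemma cpx_in_gauss_numbers [simp]: "cpx z \<in> gauss_numbers"
proof -
  have nat: "of_nat n \<in> gauss_numbers" for n by (induction n) simp_all
  have int: "of_int n \<in> gauss_numbers" for n
    using nat by (cases n rule: int_cases2) simp_all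
  have "cpx z = of_int (gre z) + of_int (gim z) * \<i>" by (simp add: cpx_def complex_eq_iff)
  then show ?thesis using int by simp
qed

lemma gauss_field_simps [simp]:
  "carrier gauss_field = gauss_numbers" "x \<otimes>\<^bsub>gauss_field\<^esub> y = x * y" "x \<oplus>\<^bsub>gauss_field\<^esub> y = x + y"
  "\<one>\<^bsub>gauss_field\<^esub> = 1"
  by (simp_all add: gauss_field_def gauss_numbers_def ring_of_type_algebra_def)

lemma cnj_gauss_numbers: "x \<in> gauss_numbers \<Longrightarrow> cnj x \<in> gauss_numbers"
  by (induction rule: gauss_numbers_induct) simp_all

abbreviation "gauss_aut \<equiv> ring_automorphism_group gauss_field"
abbreviation "idQ \<equiv> restrict (\<lambda>x. x) gauss_numbers"
abbreviation "cnjQ \<equiv> restrict cnj gauss_numbers"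

text \<open>Every element of the field arises from \<open>\<i>\<close> by operations that ring homomorphisms respect.\<close>

lemma ring_hom_gauss_determined:
  assumes f: "f \<in> ring_hom gauss_field gauss_field" and g: "g \<in> ring_hom gauss_field gauss_field"
    and eq: "f \<i> = g \<i>" and "x \<in> gauss_numbers"
  shows "f x = g x"
proof -
  have h: "h 1 = 1" "h 0 = 0" "x \<in> gauss_numbers \<Longrightarrow> h (- x) = - h x"
    "x \<in> gauss_numbers \<Longrightarrow> x \<noteq> 0 \<Longrightarrow> h (inverse x) = inverse (h x)"
    "x \<in> gauss_numbers \<Longrightarrow> y \<in> gauss_numbers \<Longrightarrow> h (x + y) = h x + h y"
    "x \<in> gauss_numbers \<Longrightarrow> y \<in> gauss_numbers \<Longrightarrow> h (x * y) = h x * h y"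
    if hh: "h \<in> ring_hom gauss_field gauss_field" for h x y
  proof -
    show one: "h 1 = 1" using ring_hom_one[OF hh] by simp
    show add: "h (x + y) = h x + h y" if "x \<in> gauss_numbers" "y \<in> gauss_numbers" for x y
      using ring_hom_add[OF hh, of x y] that by simp
    show mult: "h (x * y) = h x * h y" if "x \<in> gauss_numbers" "y \<in> gauss_numbers" for x y
      using ring_hom_mult[OF hh, of x y] that by simp
    show zero: "h 0 = 0" using add[of 0 0] by simp
    show "h (- x) = - h x" if "x \<in> gauss_numbers"
      using add[of x "- x"] that zero by (simp add: eq_neg_iff_add_eq_0 add.commute)
    show "h (inverse x) = inverse (h x)" if "x \<in> gauss_numbers" "x \<noteq> 0"
      using mult[of x "inverse x"] that one by (simp add: inverse_unique)
  qed
  show ?thesis using \<open>x \<in> gauss_numbers\<close>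
    by (induction rule: gauss_numbers_induct) (simp_all add: h[OF f] h[OF g] eq)
qed

lemma idQ_iso: "idQ \<in> ring_iso gauss_field gauss_field"
  and cnjQ_iso: "cnjQ \<in> ring_iso gauss_field gauss_field"
proof -
  show "idQ \<in> ring_iso gauss_field gauss_field"
    by (rule ring_iso_memI) (simp_all add: bij_betw_def inj_on_def)
  have "cnj ` gauss_numbers = gauss_numbers"
  proof (rule equalityI)
    show "gauss_numbers \<subseteq> cnj ` gauss_numbers"
      using cnj_gauss_numbers by (auto intro!: image_eqI[of _ cnj "cnj _"])
  qed (use cnj_gauss_numbers in blast)
  then show "cnjQ \<in> ring_iso gauss_field gauss_field"
    by (intro ring_iso_memI) (simp_all add: bij_betw_def inj_on_def cnj_gauss_numbers)
qed

text \<open>The image of \<open>\<i>\<close> is a square root of \<open>- 1\<close> and determines the automorphism.\<close>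

lemma carrier_gauss_automorphisms:
  "carrier gauss_aut = {idQ, cnjQ}"
proof -
  have "f = idQ \<or> f = cnjQ" if "f \<in> ring_iso gauss_field gauss_field" "f \<in> extensional gauss_numbers" for f
  proof -
    have hom: "f \<in> ring_hom gauss_field gauss_field" "idQ \<in> ring_hom gauss_field gauss_field"
      "cnjQ \<in> ring_hom gauss_field gauss_field"
      using that(1) idQ_iso cnjQ_iso by (simp_all add: ring_iso_def)
    have "f (\<i> * \<i>) = f \<i> * f \<i>" using ring_hom_mult[OF hom(1), of \<i> \<i>] by simp
    moreover have "f (- 1) + f 1 = f 0" "f 0 + f 0 = f 0" "f 1 = 1"
      using ring_hom_add[OF hom(1), of "- 1" 1] ring_hom_add[OF hom(1), of 0 0] ring_hom_one[OF hom(1)]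
      by simp_all
    ultimately have "f \<i> * f \<i> = - 1" by (simp add: eq_neg_iff_add_eq_0)
    then have "(f \<i> - \<i>) * (f \<i> + \<i>) = 0" by (simp add: algebra_simps)
    then have "f \<i> = \<i> \<or> f \<i> = - \<i>" by (simp add: eq_neg_iff_add_eq_0)
    then show ?thesis
    proof
      assume "f \<i> = \<i>"
      then have "f x = idQ x" if "x \<in> gauss_numbers" for x
        using ring_hom_gauss_determined[OF hom(1,2) _ that] by simp
      then show ?thesis using that(2) by (intro disjI1 extensionalityI[of _ gauss_numbers]) simp_all
    next
      assume "f \<i> = - \<i>"
      then have "f x = cnjQ x" if "x \<in> gauss_numbers" for x
        using ring_hom_gauss_determined[OF hom(1,3) _ that] by simp
      then show ?thesis using that(2) by (intro disjI2 extensionalityI[of _ gauss_numbers]) simp_all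
    qed
  qed
  then show ?thesis
    using idQ_iso cnjQ_iso by (auto simp: ring_automorphism_group_def)
qed

lemma gauss_automorphisms_Bij: "idQ \<in> Bij gauss_numbers" "cnjQ \<in> Bij gauss_numbers"
  using idQ_iso cnjQ_iso by (simp_all add: Bij_def ring_iso_def)

lemma gauss_automorphisms_mult:
  "idQ \<otimes>\<^bsub>gauss_aut\<^esub> idQ = idQ"
  "idQ \<otimes>\<^bsub>gauss_aut\<^esub> cnjQ = cnjQ"
  "cnjQ \<otimes>\<^bsub>gauss_aut\<^esub> idQ = cnjQ"
  "cnjQ \<otimes>\<^bsub>gauss_aut\<^esub> cnjQ = idQ"
  "\<one>\<^bsub>gauss_aut\<^esub> = idQ"
  using gauss_automorphisms_Bij cnj_gauss_numbers
  by (auto simp: ring_automorphism_group_def BijGroup_def compose_def fun_eq_iff)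

lemma group_gauss_automorphisms: "group gauss_aut"
  by (rule groupI) (auto simp: carrier_gauss_automorphisms gauss_automorphisms_mult)

lemma gauss_automorphisms_generated:
  "carrier gauss_aut =
     generate gauss_aut {restrict cnj (carrier gauss_field)}"
proof
  show "carrier gauss_aut \<subseteq>
      generate gauss_aut {restrict cnj (carrier gauss_field)}"
    using generate.one[of "gauss_aut" "{cnjQ}"]
      generate.incl[of cnjQ "{cnjQ}" "gauss_aut"]
    by (simp add: carrier_gauss_automorphisms gauss_automorphisms_mult)
  show "generate gauss_aut {restrict cnj (carrier gauss_field)}
      \<subseteq> carrier gauss_aut"
    by (rule group.generate_incl[OF group_gauss_automorphisms]) (simp add: carrier_gauss_automorphisms)
qed

lemma gauss_matrix_idQ: "gauss_matrix idQ = mat 1"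
  by (rule gauss_matrix_eq[where g = "\<lambda>z. z"]) simp_all

lemma gauss_matrix_cnjQ: "gauss_matrix cnjQ = cnjmat"
  by (rule gauss_matrix_eq[where g = gcnj]) (simp_all add: to_gint_cnjmat)

lemma C2_eq: "C2 = {mat 1, cnjmat}"
  by (simp add: C2_def carrier_gauss_automorphisms gauss_matrix_idQ gauss_matrix_cnjQ)

lemma gauss_matrix_iso:
  "gauss_matrix \<in> iso gauss_aut (GL2Z \<lparr>carrier := C2\<rparr>)"
proof -
  have ne: "mat 1 \<noteq> cnjmat" by (simp add: mat2_eq_iff)
  have "gauss_matrix \<in> hom gauss_aut (GL2Z \<lparr>carrier := C2\<rparr>)"
    by (rule homI)
      (auto simp: carrier_gauss_automorphisms gauss_automorphisms_mult gauss_matrix_idQ gauss_matrix_cnjQ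
        C2_eq GL2Z_def cnjmat_cnjmat)
  moreover have "bij_betw gauss_matrix (carrier gauss_aut)
      (carrier (GL2Z \<lparr>carrier := C2\<rparr>))"
    using ne unfolding bij_betw_def
    by (auto simp: carrier_gauss_automorphisms gauss_matrix_idQ gauss_matrix_cnjQ C2_eq inj_on_def)
  ultimately show ?thesis by (simp add: iso_def)
qed

section \<open>Groups of homeomorphisms\<close>

lemma group_homeomorphism_group: "group (homeomorphism_group T)"
proof -
  have hom_bij: "f \<in> Bij (topspace T)"
    if "homeomorphic_map T T f" "f \<in> extensional (topspace T)" for f
    using that by (auto simp: Bij_def bij_betw_def homeomorphic_eq_everything_map)
  have "subgroup ({f. homeomorphic_map T T f} \<inter> extensional (topspace T)) (BijGroup (topspace T))"
  proof (rule group.subgroupI[OF group_BijGroup])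
    show "{f. homeomorphic_map T T f} \<inter> extensional (topspace T) \<subseteq> carrier (BijGroup (topspace T))"
      using hom_bij by (auto simp: BijGroup_def)
    have "homeomorphic_map T T id" by simp
    then have "homeomorphic_map T T (\<lambda>x\<in>topspace T. x)"
      by (rule homeomorphic_map_eq) simp
    then show "{f. homeomorphic_map T T f} \<inter> extensional (topspace T) \<noteq> {}" by blast
    fix f assume f: "f \<in> {f. homeomorphic_map T T f} \<inter> extensional (topspace T)"
    then have fb: "f \<in> Bij (topspace T)" using hom_bij by blast
    obtain g where g: "homeomorphic_maps T T f g" using f homeomorphic_map_maps by blast
    have inv_eq: "inv_into (topspace T) f x = g x" if "x \<in> topspace T" for x
    proof -
      have "g x \<in> topspace T" "f (g x) = x"
        using g that by (auto simp: homeomorphic_maps_def continuous_map_def)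
      moreover have "inj_on f (topspace T)" using fb by (simp add: Bij_def bij_betw_def)
      ultimately show ?thesis by (metis inv_into_f_f)
    qed
    have "homeomorphic_map T T g" using g homeomorphic_maps_map by blast
    then have "homeomorphic_map T T (\<lambda>x\<in>topspace T. inv_into (topspace T) f x)"
      by (rule homeomorphic_map_eq) (simp add: inv_eq)
    then show "inv\<^bsub>BijGroup (topspace T)\<^esub> f \<in> {f. homeomorphic_map T T f} \<inter> extensional (topspace T)"
      unfolding inv_BijGroup[OF fb] by blast
    fix h assume h: "h \<in> {f. homeomorphic_map T T f} \<inter> extensional (topspace T)"
    then have hb: "h \<in> Bij (topspace T)" using hom_bij by blast
    have "homeomorphic_map T T (f \<circ> h)" using f h homeomorphic_map_compose by blast
    then have "homeomorphic_map T T (compose (topspace T) f h)"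
      by (rule homeomorphic_map_eq) (simp add: compose_def)
    then show "f \<otimes>\<^bsub>BijGroup (topspace T)\<^esub> h \<in> {f. homeomorphic_map T T f} \<inter> extensional (topspace T)"
      using fb hb by (simp add: BijGroup_def)
  qed
  then show ?thesis
    unfolding homeomorphism_group_def by (rule group.subgroup_imp_group[OF group_BijGroup])
qed

lemma group_Aut: "group (Aut \<Omega>)"
  unfolding Aut_def by (rule group_homeomorphism_group)

lemma Aut_carrier:
  "f \<in> carrier (Aut \<Omega>) \<longleftrightarrow>
     homeomorphic_map (subtopology config_topology \<Omega>) (subtopology config_topology \<Omega>) f \<and> f \<in> extensional \<Omega>"
  by (simp add: Aut_def homeomorphism_group_def)

lemma Aut_bij: "f \<in> carrier (Aut \<Omega>) \<Longrightarrow> bij_betw f \<Omega> \<Omega>"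
  by (auto simp: Aut_carrier homeomorphic_eq_everything_map bij_betw_def)

lemma Aut_mult:
  assumes "f \<in> carrier (Aut \<Omega>)" "g \<in> carrier (Aut \<Omega>)"
  shows "f \<otimes>\<^bsub>Aut \<Omega>\<^esub> g = compose \<Omega> f g"
  using assms Aut_bij[OF assms(1)] Aut_bij[OF assms(2)]
  by (auto simp: Aut_carrier) (simp add: Aut_def homeomorphism_group_def BijGroup_def Bij_def)

lemma Aut_one: "\<one>\<^bsub>Aut \<Omega>\<^esub> = (\<lambda>U\<in>\<Omega>. U)"
  by (simp add: Aut_def homeomorphism_group_def BijGroup_def)

lemma Aut_eqI:
  assumes "f \<in> carrier (Aut \<Omega>)" "g \<in> carrier (Aut \<Omega>)" "\<And>U. U \<in> \<Omega> \<Longrightarrow> f U = g U"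
  shows "f = g"
  using assms by (intro extensionalityI[of f \<Omega> g]) (auto simp: Aut_carrier)

lemma Aut_mult_apply:
  "f \<in> carrier (Aut \<Omega>) \<Longrightarrow> g \<in> carrier (Aut \<Omega>) \<Longrightarrow> U \<in> \<Omega> \<Longrightarrow> (f \<otimes>\<^bsub>Aut \<Omega>\<^esub> g) U = f (g U)"
  by (simp add: Aut_mult compose_def)

lemma continuous_map_image:
  assumes "bij a"
  shows "continuous_map config_topology config_topology (image a)"
  unfolding continuous_map_def
proof (intro conjI allI impI)
  fix S assume S: "openin config_topology S"
  show "openin config_topology {U \<in> topspace config_topology. a ` U \<in> S}"
    unfolding openin_config_iff
  proof
    fix U assume "U \<in> {U \<in> topspace config_topology. a ` U \<in> S}"
    then have "a ` U \<in> S" by simp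
    then obtain B where B: "finite B" "cylinder B (a ` U) \<subseteq> S"
      using S unfolding openin_config_iff by blast
    define B' where "B' = a -` B"
    have "finite B'" unfolding B'_def using B(1) assms by (intro finite_vimageI bij_is_inj)
    moreover have "a ` W \<in> cylinder B (a ` U)" if "W \<in> cylinder B' U" for W
      unfolding cylinder_def
    proof (intro CollectI ballI)
      fix y assume y: "y \<in> B"
      obtain x where x: "y = a x" using assms by (meson bij_pointE)
      have "y \<in> a ` V \<longleftrightarrow> x \<in> V" for V unfolding x using assms by (simp add: bij_is_inj inj_image_mem_iff)
      then show "y \<in> a ` W \<longleftrightarrow> y \<in> a ` U" using that x y by (simp add: cylinder_def B'_def)
    qed
    ultimately show "\<exists>B. finite B \<and> cylinder B U \<subseteq> {U \<in> topspace config_topology. a ` U \<in> S}"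
      using B(2) by (intro exI[of _ B']) auto
  qed
qed simp

lemma image_in_Aut:
  assumes a: "bij a" and inv: "\<And>U. a ` U \<in> \<Omega> \<longleftrightarrow> U \<in> \<Omega>"
  shows "(\<lambda>U\<in>\<Omega>. a ` U) \<in> carrier (Aut \<Omega>)"
proof -
  let ?T = "subtopology config_topology \<Omega>"
  define b where "b = inv_into UNIV a"
  have b: "bij b" "\<And>x. a (b x) = x" "\<And>x. b (a x) = x"
    using a by (simp_all add: b_def bij_imp_bij_inv bij_is_surj surj_f_inv_f bij_is_inj)
  have ab: "a ` b ` U = U" "b ` a ` U = U" for U by (simp_all add: image_image b)
  have cont: "continuous_map ?T ?T (image a)"
    by (intro continuous_map_into_subtopology continuous_map_from_subtopology continuous_map_image a)
      (auto simp: inv)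
  have inv': "b ` U \<in> \<Omega> \<longleftrightarrow> U \<in> \<Omega>" for U using inv[of "b ` U"] by (simp add: ab)
  have cont': "continuous_map ?T ?T (image b)"
    by (intro continuous_map_into_subtopology continuous_map_from_subtopology continuous_map_image b)
      (auto simp: inv')
  have "homeomorphic_maps ?T ?T (image a) (image b)"
    unfolding homeomorphic_maps_def using cont cont' ab by simp
  then have "homeomorphic_map ?T ?T (image a)" using homeomorphic_map_maps by blast
  then have "homeomorphic_map ?T ?T (\<lambda>U\<in>\<Omega>. a ` U)" by (rule homeomorphic_map_eq) simp
  then show ?thesis by (simp add: Aut_carrier)
qed

lemma normalizer_iff:
  assumes "H \<subseteq> carrier G"
  shows "g \<in> normalizer G H \<longleftrightarrow> g \<in> carrier G \<and> g <#\<^bsub>G\<^esub> H #>\<^bsub>G\<^esub> (inv\<^bsub>G\<^esub> g) = H"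
  using assms by (auto simp: normalizer_def stabilizer_def)

lemma (in group) normalizer_conj_iff:
  assumes "H \<subseteq> carrier G"
  shows "g \<in> normalizer G H \<longleftrightarrow> g \<in> carrier G \<and> (\<lambda>h. g \<otimes> h \<otimes> inv g) ` H = H"
  unfolding normalizer_iff[OF assms] by (auto simp: l_coset_def r_coset_def image_iff)

section \<open>Affine symmetries of the hull\<close>

text \<open>The inverses of the maps \<open>z \<mapsto> u z\<close> and \<open>z \<mapsto> u gcnj z\<close> are \<open>z \<mapsto> gcnj u z\<close> and \<open>z \<mapsto> u gcnj z\<close>.\<close>

lemma (in hull_code) linear_part_matrix: "\<exists>M\<in>dihedral_mats. \<forall>x. m x = M *v x"
proof -
  obtain u where u: "gnorm u = 1" "(\<forall>z. bwd z = u * z) \<or> (\<forall>z. bwd z = u * gcnj z)"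
    using image_origin_and_linear_part by blast
  have bwd_m: "bwd (to_gint (m x)) = to_gint x" for x by simp
  from u(2) show ?thesis
  proof
    assume f: "\<forall>z. bwd z = u * z"
    have "to_gint (m x) = gcnj u * to_gint x" for x
    proof -
      have "to_gint x = u * to_gint (m x)" using f bwd_m by metis
      then show ?thesis using gnorm_1_inverse[OF u(1)] by (simp add: mult.assoc[symmetric])
    qed
    then have "to_gint (m x) = to_gint (mulmat (gcnj u) *v x)" for x by (simp add: to_gint_mulmat)
    then have "m x = mulmat (gcnj u) *v x" for x by (simp only: to_gint_eq_iff)
    then show ?thesis using mulmat_in[of "gcnj u"] u(1) by (intro bexI[of _ "mulmat (gcnj u)"]) simp_all
  next
    assume f: "\<forall>z. bwd z = u * gcnj z"
    have "to_gint (m x) = u * gcnj (to_gint x)" for x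
    proof -
      have "to_gint x = u * gcnj (to_gint (m x))" using f bwd_m by metis
      then have "gcnj (to_gint x) = gcnj u * to_gint (m x)" by simp
      then show ?thesis using gnorm_1_inverse[OF u(1)] by (simp add: mult.assoc[symmetric])
    qed
    then have "to_gint (m x) = to_gint ((mulmat u ** cnjmat) *v x)" for x
      by (simp only: matrix_vector_mul_assoc[symmetric] to_gint_mulmat to_gint_cnjmat)
    then have "m x = (mulmat u ** cnjmat) *v x" for x by (simp only: to_gint_eq_iff)
    then show ?thesis using mulmat_cnj_in[of u] u(1) by (intro bexI[of _ "mulmat u ** cnjmat"]) simp_all
  qed
qed

lemma kfree_unit_mult: "gnorm u = 1 \<Longrightarrow> kfree k (u * z) \<longleftrightarrow> kfree k z"
  by (simp add: kfree_def unit_dvd_iff)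

lemma kfree_gcnj: "kfree k (gcnj z) \<longleftrightarrow> kfree k z"
proof -
  have "kfree k (gcnj z)" if z: "kfree k z" for z
    unfolding kfree_def
  proof
    assume "\<exists>p. prime_elem p \<and> p ^ k dvd gcnj z"
    then obtain p where "prime_elem p" "p ^ k dvd gcnj z" by blast
    then have "prime_elem (gcnj p)" "gcnj p ^ k dvd z"
      using gcnj_dvd_swap[of "p ^ k" z] by (simp_all add: prime_elem_gcnj)
    then show False using z by (auto simp: kfree_def)
  qed
  from this[of z] this[of "gcnj z"] show ?thesis by auto
qed

lemma kfree_dihedral: "M \<in> dihedral_mats \<Longrightarrow> M *v x \<in> kfree_set k \<longleftrightarrow> x \<in> kfree_set k"
  by (erule dihedral_mats_cases)
    (simp_all add: kfree_set_def to_gint_mulmat to_gint_cnjmat kfree_unit_mult kfree_gcnj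
      matrix_vector_mul_assoc[symmetric])

lemma inverse_image_mem:
  fixes M M' :: "int ^ 2 ^ 2"
  assumes "M ** M' = mat 1" "M' ** M = mat 1"
  shows "y \<in> (\<lambda>x. M *v x) ` U \<longleftrightarrow> M' *v y \<in> U"
proof
  assume "y \<in> (\<lambda>x. M *v x) ` U"
  then show "M' *v y \<in> U" using assms by (auto simp: matrix_vector_mul_assoc)
next
  assume "M' *v y \<in> U"
  then show "y \<in> (\<lambda>x. M *v x) ` U"
    using assms by (intro image_eqI[of _ _ "M' *v y"]) (simp_all add: matrix_vector_mul_assoc)
qed

text \<open>The pattern of \<open>M U\<close> at \<open>B\<close> is the pattern of \<open>U\<close> at the preimage of \<open>B\<close>.\<close>

lemma shift_hull_linear_image:
  assumes M: "M ** M' = mat 1" "M' ** M = mat 1"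
    and V: "\<And>x. M *v x \<in> V \<longleftrightarrow> x \<in> V" and U: "U \<in> shift_hull V"
  shows "(\<lambda>x. M *v x) ` U \<in> shift_hull V"
  unfolding shift_hull_iff
proof (intro allI impI)
  fix B :: "(int ^ 2) set" assume "finite B"
  then obtain t where t: "\<And>x. x \<in> (\<lambda>y. M' *v y) ` B \<Longrightarrow> x \<in> U \<longleftrightarrow> x + t \<in> V"
    using U[unfolded shift_hull_iff, rule_format, of "(\<lambda>y. M' *v y) ` B"] by auto
  have "y \<in> (\<lambda>x. M *v x) ` U \<longleftrightarrow> y + M *v t \<in> V" if "y \<in> B" for y
  proof -
    have "y \<in> (\<lambda>x. M *v x) ` U \<longleftrightarrow> M' *v y + t \<in> V"
      unfolding inverse_image_mem[OF M] using t that by blast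
    also have "\<dots> \<longleftrightarrow> M *v (M' *v y + t) \<in> V" using V by simp
    also have "M *v (M' *v y + t) = y + M *v t"
      by (simp add: matrix_vector_right_distrib matrix_vector_mul_assoc M)
    finally show ?thesis .
  qed
  then show "\<exists>t. \<forall>x\<in>B. x \<in> (\<lambda>x. M *v x) ` U \<longleftrightarrow> x + t \<in> V" by blast
qed

lemma linear_image_hull_iff:
  assumes M: "M ** M' = mat 1" "M' ** M = mat 1"
    and V: "\<And>x. M *v x \<in> V \<longleftrightarrow> x \<in> V"
  shows "(\<lambda>x. M *v x) ` U \<in> shift_hull V \<longleftrightarrow> U \<in> shift_hull V"
proof
  have V': "M' *v x \<in> V \<longleftrightarrow> x \<in> V" for x
    using V[of "M' *v x"] by (simp add: matrix_vector_mul_assoc M)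
  assume "(\<lambda>x. M *v x) ` U \<in> shift_hull V"
  from shift_hull_linear_image[OF M(2,1) V' this] show "U \<in> shift_hull V"
    by (simp add: image_image matrix_vector_mul_assoc M)
qed (rule shift_hull_linear_image[OF M V])

lemma bij_matrix:
  fixes M M' :: "int ^ 2 ^ 2"
  assumes "M ** M' = mat 1" "M' ** M = mat 1"
  shows "bij (\<lambda>x. M *v x)"
  by (rule o_bij[of "\<lambda>x. M' *v x"]) (simp_all add: fun_eq_iff matrix_vector_mul_assoc assms)

locale kfree_shift =
  fixes k :: nat and V :: "(int ^ 2) set" and \<Omega> :: "(int ^ 2) set set"
  assumes k2: "k \<ge> 2" and V_def: "V = kfree_set k" and \<Omega>_def: "\<Omega> = shift_hull V"
begin

abbreviation aut_mult (infixl \<open>\<odot>\<close> 70) where "f \<odot> g \<equiv> f \<otimes>\<^bsub>Aut \<Omega>\<^esub> g"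
abbreviation "ainv f \<equiv> inv\<^bsub>Aut \<Omega>\<^esub> f"
abbreviation "aid \<equiv> \<one>\<^bsub>Aut \<Omega>\<^esub>"

lemma \<Omega>_eq: "\<Omega> = {U. adm k U}"
  using shift_hull_kfree[OF k2] by (simp add: V_def \<Omega>_def)

lemma closed_\<Omega>: "closedin config_topology \<Omega>"
  by (simp add: \<Omega>_def shift_hull_def closedin_closure_of)

lemma singleton_in: "{x} \<in> \<Omega>"
  using admissible_singleton[of k "to_gint x"] k2 by (simp add: \<Omega>_eq adm_def)

lemma translate_iff: "(\<lambda>x. t + x) ` U \<in> \<Omega> \<longleftrightarrow> U \<in> \<Omega>"
proof
  assume "(\<lambda>x. t + x) ` U \<in> \<Omega>"
  then have "adm k ((\<lambda>x. t + x) ` U)" by (simp only: \<Omega>_eq mem_Collect_eq)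
  then have "adm k ((\<lambda>x. - t + x) ` (\<lambda>x. t + x) ` U)" by (rule adm_translate)
  moreover have "(\<lambda>x. - t + x) ` (\<lambda>x. t + x) ` U = U" unfolding image_image by simp
  ultimately show "U \<in> \<Omega>" by (simp only: \<Omega>_eq mem_Collect_eq)
qed (use adm_translate in \<open>simp add: \<Omega>_eq\<close>)

interpretation A: group "Aut \<Omega>" by (rule group_Aut)

lemma hull_code_of_Aut:
  assumes f: "f \<in> carrier (Aut \<Omega>)" and m: "\<And>x y. m (x + y) = m x + m y" "bij m"
    and eq: "\<And>t U. U \<in> \<Omega> \<Longrightarrow> f ((\<lambda>x. t + x) ` U) = (\<lambda>x. m t + x) ` f U"
  shows "hull_code k \<Omega> f m"
proof
  show "continuous_map (subtopology config_topology \<Omega>) (subtopology config_topology \<Omega>) f"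
    using f by (simp add: Aut_carrier homeomorphic_imp_continuous_map)
qed (use k2 \<Omega>_eq closed_\<Omega> Aut_bij[OF f] m eq in simp_all)

lemma dihedral_mats_hull:
  assumes "M \<in> dihedral_mats"
  shows "(\<lambda>x. M *v x) ` U \<in> \<Omega> \<longleftrightarrow> U \<in> \<Omega>"
  using dihedral_mats_inverse[OF assms] linear_image_hull_iff[of M _ V U] kfree_dihedral[OF assms]
  by (auto simp: \<Omega>_def V_def)

text \<open>A matrix preserving \<open>V\<close> acts on the hull by a homeomorphism that normalises the shift, so it is subject to the
  same rigidity as any other such homeomorphism.\<close>

lemma stab_eq: "stab V = dihedral_mats"
proof (rule equalityI)
  show "dihedral_mats \<subseteq> stab V"
  proof
    fix M assume M: "M \<in> dihedral_mats"
    obtain M' where M': "M' \<in> dihedral_mats" "M' ** M = mat 1" "M ** M' = mat 1"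
      using dihedral_mats_inverse[OF M] by blast
    have "(\<lambda>x. M *v x) ` V = V"
      using inverse_image_mem[OF M'(3,2)] kfree_dihedral[OF M'(1)] by (auto simp: V_def)
    then show "M \<in> stab V"
      using dihedral_mats_invertible[OF M] by (simp add: stab_def stabilizer_def GL2Z_def)
  qed
  show "stab V \<subseteq> dihedral_mats"
  proof
    fix M assume "M \<in> stab V"
    then obtain M' where MV: "(\<lambda>x. M *v x) ` V = V" and M': "M ** M' = mat 1" "M' ** M = mat 1"
      by (auto simp: stab_def stabilizer_def GL2Z_def invertible_def)
    have bijM: "bij (\<lambda>x. M *v x)" using M' by (rule bij_matrix)
    have "M *v x \<in> V \<longleftrightarrow> x \<in> V" for x
      using inverse_image_mem[OF M', of "M *v x" V] MV by (simp add: matrix_vector_mul_assoc M')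
    then have "(\<lambda>x. M *v x) ` U \<in> \<Omega> \<longleftrightarrow> U \<in> \<Omega>" for U
      unfolding \<Omega>_def by (rule linear_image_hull_iff[OF M'])
    then have "(\<lambda>U\<in>\<Omega>. (\<lambda>x. M *v x) ` U) \<in> carrier (Aut \<Omega>)" by (rule image_in_Aut[OF bijM])
    then have "hull_code k \<Omega> (\<lambda>U\<in>\<Omega>. (\<lambda>x. M *v x) ` U) (\<lambda>x. M *v x)"
      by (rule hull_code_of_Aut)
        (simp_all add: matrix_vector_right_distrib bijM translate_iff image_image)
    then obtain N where "N \<in> dihedral_mats" "\<forall>x. M *v x = N *v x"
      using hull_code.linear_part_matrix by blast
    then show "M \<in> dihedral_mats" by (simp add: matrix_eq[symmetric])
  qed
qed

lemma affine_in_Aut: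
  assumes "M \<in> dihedral_mats"
  shows "affine_action \<Omega> t M \<in> carrier (Aut \<Omega>)"
proof -
  obtain M' where M': "M' ** M = mat 1" "M ** M' = mat 1"
    using dihedral_mats_inverse[OF assms] by blast
  have eq: "(\<lambda>x. M *v x + t) ` U = (\<lambda>x. t + x) ` (\<lambda>x. M *v x) ` U" for U
    by (simp add: image_image add.commute)
  have "(\<lambda>x. M *v x + t) = (\<lambda>x. t + x) \<circ> (\<lambda>x. M *v x)" by (simp add: fun_eq_iff add.commute)
  then have "bij (\<lambda>x. M *v x + t)"
    using bij_comp[OF bij_matrix[OF M'(2,1)] bij_plus[of t]] by simp
  then show ?thesis
    unfolding affine_action_def
    by (rule image_in_Aut) (simp only: eq translate_iff dihedral_mats_hull[OF assms])
qed

lemma affine_apply: "U \<in> \<Omega> \<Longrightarrow> affine_action \<Omega> t M U = (\<lambda>x. M *v x + t) ` U"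
  by (simp add: affine_action_def)

lemma affine_in_\<Omega>: "M \<in> dihedral_mats \<Longrightarrow> U \<in> \<Omega> \<Longrightarrow> (\<lambda>x. M *v x + t) ` U \<in> \<Omega>"
  using Aut_bij[OF affine_in_Aut, of M t] affine_apply[of U t M] by (metis bij_betw_apply)

lemma affine_mult:
  assumes "M \<in> dihedral_mats" "N \<in> dihedral_mats"
  shows "affine_action \<Omega> s M \<odot> affine_action \<Omega> t N = affine_action \<Omega> (M *v t + s) (M ** N)"
proof (rule Aut_eqI[of _ \<Omega>])
  show "affine_action \<Omega> s M \<odot> affine_action \<Omega> t N \<in> carrier (Aut \<Omega>)"
    using affine_in_Aut assms by simp
  show "affine_action \<Omega> (M *v t + s) (M ** N) \<in> carrier (Aut \<Omega>)"
    using affine_in_Aut dihedral_mats_mult assms by simp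
  fix U assume U: "U \<in> \<Omega>"
  then show "(affine_action \<Omega> s M \<odot> affine_action \<Omega> t N) U = affine_action \<Omega> (M *v t + s) (M ** N) U"
    using affine_in_\<Omega>[OF assms(2) U, of t]
    by (simp add: Aut_mult_apply affine_in_Aut assms affine_apply image_image
        matrix_vector_right_distrib matrix_vector_mul_assoc add.assoc)
qed

lemma mat_1_in: "mat 1 \<in> dihedral_mats"
  using mulmat_in[of 1] by (simp add: mulmat_1)

lemma affine_eq_iff:
  assumes "affine_action \<Omega> s M = affine_action \<Omega> t N"
  shows "s = t \<and> M = N"
proof -
  have "affine_action \<Omega> s M {x} = affine_action \<Omega> t N {x}" for x using assms by simp
  then have eq: "M *v x + s = N *v x + t" for x by (simp add: affine_apply singleton_in)
  from eq[of 0] have "s = t" by simp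
  then show ?thesis using eq by (simp add: matrix_eq)
qed

lemma shift_eq_affine: "shift \<Omega> t = affine_action \<Omega> (- t) (mat 1)"
  by (simp add: shift_def affine_action_def)

lemma linear_eq_affine: "linear_action \<Omega> M = affine_action \<Omega> 0 M"
  by (simp add: linear_action_def affine_action_def)

lemma one_eq_affine: "aid = affine_action \<Omega> 0 (mat 1)"
  by (simp add: Aut_one affine_action_def)

lemma shift_in_Aut: "shift \<Omega> t \<in> carrier (Aut \<Omega>)"
  unfolding shift_eq_affine by (rule affine_in_Aut[OF mat_1_in])

lemma shift_mult: "shift \<Omega> s \<odot> shift \<Omega> t = shift \<Omega> (s + t)"
  by (simp add: shift_eq_affine affine_mult mat_1_in algebra_simps)

lemma shift_eq_iff: "shift \<Omega> s = shift \<Omega> t \<longleftrightarrow> s = t"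
  unfolding shift_eq_affine using affine_eq_iff[of "- s" "mat 1" "- t" "mat 1"] by auto

lemma shift_apply: "U \<in> \<Omega> \<Longrightarrow> shift \<Omega> (- t) U = (\<lambda>x. t + x) ` U"
  by (simp add: shift_def add.commute)

lemma affine_shift:
  assumes "M \<in> dihedral_mats"
  shows "affine_action \<Omega> t M \<odot> shift \<Omega> s = shift \<Omega> (M *v s) \<odot> affine_action \<Omega> t M"
proof -
  have "M *v (- s) = - (M *v s)"
    using matrix_vector_right_distrib[of M s "- s"] by (simp add: eq_neg_iff_add_eq_0 add.commute)
  then show ?thesis
    unfolding shift_eq_affine by (simp add: affine_mult assms mat_1_in add.commute)
qed

lemma shift_group_subset: "shift_group \<Omega> \<subseteq> carrier (Aut \<Omega>)"
  using shift_in_Aut by (auto simp: shift_group_def)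

lemma subgroup_shift_group: "subgroup (shift_group \<Omega>) (Aut \<Omega>)"
proof (rule A.subgroupI[OF shift_group_subset])
  show "shift_group \<Omega> \<noteq> {}" by (auto simp: shift_group_def)
  fix f assume "f \<in> shift_group \<Omega>"
  then obtain t where t: "f = shift \<Omega> t" by (auto simp: shift_group_def)
  have "shift \<Omega> (- t) \<odot> f = aid"
    unfolding t shift_mult by (simp add: one_eq_affine shift_eq_affine)
  then have "ainv f = shift \<Omega> (- t)"
    using shift_in_Aut t by (intro A.inv_equality) auto
  then show "ainv f \<in> shift_group \<Omega>" by (simp add: shift_group_def)
  fix g assume "g \<in> shift_group \<Omega>"
  then show "f \<odot> g \<in> shift_group \<Omega>" using t by (auto simp: shift_group_def shift_mult)
qed

text \<open>The rigidity theorem in group-theoretic form, common to the computation of the centraliser (\<open>m\<close> the identity) and of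
  the normaliser.\<close>

lemma Aut_shift_equivariant:
  assumes f: "f \<in> carrier (Aut \<Omega>)" and eq: "\<And>t. f \<odot> shift \<Omega> t = shift \<Omega> (m t) \<odot> f"
    and add: "\<And>x y. m (x + y) = m x + m y" and "bij m"
  shows "\<exists>s. \<exists>M\<in>dihedral_mats. (\<forall>x. m x = M *v x) \<and> f = affine_action \<Omega> s M"
proof -
  have "m 0 = 0" using add[of 0 0] by simp
  then have neg: "m (- t) = - m t" for t
    using add[of t "- t"] by (simp add: eq_neg_iff_add_eq_0 add.commute)
  interpret hull_code k \<Omega> f m
  proof (rule hull_code_of_Aut[OF f add \<open>bij m\<close>])
    fix t U assume U: "U \<in> \<Omega>"
    have fU: "f U \<in> \<Omega>" using Aut_bij[OF f] U by (rule bij_betw_apply)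
    have "(f \<odot> shift \<Omega> (- t)) U = (shift \<Omega> (- m t) \<odot> f) U"
      using eq[of "- t"] by (simp add: neg)
    then show "f ((\<lambda>x. t + x) ` U) = (\<lambda>x. m t + x) ` f U"
      using f shift_in_Aut U fU by (simp only: Aut_mult_apply shift_apply)
  qed
  obtain M where M: "M \<in> dihedral_mats" "\<forall>x. m x = M *v x" using linear_part_matrix by blast
  have "f = affine_action \<Omega> offset M"
    by (rule Aut_eqI[OF f affine_in_Aut[OF M(1)]]) (simp add: \<phi>_affine affine_apply M(2))
  then show ?thesis using M by blast
qed

lemma symmetry_group_eq: "symmetry_group \<Omega> = shift_group \<Omega>"
proof (rule equalityI)
  show "shift_group \<Omega> \<subseteq> symmetry_group \<Omega>"
    using shift_in_Aut by (auto simp: symmetry_group_def centralizer_def shift_group_def shift_mult add.commute)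
  show "symmetry_group \<Omega> \<subseteq> shift_group \<Omega>"
  proof
    fix f assume "f \<in> symmetry_group \<Omega>"
    then have f: "f \<in> carrier (Aut \<Omega>)" "\<And>t. f \<odot> shift \<Omega> t = shift \<Omega> t \<odot> f"
      by (auto simp: symmetry_group_def centralizer_def shift_group_def)
    obtain s M where "\<forall>x. x = M *v x" "f = affine_action \<Omega> s M"
      using Aut_shift_equivariant[of f "\<lambda>x. x", OF f refl] by (auto simp: bij_def)
    then have "M = mat 1" by (simp add: matrix_eq)
    then have "f = shift \<Omega> (- s)" using \<open>f = affine_action \<Omega> s M\<close> by (simp add: shift_eq_affine)
    then show "f \<in> shift_group \<Omega>" by (simp add: shift_group_def)
  qed
qed

lemma conj_iff:
  assumes "f \<in> carrier (Aut \<Omega>)" "g \<in> carrier (Aut \<Omega>)" "h \<in> carrier (Aut \<Omega>)"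
  shows "f \<odot> g \<odot> ainv f = h \<longleftrightarrow> f \<odot> g = h \<odot> f"
proof
  assume "f \<odot> g \<odot> ainv f = h"
  then show "f \<odot> g = h \<odot> f" using assms by (auto simp: A.m_assoc)
next
  assume "f \<odot> g = h \<odot> f"
  then show "f \<odot> g \<odot> ainv f = h" using assms by (simp add: A.m_assoc)
qed

text \<open>Conjugation by an element of the normaliser permutes the translations and, since these form a
  faithful copy of the lattice, defines the automorphism \<open>m\<close> of the lattice.\<close>

lemma extended_symmetry_group_eq:
  "extended_symmetry_group \<Omega> = {affine_action \<Omega> t M | t M. M \<in> dihedral_mats}"
proof (rule equalityI)
  show "{affine_action \<Omega> t M | t M. M \<in> dihedral_mats} \<subseteq> extended_symmetry_group \<Omega>"
  proof
    fix f assume "f \<in> {affine_action \<Omega> t M | t M. M \<in> dihedral_mats}"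
    then obtain t M where M: "M \<in> dihedral_mats" "f = affine_action \<Omega> t M" by blast
    have f: "f \<in> carrier (Aut \<Omega>)" using M affine_in_Aut by simp
    obtain M' where M': "M ** M' = mat 1" using dihedral_mats_inverse[OF M(1)] by blast
    have conj: "f \<odot> shift \<Omega> s \<odot> ainv f = shift \<Omega> (M *v s)" for s
      using affine_shift[OF M(1), of t s] M(2) conj_iff[OF f shift_in_Aut[of s] shift_in_Aut[of "M *v s"]]
      by simp
    have "shift \<Omega> s \<in> range (\<lambda>s. shift \<Omega> (M *v s))" for s
      by (rule image_eqI[of _ _ "M' *v s"]) (simp_all add: matrix_vector_mul_assoc M')
    then have "range (\<lambda>s. shift \<Omega> (M *v s)) = range (shift \<Omega>)" by auto
    then have "(\<lambda>h. f \<odot> h \<odot> ainv f) ` shift_group \<Omega> = shift_group \<Omega>"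
      by (simp only: shift_group_def image_image conj)
    then show "f \<in> extended_symmetry_group \<Omega>"
      unfolding extended_symmetry_group_def A.normalizer_conj_iff[OF shift_group_subset] using f by simp
  qed
  show "extended_symmetry_group \<Omega> \<subseteq> {affine_action \<Omega> t M | t M. M \<in> dihedral_mats}"
  proof
    fix f assume "f \<in> extended_symmetry_group \<Omega>"
    then have f: "f \<in> carrier (Aut \<Omega>)"
      and conj: "(\<lambda>h. f \<odot> h \<odot> ainv f) ` shift_group \<Omega> = shift_group \<Omega>"
      unfolding extended_symmetry_group_def A.normalizer_conj_iff[OF shift_group_subset] by simp_all
    have "\<exists>s. f \<odot> shift \<Omega> t = shift \<Omega> s \<odot> f" for t
    proof -
      have "f \<odot> shift \<Omega> t \<odot> ainv f \<in> shift_group \<Omega>"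
        using conj by (auto simp: shift_group_def)
      then obtain s where "f \<odot> shift \<Omega> t \<odot> ainv f = shift \<Omega> s"
        by (auto simp: shift_group_def)
      then show ?thesis using conj_iff[OF f shift_in_Aut shift_in_Aut] by blast
    qed
    then obtain m where m: "\<And>t. f \<odot> shift \<Omega> t = shift \<Omega> (m t) \<odot> f" by metis
    have uniq: "s = s'" if "shift \<Omega> s \<odot> f = shift \<Omega> s' \<odot> f" for s s'
      using that f shift_in_Aut by (simp add: shift_eq_iff)
    have add: "m (x + y) = m x + m y" for x y
    proof (rule uniq)
      have "shift \<Omega> (m (x + y)) \<odot> f = (f \<odot> shift \<Omega> x) \<odot> shift \<Omega> y"
        using f shift_in_Aut by (simp add: m[symmetric] shift_mult[symmetric] A.m_assoc)
      also have "\<dots> = shift \<Omega> (m x) \<odot> (f \<odot> shift \<Omega> y)"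
        using f shift_in_Aut by (simp add: m[of x] A.m_assoc)
      also have "\<dots> = shift \<Omega> (m x + m y) \<odot> f"
        using f shift_in_Aut by (simp add: m[of y] shift_mult[symmetric] A.m_assoc)
      finally show "shift \<Omega> (m (x + y)) \<odot> f = shift \<Omega> (m x + m y) \<odot> f" .
    qed
    have "bij m"
      unfolding bij_def
    proof
      show "inj m"
      proof (rule injI)
        fix x y assume "m x = m y"
        then have "f \<odot> shift \<Omega> x = f \<odot> shift \<Omega> y" by (simp add: m)
        then show "x = y" using f shift_in_Aut by (simp add: shift_eq_iff)
      qed
      have "\<exists>t. s = m t" for s
      proof -
        have "shift \<Omega> s \<in> (\<lambda>h. f \<odot> h \<odot> ainv f) ` shift_group \<Omega>"
          unfolding conj by (simp add: shift_group_def)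
        then obtain t where "f \<odot> shift \<Omega> t \<odot> ainv f = shift \<Omega> s"
          by (auto simp: shift_group_def)
        then have "f \<odot> shift \<Omega> t = shift \<Omega> s \<odot> f"
          using conj_iff[OF f shift_in_Aut shift_in_Aut] by blast
        then have "shift \<Omega> (m t) \<odot> f = shift \<Omega> s \<odot> f" by (simp only: m)
        then have "m t = s" by (rule uniq)
        then show ?thesis by blast
      qed
      then show "surj m" by (metis surjI surj_def)
    qed
    then show "f \<in> {affine_action \<Omega> t M | t M. M \<in> dihedral_mats}"
      using Aut_shift_equivariant[OF f m add] by blast
  qed
qed

lemma shift_iso: "shift \<Omega> \<in> iso lattice_group (Aut \<Omega> \<lparr>carrier := shift_group \<Omega>\<rparr>)"
  unfolding iso_def
proof (intro CollectI conjI)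
  show "shift \<Omega> \<in> hom lattice_group (Aut \<Omega> \<lparr>carrier := shift_group \<Omega>\<rparr>)"
    by (rule homI) (simp_all add: lattice_group_def shift_group_def shift_mult)
  show "bij_betw (shift \<Omega>) (carrier lattice_group) (carrier (Aut \<Omega> \<lparr>carrier := shift_group \<Omega>\<rparr>))"
    by (simp add: bij_betw_def lattice_group_def shift_group_def inj_on_def shift_eq_iff)
qed

lemma linear_mult:
  "M \<in> dihedral_mats \<Longrightarrow> N \<in> dihedral_mats \<Longrightarrow>
     linear_action \<Omega> (M ** N) = linear_action \<Omega> M \<odot> linear_action \<Omega> N"
  by (simp add: linear_eq_affine affine_mult)

lemma linear_iso:
  "linear_action \<Omega> \<in> iso (GL2Z \<lparr>carrier := dihedral_mats\<rparr>)
     (Aut \<Omega> \<lparr>carrier := linear_action \<Omega> ` dihedral_mats\<rparr>)"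
  unfolding iso_def
proof (intro CollectI conjI)
  show "linear_action \<Omega> \<in> hom (GL2Z \<lparr>carrier := dihedral_mats\<rparr>)
      (Aut \<Omega> \<lparr>carrier := linear_action \<Omega> ` dihedral_mats\<rparr>)"
    by (rule homI) (simp_all add: GL2Z_def linear_mult)
  have "inj_on (linear_action \<Omega>) dihedral_mats"
    unfolding linear_eq_affine by (rule inj_onI) (use affine_eq_iff in blast)
  then show "bij_betw (linear_action \<Omega>) (carrier (GL2Z \<lparr>carrier := dihedral_mats\<rparr>))
      (carrier (Aut \<Omega> \<lparr>carrier := linear_action \<Omega> ` dihedral_mats\<rparr>))"
    by (simp add: bij_betw_def)
qed

lemma subgroup_linear: "subgroup (linear_action \<Omega> ` dihedral_mats) (Aut \<Omega>)"
proof (rule A.subgroupI)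
  show "linear_action \<Omega> ` dihedral_mats \<subseteq> carrier (Aut \<Omega>)"
    using affine_in_Aut by (auto simp: linear_eq_affine)
  show "linear_action \<Omega> ` dihedral_mats \<noteq> {}" using mat_1_in by blast
  fix f assume "f \<in> linear_action \<Omega> ` dihedral_mats"
  then obtain M where M: "M \<in> dihedral_mats" "f = linear_action \<Omega> M" by blast
  obtain M' where M': "M' \<in> dihedral_mats" "M' ** M = mat 1" using dihedral_mats_inverse[OF M(1)] by blast
  have "linear_action \<Omega> M' \<odot> f = aid"
    unfolding M(2) linear_mult[OF M'(1) M(1), symmetric] M'(2) by (simp add: linear_eq_affine one_eq_affine)
  then have "ainv f = linear_action \<Omega> M'"
    by (rule A.inv_equality) (use M M' affine_in_Aut in \<open>simp_all add: linear_eq_affine\<close>)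
  then show "ainv f \<in> linear_action \<Omega> ` dihedral_mats" using M'(1) by simp
  fix g assume "g \<in> linear_action \<Omega> ` dihedral_mats"
  then show "f \<odot> g \<in> linear_action \<Omega> ` dihedral_mats"
    using M dihedral_mats_mult by (auto simp: linear_mult[symmetric])
qed

lemma extended_semidirect:
  "internal_semidirect (Aut \<Omega> \<lparr>carrier := extended_symmetry_group \<Omega>\<rparr>)
     (shift_group \<Omega>) (linear_action \<Omega> ` dihedral_mats)"
proof -
  let ?R = "extended_symmetry_group \<Omega>"
  have "normal (shift_group \<Omega>) (Aut \<Omega> \<lparr>carrier := ?R\<rparr>)"
    unfolding extended_symmetry_group_def by (rule A.subgroup_in_normalizer[OF subgroup_shift_group])
  moreover have "subgroup (linear_action \<Omega> ` dihedral_mats) (Aut \<Omega> \<lparr>carrier := ?R\<rparr>)"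
  proof (rule A.subgroup_incl[OF subgroup_linear])
    show "subgroup ?R (Aut \<Omega>)"
      unfolding extended_symmetry_group_def by (rule A.normalizer_imp_subgroup[OF shift_group_subset])
    show "linear_action \<Omega> ` dihedral_mats \<subseteq> ?R"
      unfolding extended_symmetry_group_eq linear_eq_affine by blast
  qed
  moreover have "shift_group \<Omega> \<inter> linear_action \<Omega> ` dihedral_mats = {\<one>\<^bsub>Aut \<Omega> \<lparr>carrier := ?R\<rparr>\<^esub>}"
  proof -
    have "affine_action \<Omega> (- t) (mat 1) = aid"
      if "affine_action \<Omega> (- t) (mat 1) = affine_action \<Omega> 0 M" for t M
      using affine_eq_iff[OF that] by (simp add: one_eq_affine)
    moreover have "aid \<in> shift_group \<Omega>" using subgroup.one_closed[OF subgroup_shift_group] .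
    moreover have "aid \<in> linear_action \<Omega> ` dihedral_mats" using subgroup.one_closed[OF subgroup_linear] .
    ultimately show ?thesis by (auto simp: shift_group_def shift_eq_affine linear_eq_affine)
  qed
  moreover have "shift_group \<Omega> <#>\<^bsub>Aut \<Omega> \<lparr>carrier := ?R\<rparr>\<^esub> linear_action \<Omega> ` dihedral_mats
      = carrier (Aut \<Omega> \<lparr>carrier := ?R\<rparr>)"
  proof -
    have prod: "shift \<Omega> s \<odot> linear_action \<Omega> M = affine_action \<Omega> (- s) M" if "M \<in> dihedral_mats" for s M
      using that by (simp add: shift_eq_affine linear_eq_affine affine_mult mat_1_in)
    have elem: "f \<in> shift_group \<Omega> <#>\<^bsub>Aut \<Omega> \<lparr>carrier := ?R\<rparr>\<^esub> linear_action \<Omega> ` dihedral_mats \<longleftrightarrow>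
        (\<exists>s M. M \<in> dihedral_mats \<and> f = shift \<Omega> s \<odot> linear_action \<Omega> M)" for f
      by (auto simp: set_mult_def shift_group_def)
    have "f \<in> ?R \<longleftrightarrow> (\<exists>s M. M \<in> dihedral_mats \<and> f = affine_action \<Omega> (- s) M)" for f
      unfolding extended_symmetry_group_eq by (auto intro: exI[of _ "- _"]) (metis minus_minus)
    then have "f \<in> ?R \<longleftrightarrow> (\<exists>s M. M \<in> dihedral_mats \<and> f = shift \<Omega> s \<odot> linear_action \<Omega> M)" for f
      using prod by metis
    then show ?thesis using elem by (intro Set.set_eqI) simp
  qed
  ultimately show ?thesis unfolding internal_semidirect_def by blast
qed

end

theorem theorem6p4:
  fixes k :: nat and V :: "(int ^ 2) set" and \<Omega> :: "(int ^ 2) set set"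
    and S R :: "((int ^ 2) set \<Rightarrow> (int ^ 2) set) set"
  assumes "k \<ge> 2"
    and "V = gauss_kfree k"
    and "\<Omega> = shift_hull V"
    and "S = symmetry_group \<Omega>"
    and "R = extended_symmetry_group \<Omega>"
  shows
    "S = shift_group \<Omega> \<and>
     shift \<Omega> \<in> iso lattice_group (Aut \<Omega> \<lparr>carrier := S\<rparr>) \<and>
     internal_semidirect (Aut \<Omega> \<lparr>carrier := R\<rparr>) S (linear_action \<Omega> ` stab V) \<and>
     linear_action \<Omega> \<in> iso (stab_group V) (Aut \<Omega> \<lparr>carrier := linear_action \<Omega> ` stab V\<rparr>) \<and>
     R = {affine_action \<Omega> t M | t M. M \<in> stab V} \<and>
     stab_group V \<cong> dihedral_group 4 \<and>
     real_matrix ` stab V = square_symmetries \<and>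
     internal_semidirect (stab_group V) C4 C2 \<and>
     GL2Z \<lparr>carrier := C4\<rparr> \<cong> integer_mod_group 4 \<and>
     GL2Z \<lparr>carrier := C2\<rparr> \<cong> integer_mod_group 2 \<and>
     maximal_finite_subgroup (stab V) GL2Z \<and>
     unit_matrix \<in> iso (units_of gauss_ring) (GL2Z \<lparr>carrier := C4\<rparr>) \<and>
     gauss_matrix \<in> iso (ring_automorphism_group gauss_field) (GL2Z \<lparr>carrier := C2\<rparr>) \<and>
     carrier (ring_automorphism_group gauss_field) =
       generate (ring_automorphism_group gauss_field) {restrict cnj (carrier gauss_field)}"
proof -
  interpret kfree_shift k V \<Omega>
    by standard (use assms gauss_kfree_eq in auto)
  have S: "S = shift_group \<Omega>" using assms(4) symmetry_group_eq by simp
  show ?thesis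
    unfolding S assms(5) stab_eq
    by (intro conjI refl shift_iso extended_semidirect linear_iso extended_symmetry_group_eq
        dihedral_mats_cong_dihedral_group real_matrix_dihedral_mats maximal_finite_dihedral_mats
        unit_matrix_iso gauss_matrix_iso gauss_automorphisms_generated
        semidirect_dihedral_mats[folded C4_eq C2_eq] rotation_mats_cong[folded C4_eq]
        reflection_mats_cong[folded C2_eq])
qed

end
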